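(* Let $W(x) = \frac12 |x|$ on $\mathbb{R}$. Let $\rho_0 \in \mathcal{P}_2(\mathbb{R})$, let $c > 1/2$ and set $\sigma_0 = a[\rho_0]\rho_0$. There exists a constant $C>0$ such that, for every $\varepsilon > 0$, denoting by $(\rho^\varepsilon, \sigma^\varepsilon)$ the solution of the relaxation system $$\partial_t \rho + \partial_x \sigma = 0, \qquad \partial_t \sigma + c^2 \partial_x \rho = \frac{1}{\varepsilon}\big(a[\rho]\rho - \sigma\big), \qquad a[\rho] = -W' * \rho,$$ with initial data $(\rho_0, \sigma_0)$, one has $$\forall T>0, \qquad W_1\big(\rho(T), \rho^\varepsilon(T)\big) \leq C\big(\sqrt{\varepsilon T} + \varepsilon\big),$$ where $\rho \in C([0,+\infty), \mathcal{P}_2(\mathbb{R}))$ is the unique solution of the aggregation equation $\partial_t \rho + \partial_x(a[\rho]\rho) = 0$ with initial datum $\rho_0$.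
   Context: $\mathcal{P}_2(\mathbb{R})$ is the set of Borel probability measures on $\mathbb{R}$ with finite second moment. $W_1$ is the Wasserstein distance of order 1; in one dimension $W_1(\mu,\nu) = \int_0^1 |F_\mu^{-1}(z) - F_\nu^{-1}(z)|\,dz$ where $F_\mu(x) = \mu((-\infty,x))$ and $F_\mu^{-1}(z) = \inf\{x : F_\mu(x) > z\}$. For $W(x)=\frac12|x|$ one takes $W'(x) = \frac12\mathrm{sgn}(x)$. The relaxation system is understood through the cumulative variables $u^\varepsilon(t,x) = \frac12 - \int_{-\infty}^x \rho^\varepsilon(t,dy)$, $v^\varepsilon(t,x) = \frac12 - \int_{-\infty}^x \sigma^\varepsilon(t,dy)$, which solve $\partial_t u + \partial_x v = 0$, $\partial_t v + c^2 \partial_x u = \frac1\varepsilon(\frac12 u^2 - v)$ (one has $a[\rho^\varepsilon] = u^\varepsilon$, $\rho^\varepsilon = -\partial_x u^\varepsilon$). The solution $\rho$ of the aggregation equation is characterized by $\rho(t) = -\partial_x u(t)$, where $u$ is the entropy solution of the Burgers equation $\partial_t u + \frac12\partial_x(u^2)=0$ with initial datum $u_0(x) = \frac12 - \rho_0((-\infty,x))$. *)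

theory Defs
  imports "HOL-Probability.Probability"
begin

definition P2 :: "real measure \<Rightarrow> bool" where
  "P2 \<mu> \<longleftrightarrow> prob_space \<mu> \<and> sets \<mu> = sets borel \<and> integrable \<mu> (\<lambda>x. x ^ 2)"

definition cdf_left :: "real measure \<Rightarrow> real \<Rightarrow> real" where
  "cdf_left \<mu> x = measure \<mu> {..<x}"

definition qf :: "real measure \<Rightarrow> real \<Rightarrow> real" where
  "qf \<mu> z = Inf {x. cdf_left \<mu> x > z}"

definition W1 :: "real measure \<Rightarrow> real measure \<Rightarrow> real" where
  "W1 \<mu> \<nu> = (LINT z:{0<..<1}|lborel. \<bar>qf \<mu> z - qf \<nu> z\<bar>)"

definition Wprime :: "real \<Rightarrow> real" where
  "Wprime x = (1/2) * sgn x"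

definition aggr_field :: "real measure \<Rightarrow> real \<Rightarrow> real" where
  "aggr_field \<rho> x = - (LINT y|\<rho>. Wprime (x - y))"

definition u_init :: "real measure \<Rightarrow> real \<Rightarrow> real" where
  "u_init \<rho>0 x = 1/2 - measure \<rho>0 {..<x}"

definition v_init :: "real measure \<Rightarrow> real \<Rightarrow> real" where
  "v_init \<rho>0 x = 1/8 - (LINT y:{..<x}|\<rho>0. aggr_field \<rho>0 y)"

definition test_fun :: "(real \<Rightarrow> real \<Rightarrow> real) \<Rightarrow> (real \<Rightarrow> real \<Rightarrow> real) \<Rightarrow> (real \<Rightarrow> real \<Rightarrow> real) \<Rightarrow> bool" where
  "test_fun \<phi> \<phi>t \<phi>x \<longleftrightarrow>
     (\<forall>t x. ((\<lambda>s. \<phi> s x) has_real_derivative \<phi>t t x) (at t)) \<and>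
     (\<forall>t x. ((\<lambda>y. \<phi> t y) has_real_derivative \<phi>x t x) (at x)) \<and>
     continuous_on UNIV (\<lambda>p. \<phi> (fst p) (snd p)) \<and>
     continuous_on UNIV (\<lambda>p. \<phi>t (fst p) (snd p)) \<and>
     continuous_on UNIV (\<lambda>p. \<phi>x (fst p) (snd p)) \<and>
     (\<exists>a b R. 0 < a \<and> (\<forall>t x. \<not> (a \<le> t \<and> t \<le> b \<and> \<bar>x\<bar> \<le> R) \<longrightarrow> \<phi> t x = 0))"

definition admissible :: "(real \<Rightarrow> real \<Rightarrow> real) \<Rightarrow> bool" where
  "admissible u \<longleftrightarrow>
     set_borel_measurable lborel ({0..} \<times> UNIV) (\<lambda>p. u (fst p) (snd p)) \<and>
     (\<exists>M. \<forall>t\<ge>0. \<forall>x. \<bar>u t x\<bar> \<le> M) \<and>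
     (\<forall>t\<ge>0. \<forall>R. ((\<lambda>s. LINT x:{-R..R}|lborel. \<bar>u s x - u t x\<bar>) \<longlongrightarrow> 0) (at t within {0..}))"

definition burgers_entropy_solution :: "(real \<Rightarrow> real) \<Rightarrow> (real \<Rightarrow> real \<Rightarrow> real) \<Rightarrow> bool" where
  "burgers_entropy_solution u0 u \<longleftrightarrow>
     admissible u \<and> (\<forall>x. u 0 x = u0 x) \<and>
     (\<forall>k \<phi> \<phi>t \<phi>x. test_fun \<phi> \<phi>t \<phi>x \<and> (\<forall>t x. 0 \<le> \<phi> t x) \<longrightarrow>
        0 \<le> (LINT p|lborel. \<bar>u (fst p) (snd p) - k\<bar> * \<phi>t (fst p) (snd p)
               + sgn (u (fst p) (snd p) - k) * ((u (fst p) (snd p))\<^sup>2 / 2 - k\<^sup>2 / 2)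
                 * \<phi>x (fst p) (snd p)))"

text \<open>Weak solution of the relaxation system in cumulative variables:
  d_t u + d_x v = 0,  d_t v + c^2 d_x u = (1/eps)(u^2/2 - v),  (u,v)(0) = (u0,v0).\<close>
definition relax_solution :: "real \<Rightarrow> real \<Rightarrow> (real \<Rightarrow> real) \<Rightarrow> (real \<Rightarrow> real) \<Rightarrow>
    (real \<Rightarrow> real \<Rightarrow> real) \<Rightarrow> (real \<Rightarrow> real \<Rightarrow> real) \<Rightarrow> bool" where
  "relax_solution c \<epsilon> u0 v0 u v \<longleftrightarrow>
     admissible u \<and> admissible v \<and> (\<forall>x. u 0 x = u0 x) \<and> (\<forall>x. v 0 x = v0 x) \<and>
     (\<forall>\<phi> \<phi>t \<phi>x. test_fun \<phi> \<phi>t \<phi>x \<longrightarrow>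
        (LINT p|lborel. u (fst p) (snd p) * \<phi>t (fst p) (snd p)
                        + v (fst p) (snd p) * \<phi>x (fst p) (snd p)) = 0 \<and>
        (LINT p|lborel. v (fst p) (snd p) * \<phi>t (fst p) (snd p)
                        + c\<^sup>2 * u (fst p) (snd p) * \<phi>x (fst p) (snd p)
                        + (1/\<epsilon>) * ((u (fst p) (snd p))\<^sup>2 / 2 - v (fst p) (snd p))
                          * \<phi> (fst p) (snd p)) = 0)"

text \<open>rho(t) = - d_x u(t): rho(t) is a probability measure with rho(t)((-infinity,x)) = 1/2 - u(t,x).\<close>
definition density_of_cumulative :: "(real \<Rightarrow> real measure) \<Rightarrow> (real \<Rightarrow> real \<Rightarrow> real) \<Rightarrow> bool" where
  "density_of_cumulative \<rho> u \<longleftrightarrow>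
     (\<forall>t\<ge>0. prob_space (\<rho> t) \<and> sets (\<rho> t) = sets borel \<and>
             (\<forall>x. measure (\<rho> t) {..<x} = 1/2 - u t x))"

end

theory Submission
  imports Defs
begin

text \<open>
  Write \<open>(u, v)\<close> for the cumulative variables of the relaxation system and \<open>w\<close> for the entropy
  solution. Since \<open>u(t)\<close> is nonincreasing with values in \<open>[-1/2, 1/2]\<close>
  and \<open>c > 1/2\<close>, integrating along the characteristics of speed \<open>\<plusminus> c\<close> shows that \<open>v + c u\<close> is
  nonincreasing and \<open>v - c u\<close> nondecreasing in \<open>x\<close>. Hence mass travels at speed at most \<open>c\<close>,
  and the same integral formula bounds the defect \<open>v - u^2/2\<close> by \<open>O(\<epsilon>)\<close> in \<open>L^1\<close>.
  The primitive \<open>E\<close> of \<open>u - w\<close> solves \<open>E_t + a E_x = -(v - u^2/2)\<close> with \<open>a = (u + w)/2\<close>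
  nonincreasing, so the \<open>L^1\<close> norm of \<open>E(T)\<close> is \<open>O(\<epsilon> T)\<close>. As \<open>u - w\<close> has bounded
  variation, interpolation gives \<open>O(sqrt (\<epsilon> T))\<close> for the \<open>L^1\<close> norm of \<open>u - w\<close>, which
  dominates \<open>W1\<close>. All computations are done after mollification in \<open>x\<close> with a kernel supported
  in \<open>[0, d]\<close>.
\<close>

section \<open>Mollification\<close>

text \<open>The factor \<epsilon> in the defect comes from the weight exp((s -
  t)/\<epsilon>)/\<epsilon> in the characteristic formula: it averages over times t - s of order
  \<epsilon>, and in such a time finite speed lets \<open>u\<close> change only by its oscillation
  over a distance of order c \<epsilon>, whose integral in x is controlled because the total
  variation is at most 1. Initial data at equilibrium have no defect. The interpolation replaces u -
  w by a difference quotient of E with step h, at a cost of order \<epsilon> T / h + h; the choice h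
  = sqrt(\<epsilon> T) balances both terms and gives the constant 4 (c + 1/2) c + 2. Two obstacles
  shape the proof. The equations hold only against test functions supported in positive times, so
  initial values must be recovered from continuity in time. And mollification does not commute with
  the products in the equation for E; since \<open>u\<close> and \<open>w\<close> are monotone,
  being 1/2 minus distribution functions, the commutator is O(d) in L^1, and d can tend to 0 with
  \<epsilon> and T fixed.\<close>

lemma has_real_derivative_pos_part_square:
  "((\<lambda>x::real. (max 0 x)^2) has_real_derivative 2 * max 0 x) (at x)"
proof -
  consider "x < 0" | "x = 0" | "x > 0" by linarith
  then show ?thesis
  proof cases
    case 1
    have "((\<lambda>x::real. 0) has_real_derivative 0) (at x)" by simp
    then have "((\<lambda>x::real. (max 0 x)^2) has_real_derivative 0) (at x)"
      by (rule has_field_derivative_transform_within_open[where S="{..<0}"]) (use 1 in auto)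
    then show ?thesis using 1 by simp
  next
    case 3
    have "((\<lambda>x::real. x^2) has_real_derivative 2*x) (at x)"
      by (auto intro!: derivative_eq_intros)
    then have "((\<lambda>x::real. (max 0 x)^2) has_real_derivative 2*x) (at x)"
      by (rule has_field_derivative_transform_within_open[where S="{0<..}"]) (use 3 in auto)
    then show ?thesis using 3 by simp
  next
    case 2
    have "((\<lambda>y::real. (max 0 y)^2 / y) \<longlongrightarrow> 0) (at 0)"
    proof (rule Lim_null_comparison)
      show "\<forall>\<^sub>F y::real in at 0. norm ((max 0 y)^2 / y) \<le> \<bar>y\<bar>"
        by (intro always_eventually) (auto simp: max_def power2_eq_square)
      show "((\<lambda>y::real. \<bar>y\<bar>) \<longlongrightarrow> 0) (at 0)"
        by (auto intro!: tendsto_eq_intros)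
    qed
    then show ?thesis using 2 by (simp add: has_field_derivative_iff)
  qed
qed

text \<open>Squares of positive parts are C^1 piecewise polynomials. The mollifier and the cut-off
  of the transport estimate are both built from them, which is smooth enough because
  \<open>test_fun\<close> asks for one continuous derivative only.\<close>

lemmas DERIV_pos_part_square = DERIV_chain2[OF has_real_derivative_pos_part_square]

section \<open>Convolution of bounded Borel functions with compactly supported kernels\<close>

definition conv :: "(real \<Rightarrow> real) \<Rightarrow> (real \<Rightarrow> real) \<Rightarrow> real \<Rightarrow> real" where
  "conv k f x = (LINT y|lborel. f y * k (x - y))"

definition bdd_borel :: "(real \<Rightarrow> real) \<Rightarrow> bool" where
  "bdd_borel f \<longleftrightarrow> f \<in> borel_measurable borel \<and> (\<exists>M. \<forall>x. \<bar>f x\<bar> \<le> M)"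

lemma bdd_borelE:
  assumes "bdd_borel f"
  obtains M where "0 \<le> M" "\<And>x. \<bar>f x\<bar> \<le> M"
proof -
  obtain M where "\<And>x. \<bar>f x\<bar> \<le> M" using assms unfolding bdd_borel_def by blast
  then show ?thesis using that[of M] by (meson abs_ge_zero order_trans)
qed

lemma bdd_borel_const [intro, simp]: "bdd_borel (\<lambda>_. a)"
  by (auto simp: bdd_borel_def)

lemma bdd_borel_add [intro]: "bdd_borel f \<Longrightarrow> bdd_borel g \<Longrightarrow> bdd_borel (\<lambda>x. f x + g x)"
  unfolding bdd_borel_def by (auto intro: order_trans[OF abs_triangle_ineq add_mono])

lemma bdd_borel_mult [intro]: "bdd_borel f \<Longrightarrow> bdd_borel g \<Longrightarrow> bdd_borel (\<lambda>x. f x * g x)"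
proof -
  assume f: "bdd_borel f" and g: "bdd_borel g"
  obtain M where M: "0 \<le> M" "\<And>x. \<bar>f x\<bar> \<le> M" using bdd_borelE[OF f] by blast
  obtain N where N: "0 \<le> N" "\<And>x. \<bar>g x\<bar> \<le> N" using bdd_borelE[OF g] by blast
  have "\<bar>f x * g x\<bar> \<le> M * N" for x
    using M N by (auto simp: abs_mult intro!: mult_mono)
  then show ?thesis using f g unfolding bdd_borel_def by auto
qed

lemma bdd_borel_cmult [intro]: "bdd_borel f \<Longrightarrow> bdd_borel (\<lambda>x. a * f x)"
  by (rule bdd_borel_mult) auto

lemma bdd_borel_diff [intro]: "bdd_borel f \<Longrightarrow> bdd_borel g \<Longrightarrow> bdd_borel (\<lambda>x. f x - g x)"
  using bdd_borel_add[of f "\<lambda>x. -1 * g x"] bdd_borel_cmult[of g "-1"] by simp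

lemma bdd_borel_shift [intro]: "bdd_borel f \<Longrightarrow> bdd_borel (\<lambda>x. f (x + a))"
  unfolding bdd_borel_def by (auto intro: measurable_compose[where f="\<lambda>x. x + a"])

text \<open>One-sided support: \<open>conv k f x\<close> sees \<open>f\<close> on [x - d, x] only.
  Neither sign nor mass is prescribed, so that the derivative of a mollifier is covered as
  well.\<close>

definition kernel_on :: "real \<Rightarrow> (real \<Rightarrow> real) \<Rightarrow> bool" where
  "kernel_on d k \<longleftrightarrow> continuous_on UNIV k \<and> (\<forall>x. x \<notin> {0..d} \<longrightarrow> k x = 0)"

lemma kernel_onE:
  assumes "kernel_on d k"
  obtains K where "0 \<le> K" "\<And>x. \<bar>k x\<bar> \<le> K"
proof -
  have "compact (k ` {0..d})"
    using assms by (intro compact_continuous_image) (auto simp: kernel_on_def intro: continuous_on_subset)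
  then obtain K where K: "\<forall>x\<in>{0..d}. \<bar>k x\<bar> \<le> K"
    by (auto simp: bounded_iff dest!: compact_imp_bounded)
  show ?thesis
  proof (rule that[of "max 0 K"])
    fix x show "\<bar>k x\<bar> \<le> max 0 K"
      using K assms by (cases "x \<in> {0..d}") (auto simp: kernel_on_def le_max_iff_disj)
  qed simp
qed

lemma kernel_measurable: "kernel_on d k \<Longrightarrow> k \<in> borel_measurable borel"
  unfolding kernel_on_def by (auto intro: borel_measurable_continuous_onI)

lemma integrable_bounded_support:
  fixes f :: "'a::euclidean_space \<Rightarrow> real"
  assumes "f \<in> borel_measurable borel" "\<And>x. \<bar>f x\<bar> \<le> M" "\<And>x. x \<notin> cbox a b \<Longrightarrow> f x = 0"
  shows "integrable lborel f"
proof (rule Bochner_Integration.integrable_bound)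
  show "integrable lborel (\<lambda>x. M * indicator (cbox a b) x :: real)"
    using emeasure_lborel_cbox_finite[of a b]
    by (intro integrable_mult_right integrable_real_indicator) auto
  show "f \<in> borel_measurable lborel" using assms by simp
  show "AE x in lborel. norm (f x) \<le> norm (M * indicator (cbox a b) x)"
  proof (intro AE_I2)
    fix x show "norm (f x) \<le> norm (M * indicator (cbox a b) x)"
      using assms(2)[of x] assms(3)[of x] by (cases "x \<in> cbox a b") auto
  qed
qed

lemma conv_integrable:
  assumes "bdd_borel f" "kernel_on d k"
  shows "integrable lborel (\<lambda>y. f y * k (x - y))"
proof -
  obtain M where M: "0 \<le> M" "\<And>x. \<bar>f x\<bar> \<le> M" using bdd_borelE[OF assms(1)] by blast
  obtain K where K: "0 \<le> K" "\<And>x. \<bar>k x\<bar> \<le> K" using kernel_onE[OF assms(2)] by blast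
  note [measurable] = kernel_measurable[OF assms(2)]
  have [measurable]: "f \<in> borel_measurable borel" using assms by (simp add: bdd_borel_def)
  show ?thesis
  proof (rule integrable_bounded_support[where a="x - d" and b=x and M="M * K"])
    show "(\<lambda>y. f y * k (x - y)) \<in> borel_measurable borel" by measurable
    show "\<bar>f y * k (x - y)\<bar> \<le> M * K" for y
      using M K by (auto simp: abs_mult intro!: mult_mono')
    show "f y * k (x - y) = 0" if "y \<notin> cbox (x - d) x" for y
      using assms(2) that by (auto simp: kernel_on_def)
  qed
qed

lemma conv_add: "bdd_borel f \<Longrightarrow> bdd_borel g \<Longrightarrow> kernel_on d k \<Longrightarrow>
    conv k (\<lambda>y. f y + g y) x = conv k f x + conv k g x"
  unfolding conv_def by (simp add: distrib_right Bochner_Integration.integral_add[OF conv_integrable conv_integrable])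

lemma conv_diff: "bdd_borel f \<Longrightarrow> bdd_borel g \<Longrightarrow> kernel_on d k \<Longrightarrow>
    conv k (\<lambda>y. f y - g y) x = conv k f x - conv k g x"
  unfolding conv_def by (simp add: left_diff_distrib Bochner_Integration.integral_diff[OF conv_integrable conv_integrable])

lemma conv_cmult: "conv k (\<lambda>y. a * f y) x = a * conv k f x"
  unfolding conv_def by (simp add: mult.assoc)

lemma conv_shift: "conv k (\<lambda>y. f (y + a)) x = conv k f (x + a)"
proof -
  have "conv k f (x + a) = (LINT y|lborel. f (a + 1 * y) * k (x + a - (a + 1 * y)))"
    unfolding conv_def by (subst lborel_integral_real_affine[where c=1 and t=a]) auto
  then show ?thesis by (simp add: conv_def algebra_simps)
qed

text \<open>The same kind of kernel serves in space and in time. In time, the support in [0, d]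
  means that only the past of the evaluation point is seen; in space, it places a mollified monotone
  function between the function and its shift by d.\<close>

locale mollifier =
  fixes d :: real and k k' :: "real \<Rightarrow> real"
  assumes d_pos: "0 < d"
    and deriv: "\<And>x. (k has_real_derivative k' x) (at x)"
    and kernel': "kernel_on d k'"
    and nonneg: "\<And>x. 0 \<le> k x"
    and support: "\<And>x. x \<notin> {0..d} \<Longrightarrow> k x = 0"
    and mass: "(LINT x|lborel. k x) = 1"
begin

lemma kernel: "kernel_on d k"
proof -
  have "continuous_on UNIV k" by (rule DERIV_continuous_on[OF deriv])
  then show ?thesis using support by (simp add: kernel_on_def)
qed

lemma conv_const: "conv k (\<lambda>_. a) x = a"
proof -
  have "(LINT y|lborel. k (x - y)) = 1"
    using lborel_integral_real_affine[of "-1" k x] mass by simp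
  then show ?thesis by (simp add: conv_def)
qed

lemma conv_mono:
  assumes "bdd_borel f" "bdd_borel g" "\<And>y. x - d \<le> y \<Longrightarrow> y \<le> x \<Longrightarrow> f y \<le> g y"
  shows "conv k f x \<le> conv k g x"
  unfolding conv_def
proof (rule integral_mono)
  fix y show "f y * k (x - y) \<le> g y * k (x - y)"
    using assms(3)[of y] nonneg[of "x - y"] support[of "x - y"]
    by (cases "x - y \<in> {0..d}") (auto intro: mult_right_mono)
qed (auto intro: conv_integrable assms kernel)

lemma conv_le:
  assumes "bdd_borel f" "\<And>y. x - d \<le> y \<Longrightarrow> y \<le> x \<Longrightarrow> f y \<le> a"
  shows "conv k f x \<le> a"
  using conv_mono[OF assms(1) bdd_borel_const[of a] assms(2)] by (simp add: conv_const)

lemma conv_ge: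
  assumes "bdd_borel f" "\<And>y. x - d \<le> y \<Longrightarrow> y \<le> x \<Longrightarrow> a \<le> f y"
  shows "a \<le> conv k f x"
  using conv_mono[OF bdd_borel_const[of a] assms(1) assms(2)] by (simp add: conv_const)

lemma conv_antimono:
  assumes "bdd_borel f" "antimono f"
  shows "antimono (conv k f)"
proof (rule antimonoI)
  fix x y :: real assume "x \<le> y"
  have "conv k (\<lambda>z. f (z + (y - x))) x \<le> conv k f x"
    by (rule conv_mono) (use assms \<open>x \<le> y\<close> in \<open>auto intro: antimonoD\<close>)
  then show "conv k f y \<le> conv k f x" by (simp add: conv_shift)
qed

text \<open>The derivative falls on the kernel, so \<open>f\<close> needs no regularity. Difference
  quotients of \<open>k\<close> are bounded by the supremum of \<open>k'\<close>, which allows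
  dominated convergence along every sequence of steps.\<close>

lemma conv_has_derivative:
  assumes f: "bdd_borel f"
  shows "(conv k f has_real_derivative conv k' f x) (at x)"
proof -
  obtain M where M: "0 \<le> M" "\<And>x. \<bar>f x\<bar> \<le> M" using bdd_borelE[OF f] by blast
  obtain K where K: "0 \<le> K" "\<And>x. \<bar>k' x\<bar> \<le> K" using kernel_onE[OF kernel'] by blast
  note [measurable] = kernel_measurable[OF kernel] kernel_measurable[OF kernel']
  have [measurable]: "f \<in> borel_measurable borel" using f by (simp add: bdd_borel_def)
  have lip: "\<bar>k a - k b\<bar> \<le> K * \<bar>a - b\<bar>" for a b
    using field_differentiable_bound[of UNIV k k' K a b] deriv K by auto
  have "((\<lambda>h. (conv k f (x + h) - conv k f x) / h) \<longlongrightarrow> conv k' f x) (at 0)"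
    unfolding tendsto_at_iff_sequentially
  proof (intro allI impI)
    fix X :: "nat \<Rightarrow> real"
    assume X0: "\<forall>i. X i \<in> UNIV - {0}" and X: "X \<longlonglongrightarrow> 0"
    \<comment> \<open>A bound on all steps yields one box outside of which the kernels at
      \<open>x\<close> and at every \<open>x + X n\<close> vanish; it carries the dominating
      function.\<close>
    obtain H where H: "\<And>n. \<bar>X n\<bar> \<le> H"
      using Bseq_def convergent_imp_Bseq[OF convergentI[OF X]] by (metis real_norm_def)
    have "(\<lambda>n. LINT y|lborel. f y * ((k (x + X n - y) - k (x - y)) / X n))
        \<longlonglongrightarrow> (LINT y|lborel. f y * k' (x - y))"
    proof (rule integral_dominated_convergence
        [where w="\<lambda>y. M * K * indicator (cbox (x - d - H) (x + H)) y"])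
      show "integrable lborel (\<lambda>y. M * K * indicator (cbox (x - d - H) (x + H)) y)"
        using emeasure_lborel_cbox_finite[of "x - d - H" "x + H"]
        by (intro integrable_mult_right integrable_real_indicator) auto
      show "AE y in lborel. (\<lambda>n. f y * ((k (x + X n - y) - k (x - y)) / X n))
          \<longlonglongrightarrow> f y * k' (x - y)"
      proof (intro AE_I2 tendsto_mult_left)
        fix y
        have "((\<lambda>h. (k (x - y + h) - k (x - y)) / h) \<longlongrightarrow> k' (x - y)) (at 0)"
          using deriv[of "x - y"] by (simp add: DERIV_def)
        then show "(\<lambda>n. (k (x + X n - y) - k (x - y)) / X n) \<longlonglongrightarrow> k' (x - y)"
          unfolding tendsto_at_iff_sequentially using X0 X
          by (auto simp: o_def algebra_simps)
      qed
      show "AE y in lborel. norm (f y * ((k (x + X n - y) - k (x - y)) / X n))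
          \<le> M * K * indicator (cbox (x - d - H) (x + H)) y" for n
      proof (intro AE_I2)
        fix y
        show "norm (f y * ((k (x + X n - y) - k (x - y)) / X n))
          \<le> M * K * indicator (cbox (x - d - H) (x + H)) y"
        proof (cases "y \<in> cbox (x - d - H) (x + H)")
          case True
          have "\<bar>k (x + X n - y) - k (x - y)\<bar> / \<bar>X n\<bar> \<le> K"
            using lip[of "x + X n - y" "x - y"] X0 by (auto simp: divide_simps)
          then have "\<bar>f y\<bar> * (\<bar>k (x + X n - y) - k (x - y)\<bar> / \<bar>X n\<bar>) \<le> M * K"
            using M K by (intro mult_mono) auto
          then show ?thesis using True by (simp add: abs_mult)
        next
          case False
          then have "k (x + X n - y) = 0" "k (x - y) = 0"
            using H[of n] by (auto intro!: support)
          then show ?thesis using False by simp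
        qed
      qed
    qed measurable
    moreover have "(LINT y|lborel. f y * ((k (x + X n - y) - k (x - y)) / X n))
        = (conv k f (x + X n) - conv k f x) / X n" for n
      unfolding conv_def
      by (subst Bochner_Integration.integral_diff[symmetric])
         (auto intro!: conv_integrable f kernel simp: algebra_simps diff_divide_distrib
           simp flip: integral_divide_zero)
    ultimately have "(\<lambda>n. (conv k f (x + X n) - conv k f x) / X n) \<longlonglongrightarrow> (LINT y|lborel. f y * k' (x - y))"
      by (simp only:)
    then show "((\<lambda>h. (conv k f (x + h) - conv k f x) / h) \<circ> X) \<longlonglongrightarrow> conv k' f x"
      by (simp add: o_def conv_def)
  qed
  then show ?thesis by (simp add: DERIV_def)
qed

text \<open>Monotonicity is assumed of the mollified function rather than of \<open>f\<close>,
  because for the Riemann invariants it is established only after mollification.\<close>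

lemma conv_deriv_nonpos:
  assumes "bdd_borel f" "antimono (conv k f)"
  shows "conv k' f x \<le> 0"
proof (rule ccontr)
  assume "\<not> conv k' f x \<le> 0"
  then obtain e where e: "e > 0" "\<And>h. 0 < h \<Longrightarrow> h < e \<Longrightarrow> conv k f x < conv k f (x + h)"
    using DERIV_pos_inc_right[OF conv_has_derivative[OF assms(1)], of x] by auto
  show False using e(2)[of "e/2"] e(1) antimonoD[OF assms(2), of x "x + e/2"] by auto
qed

end

text \<open>With r = x/d the kernel is 30 r^2 (1 - r)^2 / d on [0, d], the rescaled Beta(3,3)
  density. The double zeros at both ends make it C^1, 30 normalises the mass, and \<open>B\<close>
  is the primitive 10 r^3 - 15 r^4 + 6 r^5, which rises from 0 to 1.\<close>

lemma mollifier_exists: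
  assumes "d > 0"
  shows "\<exists>k k'. mollifier d k k'"
proof -
  define b where "b x = 30 / d * ((max 0 (x/d))^2 * (max 0 (1 - x/d))^2)" for x
  define b' where "b' x = 30 / d * ((max 0 (x/d))^2 * (2 * max 0 (1 - x/d) * (-1/d))
      + 2 * max 0 (x/d) * (1/d) * (max 0 (1 - x/d))^2)" for x
  define B where "B x = 10 * (x/d)^3 - 15 * (x/d)^4 + 6 * (x/d)^5" for x
  have cont: "continuous_on S b" for S
    unfolding b_def using assms by (intro continuous_intros) auto
  have "(LBINT x:{0..d}. b x) = B d - B 0"
    unfolding set_lebesgue_integral_def
  proof (rule integral_FTC_Icc)
    show "(B has_vector_derivative b x) (at x within {0..d})" if "0 \<le> x" "x \<le> d" for x
    proof -
      have "(B has_real_derivative b x) (at x within {0..d})"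
        unfolding B_def b_def using that assms
        by (auto intro!: derivative_eq_intros simp: field_simps max_def) (simp add: power_numeral_reduce algebra_simps)
      then show ?thesis by (simp add: has_real_derivative_iff_has_vector_derivative)
    qed
  qed (use assms cont in auto)
  also have "\<dots> = 1" using assms by (simp add: B_def)
  also have "(LBINT x:{0..d}. b x) = (LINT x|lborel. b x)"
    unfolding set_lebesgue_integral_def
    by (rule Bochner_Integration.integral_cong) (use assms in \<open>auto simp: b_def indicator_def max_def field_simps\<close>)
  finally have mass: "(LINT x|lborel. b x) = 1" .
  have deriv: "(b has_real_derivative b' x) (at x)" for x
    unfolding b_def b'_def using assms
    by (intro DERIV_cmult DERIV_mult' DERIV_pos_part_square)
       (auto intro!: derivative_eq_intros)
  have "mollifier d b b'"
  proof
    show "kernel_on d b'"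
      unfolding kernel_on_def
    proof (intro conjI allI impI)
      show "continuous_on UNIV b'" unfolding b'_def using assms by (intro continuous_intros) auto
      show "b' x = 0" if "x \<notin> {0..d}" for x
        using that assms by (auto simp: b'_def max_def field_simps)
    qed
    show "b x = 0" if "x \<notin> {0..d}" for x
      using that assms by (auto simp: b_def max_def field_simps)
    show "0 \<le> b x" for x using assms by (auto simp: b_def)
  qed (use assms mass deriv in auto)
  then show ?thesis by blast
qed

section \<open>Admissible functions: time slices, algebra, continuity after mollification\<close>

lemma bdd_borel_set_integrable:
  assumes "bdd_borel f"
  shows "set_integrable lborel {a..b} f"
proof -
  obtain M where M: "0 \<le> M" "\<And>x. \<bar>f x\<bar> \<le> M" using bdd_borelE[OF assms] by blast
  have [measurable]: "f \<in> borel_measurable borel" using assms by (simp add: bdd_borel_def)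
  show ?thesis unfolding set_integrable_def
    by (rule integrable_bounded_support[where a=a and b=b and M=M])
       (use M in \<open>auto simp: indicator_def\<close>)
qed

lemma admissible_bdd_borel:
  assumes "admissible u" "0 \<le> t"
  shows "bdd_borel (u t)"
proof -
  have "(\<lambda>x. (t, x)) \<in> borel_measurable (borel :: real measure)"
    by (intro borel_measurable_continuous_onI continuous_intros)
  moreover have "(\<lambda>p. indicator ({0..} \<times> UNIV) p *\<^sub>R u (fst p) (snd p)) \<in> borel_measurable borel"
    using assms by (simp add: admissible_def set_borel_measurable_def)
  ultimately have "(\<lambda>x. indicator ({0..} \<times> UNIV) (t, x) *\<^sub>R u (fst (t, x)) (snd (t, x))) \<in> borel_measurable borel"
    by (rule measurable_compose)
  then show ?thesis
    using assms unfolding bdd_borel_def admissible_def by simp blast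
qed

lemma admissibleE:
  assumes "admissible u"
  obtains M where "0 \<le> M" "\<And>t x. 0 \<le> t \<Longrightarrow> \<bar>u t x\<bar> \<le> M"
proof -
  obtain M where "\<And>t x. 0 \<le> t \<Longrightarrow> \<bar>u t x\<bar> \<le> M" using assms unfolding admissible_def by blast
  then show ?thesis using that[of M] by (meson abs_ge_zero order_trans order_refl)
qed

text \<open>Sums and products are both Lipschitz on bounded sets, and such a map preserves
  boundedness, joint measurability and L^1_loc continuity in time. Proving this once yields all
  closure properties below.\<close>

lemma admissible_combine:
  assumes u: "admissible u" and v: "admissible v"
    and g[measurable]: "(\<lambda>p. g (fst p) (snd p)) \<in> borel_measurable borel"
    and lip: "\<And>M. 0 \<le> M \<Longrightarrow> \<exists>K\<ge>0. \<forall>a b a' b'. \<bar>a\<bar> \<le> M \<and> \<bar>b\<bar> \<le> M \<and> \<bar>a'\<bar> \<le> M \<and> \<bar>b'\<bar> \<le> M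
        \<longrightarrow> \<bar>g a b - g a' b'\<bar> \<le> K * (\<bar>a - a'\<bar> + \<bar>b - b'\<bar>)"
  shows "admissible (\<lambda>t x. g (u t x) (v t x))"
proof -
  obtain M1 where M1: "0 \<le> M1" "\<And>t x. 0 \<le> t \<Longrightarrow> \<bar>u t x\<bar> \<le> M1" using admissibleE[OF u] by blast
  obtain M2 where M2: "0 \<le> M2" "\<And>t x. 0 \<le> t \<Longrightarrow> \<bar>v t x\<bar> \<le> M2" using admissibleE[OF v] by blast
  define M where "M = max M1 M2"
  have M: "0 \<le> M" "\<And>t x. 0 \<le> t \<Longrightarrow> \<bar>u t x\<bar> \<le> M" "\<And>t x. 0 \<le> t \<Longrightarrow> \<bar>v t x\<bar> \<le> M"
    using M1 M2 by (auto simp: M_def le_max_iff_disj)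
  obtain K where K: "0 \<le> K" "\<And>a b a' b'. \<bar>a\<bar> \<le> M \<Longrightarrow> \<bar>b\<bar> \<le> M \<Longrightarrow> \<bar>a'\<bar> \<le> M \<Longrightarrow> \<bar>b'\<bar> \<le> M
        \<Longrightarrow> \<bar>g a b - g a' b'\<bar> \<le> K * (\<bar>a - a'\<bar> + \<bar>b - b'\<bar>)"
    using lip[OF M(1)] by blast
  let ?A = "{0..} \<times> UNIV :: (real \<times> real) set"
  have [measurable]: "(\<lambda>p. indicator ?A p *\<^sub>R u (fst p) (snd p)) \<in> borel_measurable borel"
    "(\<lambda>p. indicator ?A p *\<^sub>R v (fst p) (snd p)) \<in> borel_measurable borel"
    using u v by (auto simp: admissible_def set_borel_measurable_def)
  have A[measurable]: "?A \<in> sets borel" by (intro borel_closed closed_Times) auto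
  \<comment> \<open>Measurability is known only after cutting off negative times. Hence
    \<open>g\<close> is applied to the cut-off functions and the result is cut off again, which
    changes nothing for t >= 0.\<close>
  have "(\<lambda>p. (indicator ?A p *\<^sub>R u (fst p) (snd p), indicator ?A p *\<^sub>R v (fst p) (snd p)))
      \<in> borel_measurable borel"
    by measurable
  from measurable_compose[OF this g]
  have "(\<lambda>p. indicator ?A p *\<^sub>R g (indicator ?A p *\<^sub>R u (fst p) (snd p)) (indicator ?A p *\<^sub>R v (fst p) (snd p)))
      \<in> borel_measurable borel"
    by (intro borel_measurable_scaleR) (auto simp: A)
  also have "(\<lambda>p. indicator ?A p *\<^sub>R g (indicator ?A p *\<^sub>R u (fst p) (snd p)) (indicator ?A p *\<^sub>R v (fst p) (snd p)))
      = (\<lambda>p. indicator ?A p *\<^sub>R g (u (fst p) (snd p)) (v (fst p) (snd p)))"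
    by (auto simp: indicator_def fun_eq_iff)
  finally have meas: "set_borel_measurable lborel ?A (\<lambda>p. g (u (fst p) (snd p)) (v (fst p) (snd p)))"
    by (simp add: set_borel_measurable_def)
  have bd: "\<bar>g (u t x) (v t x)\<bar> \<le> \<bar>g 0 0\<bar> + K * (M + M)" if "0 \<le> t" for t x
  proof -
    have "\<bar>g (u t x) (v t x) - g 0 0\<bar> \<le> K * (\<bar>u t x - 0\<bar> + \<bar>v t x - 0\<bar>)"
      using K(2)[of "u t x" "v t x" 0 0] M that by auto
    also have "\<dots> \<le> K * (M + M)"
      using K(1) M(2,3)[OF that, of x] by (intro mult_left_mono add_mono) auto
    finally show ?thesis by linarith
  qed
  have lim: "((\<lambda>s. LINT x:{-R..R}|lborel. \<bar>g (u s x) (v s x) - g (u t x) (v t x)\<bar>) \<longlongrightarrow> 0) (at t within {0..})"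
    if t: "0 \<le> t" for t R
  proof (rule tendsto_sandwich)
    let ?I = "\<lambda>w s. LINT x:{-R..R}|lborel. \<bar>w s x - w t x\<bar>"
    show "\<forall>\<^sub>F s in at t within {0..}. 0 \<le> (LINT x:{-R..R}|lborel. \<bar>g (u s x) (v s x) - g (u t x) (v t x)\<bar>)"
      by (intro always_eventually allI) (auto simp: set_lebesgue_integral_def)
    show "((\<lambda>s. K * (?I u s + ?I v s)) \<longlongrightarrow> 0) (at t within {0..})"
    proof -
      have "(?I u \<longlongrightarrow> 0) (at t within {0..})" "(?I v \<longlongrightarrow> 0) (at t within {0..})"
        using u v t unfolding admissible_def by blast+
      from tendsto_mult_left[OF tendsto_add[OF this], of K] show ?thesis by simp
    qed
    have g2: "(\<lambda>x. g (u r x) (v r x)) \<in> borel_measurable borel" if "0 \<le> r" for r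
    proof -
      have [measurable]: "u r \<in> borel_measurable borel" "v r \<in> borel_measurable borel"
        using admissible_bdd_borel[OF u that] admissible_bdd_borel[OF v that] by (auto simp: bdd_borel_def)
      have "(\<lambda>x. (u r x, v r x)) \<in> borel_measurable borel" by measurable
      from measurable_compose[OF this g] show ?thesis by simp
    qed
    have bb: "bdd_borel (\<lambda>x. g (u r x) (v r x))" if "0 \<le> r" for r
      using g2[OF that] bd[OF that] unfolding bdd_borel_def by blast
    have abs_int: "set_integrable lborel {-R..R} (\<lambda>x. \<bar>w x - w' x\<bar>)" if "bdd_borel w" "bdd_borel w'" for w w' :: "real \<Rightarrow> real"
      using set_integrable_abs[OF bdd_borel_set_integrable[OF bdd_borel_diff[OF that]]] by simp
    show "\<forall>\<^sub>F s in at t within {0..}. (LINT x:{-R..R}|lborel. \<bar>g (u s x) (v s x) - g (u t x) (v t x)\<bar>)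
        \<le> K * (?I u s + ?I v s)"
      unfolding eventually_at_filter
    proof (intro always_eventually allI impI)
      fix s :: real assume "s \<in> {0..}"
      then have s: "0 \<le> s" by simp
      note i1 = abs_int[OF bb[OF s] bb[OF t]]
      note i2 = abs_int[OF admissible_bdd_borel[OF u s] admissible_bdd_borel[OF u t]]
      note i3 = abs_int[OF admissible_bdd_borel[OF v s] admissible_bdd_borel[OF v t]]
      have "(LINT x:{-R..R}|lborel. \<bar>g (u s x) (v s x) - g (u t x) (v t x)\<bar>)
          \<le> (LINT x:{-R..R}|lborel. K * (\<bar>u s x - u t x\<bar> + \<bar>v s x - v t x\<bar>))"
        by (rule set_integral_mono[OF i1]) (use i2 i3 K(2) M s t in auto)
      also have "\<dots> = K * (?I u s + ?I v s)"
        using i2 i3 by simp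
      finally show "(LINT x:{-R..R}|lborel. \<bar>g (u s x) (v s x) - g (u t x) (v t x)\<bar>)
          \<le> K * (?I u s + ?I v s)" .
    qed
  qed simp
  show ?thesis using meas bd lim unfolding admissible_def by blast
qed

lemma admissible_add [intro]: "admissible u \<Longrightarrow> admissible v \<Longrightarrow> admissible (\<lambda>t x. u t x + v t x)"
proof (rule admissible_combine[where g="(+)"])
  fix M :: real
  have "\<bar>a + b - (a' + b')\<bar> \<le> 1 * (\<bar>a - a'\<bar> + \<bar>b - b'\<bar>)" for a b a' b' :: real by simp
  then show "\<exists>K\<ge>0. \<forall>a b a' b'. \<bar>a\<bar> \<le> M \<and> \<bar>b\<bar> \<le> M \<and> \<bar>a'\<bar> \<le> M \<and> \<bar>b'\<bar> \<le> M
      \<longrightarrow> \<bar>a + b - (a' + b')\<bar> \<le> K * (\<bar>a - a'\<bar> + \<bar>b - b'\<bar>)"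
    by (intro exI[of _ 1]) auto
qed (auto intro!: borel_measurable_continuous_onI continuous_intros)

lemma admissible_mult [intro]: "admissible u \<Longrightarrow> admissible v \<Longrightarrow> admissible (\<lambda>t x. u t x * v t x)"
proof (rule admissible_combine[where g="(*)"])
  fix M :: real assume "0 \<le> M"
  have "\<bar>a * b - a' * b'\<bar> \<le> M * (\<bar>a - a'\<bar> + \<bar>b - b'\<bar>)" if "\<bar>b\<bar> \<le> M" "\<bar>a'\<bar> \<le> M" for a b a' b' :: real
  proof -
    have eq: "a * b - a' * b' = (a - a') * b + a' * (b - b')" by (simp add: algebra_simps)
    have "\<bar>a * b - a' * b'\<bar> \<le> \<bar>a - a'\<bar> * \<bar>b\<bar> + \<bar>a'\<bar> * \<bar>b - b'\<bar>"
      unfolding eq abs_mult[symmetric] by (rule abs_triangle_ineq)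
    also have "\<dots> \<le> \<bar>a - a'\<bar> * M + M * \<bar>b - b'\<bar>"
      using that by (intro add_mono mult_left_mono mult_right_mono) auto
    finally show ?thesis by (simp add: algebra_simps)
  qed
  then show "\<exists>K\<ge>0. \<forall>a b a' b'. \<bar>a\<bar> \<le> M \<and> \<bar>b\<bar> \<le> M \<and> \<bar>a'\<bar> \<le> M \<and> \<bar>b'\<bar> \<le> M
      \<longrightarrow> \<bar>a * b - a' * b'\<bar> \<le> K * (\<bar>a - a'\<bar> + \<bar>b - b'\<bar>)"
    using \<open>0 \<le> M\<close> by (intro exI[of _ M]) auto
qed (auto intro!: borel_measurable_continuous_onI continuous_intros)

lemma admissible_const [intro, simp]: "admissible (\<lambda>t x. a)"
proof -
  have "{0..} \<times> UNIV \<in> sets (borel :: (real \<times> real) measure)" by (intro borel_closed closed_Times) auto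
  then show ?thesis unfolding admissible_def by (auto simp: set_borel_measurable_def)
qed

lemma admissible_cmult [intro]: "admissible u \<Longrightarrow> admissible (\<lambda>t x. a * u t x)"
  by (rule admissible_mult) auto

lemma admissible_diff [intro]: "admissible u \<Longrightarrow> admissible v \<Longrightarrow> admissible (\<lambda>t x. u t x - v t x)"
  using admissible_add[of u "\<lambda>t x. -1 * v t x"] admissible_cmult[of v "-1"] by simp

text \<open>Continuity in time holds only in L^1_loc, yet mollification makes it pointwise and joint
  in (t, x). Moving the point costs the L^1 distance \<open>J\<close> of two translates of the
  kernel times a bound of \<open>u\<close>; moving the time costs the L^1 distance \<open>I\<close>
  of two slices times a bound of \<open>k\<close>.\<close>

lemma conv_jointly_continuous:
  assumes u: "admissible u" and k: "kernel_on d k"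
  shows "continuous_on ({0..} \<times> UNIV) (\<lambda>p. conv k (u (fst p)) (snd p))"
  unfolding continuous_on_sequentially
proof (intro allI ballI impI)
  fix X :: "nat \<Rightarrow> real \<times> real" and p
  assume p: "p \<in> {0..} \<times> UNIV" and "(\<forall>n. X n \<in> {0..} \<times> UNIV) \<and> X \<longlonglongrightarrow> p"
  then have XS: "\<And>n. X n \<in> {0..} \<times> UNIV" and X: "X \<longlonglongrightarrow> p" by auto
  obtain t x where tx: "p = (t, x)" by force
  define s y where "s = (\<lambda>n. fst (X n))" and "y = (\<lambda>n. snd (X n))"
  have s: "s \<longlonglongrightarrow> t" and y: "y \<longlonglongrightarrow> x"
    using tendsto_fst[OF X] tendsto_snd[OF X] by (auto simp: s_def y_def tx)
  have s0: "0 \<le> s n" for n using XS[of n] by (auto simp: s_def)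
  have t0: "0 \<le> t" using p by (simp add: tx)
  obtain M where M: "0 \<le> M" "\<And>t x. 0 \<le> t \<Longrightarrow> \<bar>u t x\<bar> \<le> M" using admissibleE[OF u] by blast
  obtain K where K: "0 \<le> K" "\<And>x. \<bar>k x\<bar> \<le> K" using kernel_onE[OF k] by blast
  note [measurable] = kernel_measurable[OF k]
  obtain H where H: "\<And>n. \<bar>y n\<bar> \<le> H"
    using Bseq_def convergent_imp_Bseq[OF convergentI[OF y]] by (metis real_norm_def)
  have xH: "\<bar>x\<bar> \<le> H" by (rule LIMSEQ_le_const2[OF tendsto_rabs[OF y]]) (use H in auto)
  \<comment> \<open>All windows [a - d, a] with |a| <= H lie in [-R, R]; the absolute value is there
    because no sign of \<open>d\<close> is assumed.\<close>
  define R where "R = H + \<bar>d\<bar>"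
  have kz: "k (a - z) = 0" if "z \<notin> {-R..R}" "\<bar>a\<bar> \<le> H" for a z
  proof -
    have "a - z \<notin> {0..d}" using that by (auto simp: R_def)
    then show ?thesis using k by (simp add: kernel_on_def)
  qed
  define I where "I s = (LINT x:{-R..R}|lborel. \<bar>u s x - u t x\<bar>)" for s
  define J where "J n = (LINT z|lborel. \<bar>k (y n - z) - k (x - z)\<bar>)" for n
  have intJ: "integrable lborel (\<lambda>z. \<bar>k (y n - z) - k (x - z)\<bar>)" for n
    using conv_integrable[OF bdd_borel_const[of 1] k, of "y n"] conv_integrable[OF bdd_borel_const[of 1] k, of x]
    by (intro integrable_abs Bochner_Integration.integrable_diff) auto
  have J: "J \<longlonglongrightarrow> 0"
  proof -
    have "(\<lambda>n. LINT z|lborel. \<bar>k (y n - z) - k (x - z)\<bar>) \<longlonglongrightarrow> (LINT z|(lborel::real measure). 0)"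
    proof (rule integral_dominated_convergence[where w="\<lambda>z. (2 * K) * indicator (cbox (-R) R) z"])
      show "integrable lborel (\<lambda>z. (2 * K) * indicator (cbox (-R) R) z)"
        using emeasure_lborel_cbox_finite[of "-R" R]
        by (intro integrable_mult_right integrable_real_indicator) auto
      show "AE z in lborel. (\<lambda>n. \<bar>k (y n - z) - k (x - z)\<bar>) \<longlonglongrightarrow> 0"
      proof (intro AE_I2)
        fix z
        have "(\<lambda>n. k (y n - z)) \<longlonglongrightarrow> k (x - z)"
          using k by (intro continuous_on_tendsto_compose[of UNIV k]) (auto simp: kernel_on_def intro!: tendsto_intros y)
        then show "(\<lambda>n. \<bar>k (y n - z) - k (x - z)\<bar>) \<longlonglongrightarrow> 0"
          by (simp add: LIM_zero_iff tendsto_rabs_zero)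
      qed
      show "AE z in lborel. norm \<bar>k (y n - z) - k (x - z)\<bar> \<le> (2 * K) * indicator (cbox (-R) R) z" for n
      proof (intro AE_I2)
        fix z
        show "norm \<bar>k (y n - z) - k (x - z)\<bar> \<le> (2 * K) * indicator (cbox (-R) R) z"
          using K(2)[of "y n - z"] K(2)[of "x - z"] kz[of z x] kz[of z "y n"] xH H[of n]
          by (cases "z \<in> {-R..R}") auto
      qed
    qed auto
    then show ?thesis by (simp add: J_def[abs_def])
  qed
  have I: "(\<lambda>n. I (s n)) \<longlonglongrightarrow> 0"
  proof -
    have "(I \<longlongrightarrow> 0) (at t within {0..})" using u t0 unfolding admissible_def I_def by blast
    \<comment> \<open>The limit in \<open>admissible\<close> is over punctured neighbourhoods,
      whereas \<open>s\<close> may take the value \<open>t\<close>.\<close>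
    moreover have "I t = 0" by (simp add: I_def)
    ultimately have "continuous (at t within {0..}) I" by (simp add: continuous_within)
    then show ?thesis using s s0 \<open>I t = 0\<close>
      unfolding continuous_within_sequentially by (auto simp: o_def)
  qed
  have le: "\<bar>conv k (u (s n)) (y n) - conv k (u t) x\<bar> \<le> M * J n + K * I (s n)" for n
  proof -
    note b1 = admissible_bdd_borel[OF u s0[of n]] and b2 = admissible_bdd_borel[OF u t0]
    have i: "integrable lborel (\<lambda>z. u (s n) z * k (y n - z) - u (s n) z * k (x - z))"
      "integrable lborel (\<lambda>z. u (s n) z * k (x - z) - u t z * k (x - z))"
      using b1 b2 by (auto intro!: Bochner_Integration.integrable_diff conv_integrable k)
    have eq: "conv k (u (s n)) (y n) - conv k (u t) x
        = (LINT z|lborel. u (s n) z * k (y n - z) - u (s n) z * k (x - z))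
        + (LINT z|lborel. u (s n) z * k (x - z) - u t z * k (x - z))"
      using b1 b2 by (simp add: conv_def conv_integrable[OF _ k])
    have "\<bar>conv k (u (s n)) (y n) - conv k (u t) x\<bar>
        \<le> \<bar>LINT z|lborel. u (s n) z * k (y n - z) - u (s n) z * k (x - z)\<bar>
        + \<bar>LINT z|lborel. u (s n) z * k (x - z) - u t z * k (x - z)\<bar>"
      unfolding eq by (rule abs_triangle_ineq)
    also have "\<dots> \<le> M * J n + K * I (s n)"
    proof (rule add_mono)
      have "\<bar>LINT z|lborel. u (s n) z * k (y n - z) - u (s n) z * k (x - z)\<bar>
          \<le> (LINT z|lborel. \<bar>u (s n) z * k (y n - z) - u (s n) z * k (x - z)\<bar>)"
        by (rule integral_abs_bound)
      also have "\<dots> \<le> (LINT z|lborel. M * \<bar>k (y n - z) - k (x - z)\<bar>)"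
      proof (rule integral_mono)
        fix z show "\<bar>u (s n) z * k (y n - z) - u (s n) z * k (x - z)\<bar> \<le> M * \<bar>k (y n - z) - k (x - z)\<bar>"
          using M(2)[OF s0[of n], of z] by (auto simp: abs_mult simp flip: right_diff_distrib intro!: mult_right_mono)
      qed (use intJ i in auto)
      finally show "\<bar>LINT z|lborel. u (s n) z * k (y n - z) - u (s n) z * k (x - z)\<bar> \<le> M * J n"
        by (simp add: J_def)
      have "\<bar>LINT z|lborel. u (s n) z * k (x - z) - u t z * k (x - z)\<bar>
          \<le> (LINT z|lborel. \<bar>u (s n) z * k (x - z) - u t z * k (x - z)\<bar>)"
        by (rule integral_abs_bound)
      also have "\<dots> \<le> (LINT z|lborel. K * (indicator {-R..R} z *\<^sub>R \<bar>u (s n) z - u t z\<bar>))"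
      proof (rule integral_mono)
        show "integrable lborel (\<lambda>z. K * (indicator {-R..R} z *\<^sub>R \<bar>u (s n) z - u t z\<bar>))"
          using set_integrable_abs[OF bdd_borel_set_integrable[OF bdd_borel_diff[OF b1 b2], of "-R" R]]
          by (intro integrable_mult_right) (simp add: set_integrable_def)
        fix z show "\<bar>u (s n) z * k (x - z) - u t z * k (x - z)\<bar> \<le> K * (indicator {-R..R} z *\<^sub>R \<bar>u (s n) z - u t z\<bar>)"
        proof (cases "z \<in> {-R..R}")
          case True
          have "\<bar>u (s n) z - u t z\<bar> * \<bar>k (x - z)\<bar> \<le> \<bar>u (s n) z - u t z\<bar> * K"
            using K(2) by (intro mult_left_mono) auto
          then show ?thesis using True by (simp add: mult.commute[of K] flip: left_diff_distrib abs_mult)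
        next
          case False
          then show ?thesis using kz[of z x] xH by auto
        qed
      qed (use i in auto)
      finally show "\<bar>LINT z|lborel. u (s n) z * k (x - z) - u t z * k (x - z)\<bar> \<le> K * I (s n)"
        by (simp add: I_def set_lebesgue_integral_def)
    qed
    finally show ?thesis .
  qed
  have "(\<lambda>n. conv k (u (s n)) (y n) - conv k (u t) x) \<longlonglongrightarrow> 0"
  proof (rule Lim_null_comparison)
    show "\<forall>\<^sub>F n in sequentially. norm (conv k (u (s n)) (y n) - conv k (u t) x) \<le> M * J n + K * I (s n)"
      using le by auto
    show "(\<lambda>n. M * J n + K * I (s n)) \<longlonglongrightarrow> 0"
      using tendsto_add[OF tendsto_mult_left[OF J, of M] tendsto_mult_left[OF I, of K]] by simp
  qed
  then show "((\<lambda>p. conv k (u (fst p)) (snd p)) \<circ> X) \<longlonglongrightarrow> conv k (u (fst p)) (snd p)"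
    by (simp add: o_def tx s_def y_def LIM_zero_iff)
qed

lemma conv_continuous_on [continuous_intros]:
  assumes "admissible u" "kernel_on d k" "continuous_on S f" "continuous_on S g" "\<And>p. p \<in> S \<Longrightarrow> 0 \<le> f p"
  shows "continuous_on S (\<lambda>p. conv k (u (f p)) (g p))"
  using continuous_on_compose2[OF conv_jointly_continuous[OF assms(1,2)] continuous_on_Pair[OF assms(3,4)]]
    assms(5) by auto

text \<open>The hypothesis \<open>weak\<close> says that the time mollification of \<open>f\<close>
  has the time mollification of \<open>g\<close> as its derivative. Integrate this and let the width
  shrink. It is available only for s > e, since test functions vanish near time 0; the initial value
  is reached through the continuity of \<open>f\<close>.\<close>

lemma du_bois_reymond:
  assumes T: "0 < T" and f: "continuous_on {0..T} f" and g: "continuous_on {0..T} g"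
    and weak: "\<And>e b b' s. mollifier e b b' \<Longrightarrow> e < s \<Longrightarrow> s \<le> T \<Longrightarrow> conv b' f s = conv b g s"
  shows "f T = f 0 + integral {0..T} g"
proof -
  \<comment> \<open>Clamping the time to [0, T] extends \<open>f\<close> and \<open>g\<close> to
    bounded functions on the line, to which the mollifier calculus applies.\<close>
  define cl where "cl t = max 0 (min T t)" for t
  have clT: "cl t \<in> {0..T}" for t using T by (auto simp: cl_def)
  have clid: "cl t = t" if "t \<in> {0..T}" for t using that by (auto simp: cl_def)
  have contcl: "continuous_on S cl" for S unfolding cl_def by (intro continuous_intros)
  have bb: "bdd_borel (\<lambda>t. w (cl t))" if w: "continuous_on {0..T} w" for w :: "real \<Rightarrow> real"
  proof -
    have "continuous_on UNIV (\<lambda>t. w (cl t))"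
      by (rule continuous_on_compose2[OF w contcl]) (use clT in auto)
    moreover have "compact (w ` {0..T})" using w by (intro compact_continuous_image) auto
    then obtain M where "\<forall>x\<in>{0..T}. \<bar>w x\<bar> \<le> M" by (auto simp: bounded_iff dest!: compact_imp_bounded)
    ultimately show ?thesis unfolding bdd_borel_def using clT
      by (blast intro: borel_measurable_continuous_onI)
  qed
  obtain G where G: "0 \<le> G" "\<And>x. \<bar>g (cl x)\<bar> \<le> G" using bdd_borelE[OF bb[OF g]] by blast
  \<comment> \<open>Error budget: one \<eta> at each end for \<open>f\<close>, \<eta> T for
    replacing \<open>g\<close> by its mollification, and 2 G \<eta> for the omitted interval [0, 2e]
    with e <= \<eta>.\<close>
  have key: "\<bar>f T - f 0 - integral {0..T} g\<bar> \<le> \<eta> * (2 + T + 2 * G)" if \<eta>: "0 < \<eta>" for \<eta>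
  proof -
    have uc: "\<exists>r>0. \<forall>x\<in>{0..T}. \<forall>y\<in>{0..T}. \<bar>x - y\<bar> < r \<longrightarrow> \<bar>w x - w y\<bar> < \<eta>"
      if "continuous_on {0..T} w" for w :: "real \<Rightarrow> real"
      using compact_uniformly_continuous[OF that] \<eta> unfolding uniformly_continuous_on_def dist_real_def
      by (metis abs_minus_commute compact_Icc)
    obtain r1 where r1: "r1 > 0" "\<And>x y. x\<in>{0..T} \<Longrightarrow> y\<in>{0..T} \<Longrightarrow> \<bar>x - y\<bar> < r1 \<Longrightarrow> \<bar>f x - f y\<bar> < \<eta>"
      using uc[OF f] by blast
    obtain r2 where r2: "r2 > 0" "\<And>x y. x\<in>{0..T} \<Longrightarrow> y\<in>{0..T} \<Longrightarrow> \<bar>x - y\<bar> < r2 \<Longrightarrow> \<bar>g x - g y\<bar> < \<eta>"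
      using uc[OF g] by blast
    \<comment> \<open>Integration starts at 2e, safely above e. There the mollifier sees [e, 2e],
      which is still within the continuity radius of time 0 because 2e < r1.\<close>
    define e where "e = min (min (r1/3) (r2/3)) (min (T/3) \<eta>)"
    have e: "0 < e" "2 * e < r1" "2 * e < r2" "2 * e \<le> T" "e \<le> \<eta>"
      using r1(1) r2(1) T \<eta> by (auto simp: e_def)
    obtain b b' where "mollifier e b b'" using mollifier_exists[OF e(1)] by blast
    then interpret mollifier e b b' .
    define F where "F = conv b (\<lambda>t. f (cl t))"
    define F' where "F' = conv b (\<lambda>t. g (cl t))"
    have clamp: "conv q w s = conv q (\<lambda>t. w (cl t)) s" if "kernel_on e q" "e < s" "s \<le> T" for q w s
      unfolding conv_def
    proof (rule Bochner_Integration.integral_cong[OF refl])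
      fix y show "w y * q (s - y) = w (cl y) * q (s - y)"
        using that clid[of y] by (cases "y \<in> {0..T}") (auto simp: kernel_on_def)
    qed
    have dF: "(F has_real_derivative F' s) (at s)" if "e < s" "s \<le> T" for s
      using conv_has_derivative[OF bb[OF f], of s] weak[OF \<open>mollifier e b b'\<close> that]
        clamp[OF kernel that] clamp[OF kernel' that] by (simp add: F_def F'_def)
    have contF': "continuous_on S F'" for S
      unfolding F'_def
      by (rule continuous_on_subset[OF DERIV_continuous_on[OF conv_has_derivative[OF bb[OF g]]]]) auto
    have ftc: "(F' has_integral (F T - F (2 * e))) {2 * e..T}"
      by (rule fundamental_theorem_of_calculus)
         (use e dF in \<open>auto simp flip: has_real_derivative_iff_has_vector_derivative intro: has_field_derivative_at_within\<close>)
    have near: "\<bar>conv b (\<lambda>t. w (cl t)) s - a\<bar> \<le> \<eta>"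
      if "continuous_on {0..T} w" "\<And>y. s - e \<le> y \<Longrightarrow> y \<le> s \<Longrightarrow> \<bar>w (cl y) - a\<bar> \<le> \<eta>" for w s a
    proof -
      have "conv b (\<lambda>t. w (cl t)) s \<le> a + \<eta>"
        by (rule conv_le[OF bb[OF that(1)]]) (use that(2) in \<open>force simp: abs_le_iff\<close>)
      moreover have "a - \<eta> \<le> conv b (\<lambda>t. w (cl t)) s"
        by (rule conv_ge[OF bb[OF that(1)]]) (use that(2) in \<open>force simp: abs_le_iff\<close>)
      ultimately show ?thesis by linarith
    qed
    have 1: "\<bar>F T - f T\<bar> \<le> \<eta>"
      unfolding F_def
      by (rule near[OF f]) (use e r1(2) clid in \<open>auto intro!: less_imp_le\<close>)
    have 2: "\<bar>F (2 * e) - f 0\<bar> \<le> \<eta>"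
      unfolding F_def
      by (rule near[OF f]) (use e r1(2) clid in \<open>auto intro!: less_imp_le\<close>)
    have 3: "\<bar>F' s - g s\<bar> \<le> \<eta>" if "s \<in> {2*e..T}" for s
      unfolding F'_def
      by (rule near[OF g]) (use that e r2(2) clid in \<open>auto intro!: less_imp_le\<close>)
    have gi: "g integrable_on {2*e..T}" "g integrable_on {0..2*e}" "g integrable_on {0..T}"
      using e by (auto intro!: integrable_continuous_real continuous_on_subset[OF g])
    have "\<bar>integral {2*e..T} (\<lambda>s. F' s - g s)\<bar> \<le> \<eta> * (T - 2 * e)"
    proof -
      have "continuous_on {2*e..T} (\<lambda>s. F' s - g s)"
        using e by (intro continuous_intros contF' continuous_on_subset[OF g]) auto
      then show ?thesis using integral_bound[of "2*e" T "\<lambda>s. F' s - g s" \<eta>] e 3 by auto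
    qed
    also have "\<dots> \<le> \<eta> * T" using \<eta> e by simp
    finally have 4: "\<bar>F T - F (2*e) - integral {2*e..T} g\<bar> \<le> \<eta> * T"
      using ftc gi by (simp add: Henstock_Kurzweil_Integration.integral_diff has_integral_integrable integral_unique)
    have "\<bar>g s\<bar> \<le> G" if "s \<in> {0..2*e}" for s
      using G(2)[of s] clid[of s] that e by auto
    moreover have "continuous_on {0..2*e} g" using e by (intro continuous_on_subset[OF g]) auto
    ultimately have "\<bar>integral {0..2*e} g\<bar> \<le> G * (2 * e - 0)"
      using integral_bound[of 0 "2*e" g G] e by auto
    also have "\<dots> \<le> G * (2 * \<eta>)" using e G by (intro mult_left_mono) auto
    finally have 5: "\<bar>integral {0..2*e} g\<bar> \<le> 2 * G * \<eta>" by simp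
    have "integral {0..T} g = integral {0..2*e} g + integral {2*e..T} g"
      using Henstock_Kurzweil_Integration.integral_combine[of 0 "2*e" T g] e gi by simp
    then show ?thesis using 1 2 4 5 by (simp add: algebra_simps abs_le_iff)
  qed
  have "f T - f 0 - integral {0..T} g = 0"
  proof (rule ccontr)
    assume ne: "f T - f 0 - integral {0..T} g \<noteq> 0"
    define D where "D = \<bar>f T - f 0 - integral {0..T} g\<bar>"
    have pos: "0 < 2 + T + 2 * G" using T G by simp
    have "0 < D" using ne by (simp add: D_def)
    then have "D \<le> D / (2 * (2 + T + 2 * G)) * (2 + T + 2 * G)"
      using key[of "D / (2 * (2 + T + 2 * G))"] pos by (simp add: D_def)
    also have "\<dots> = D / 2" using pos by (simp add: field_simps)
    finally show False using \<open>0 < D\<close> by simp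
  qed
  then show ?thesis by simp
qed

section \<open>Balance laws in weak form\<close>

definition test_supported :: "(real \<Rightarrow> real \<Rightarrow> real) \<Rightarrow> bool" where
  "test_supported g \<longleftrightarrow> continuous_on UNIV (\<lambda>p. g (fst p) (snd p)) \<and>
     (\<exists>a b R. 0 < a \<and> (\<forall>t x. \<not> (a \<le> t \<and> t \<le> b \<and> \<bar>x\<bar> \<le> R) \<longrightarrow> g t x = 0))"

lemma deriv_zero_outside_Icc:
  assumes "\<And>t. (f has_real_derivative f' t) (at t)" "\<And>t. t \<notin> {a..b} \<Longrightarrow> f t = 0" "t \<notin> {a..b}"
  shows "f' t = 0"
proof -
  have "((\<lambda>_. 0) has_real_derivative 0) (at t)" by simp
  then have "(f has_real_derivative 0) (at t)"
    by (rule has_field_derivative_transform_within_open[where S="- {a..b}"]) (use assms in auto)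
  then show ?thesis using assms(1) DERIV_unique by blast
qed

lemma test_fun_supported:
  assumes "test_fun \<phi> \<phi>t \<phi>x"
  shows "test_supported \<phi>" "test_supported \<phi>t" "test_supported \<phi>x"
proof -
  obtain a b R where a: "0 < a" and z: "\<And>t x. \<not> (a \<le> t \<and> t \<le> b \<and> \<bar>x\<bar> \<le> R) \<Longrightarrow> \<phi> t x = 0"
    using assms unfolding test_fun_def by blast
  have dt: "\<And>t x. ((\<lambda>s. \<phi> s x) has_real_derivative \<phi>t t x) (at t)"
    and dx: "\<And>t x. ((\<lambda>y. \<phi> t y) has_real_derivative \<phi>x t x) (at x)"
    using assms unfolding test_fun_def by blast+
  have zt: "\<phi>t t x = 0" if "\<not> (a \<le> t \<and> t \<le> b \<and> \<bar>x\<bar> \<le> R)" for t x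
  proof (cases "\<bar>x\<bar> \<le> R")
    case True
    then show ?thesis using deriv_zero_outside_Icc[OF dt[where x=x], where a=a and b=b] z that by auto
  next
    case False
    \<comment> \<open>The interval {1..0} is empty: for such \<open>x\<close> the function vanishes
      at all times.\<close>
    then show ?thesis using deriv_zero_outside_Icc[OF dt[where x=x], where a=1 and b=0] z by auto
  qed
  have zx: "\<phi>x t x = 0" if "\<not> (a \<le> t \<and> t \<le> b \<and> \<bar>x\<bar> \<le> R)" for t x
  proof (cases "a \<le> t \<and> t \<le> b")
    case True
    then have "x \<notin> {-R..R}" using that by auto
    moreover have "\<phi> t y = 0" if "y \<notin> {-R..R}" for y using that by (intro z) auto
    ultimately show ?thesis using deriv_zero_outside_Icc[OF dx[where t=t], where a="-R" and b=R] by blast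
  next
    case False
    then show ?thesis using deriv_zero_outside_Icc[OF dx[where t=t], where a=1 and b=0] z by auto
  qed
  show "test_supported \<phi>" "test_supported \<phi>t" "test_supported \<phi>x"
    unfolding test_supported_def using assms a z zt zx unfolding test_fun_def by blast+
qed

lemma admissible_test_integrable:
  assumes u: "admissible u" and g: "test_supported g"
  shows "integrable lborel (\<lambda>p. u (fst p) (snd p) * g (fst p) (snd p))"
proof -
  obtain a b R where a: "0 < a" and z: "\<And>t x. \<not> (a \<le> t \<and> t \<le> b \<and> \<bar>x\<bar> \<le> R) \<Longrightarrow> g t x = 0"
    and cont: "continuous_on UNIV (\<lambda>p. g (fst p) (snd p))"
    using g unfolding test_supported_def by blast
  obtain M where M: "0 \<le> M" "\<And>t x. 0 \<le> t \<Longrightarrow> \<bar>u t x\<bar> \<le> M" using admissibleE[OF u] by blast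
  let ?B = "cbox (a, -R) (b, R)"
  have out: "g (fst p) (snd p) = 0" if "p \<notin> ?B" for p
    using that z[of "fst p" "snd p"] by (cases p) (auto simp: cbox_Pair_eq abs_le_iff)
  have "compact ((\<lambda>p. g (fst p) (snd p)) ` ?B)"
    by (intro compact_continuous_image continuous_on_subset[OF cont]) auto
  then obtain K where K: "\<And>p. p \<in> ?B \<Longrightarrow> \<bar>g (fst p) (snd p)\<bar> \<le> K"
    by (metis (no_types, lifting) bounded_iff compact_imp_bounded imageI real_norm_def)
  have K0: "\<bar>g (fst p) (snd p)\<bar> \<le> max 0 K" for p
    using K[of p] out[of p] by (cases "p \<in> ?B") (auto simp: le_max_iff_disj)
  have [measurable]: "(\<lambda>p. g (fst p) (snd p)) \<in> borel_measurable borel"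
    by (rule borel_measurable_continuous_onI[OF cont])
  have [measurable]: "(\<lambda>p. indicator ({0..} \<times> UNIV) p *\<^sub>R u (fst p) (snd p)) \<in> borel_measurable borel"
    using u by (auto simp: admissible_def set_borel_measurable_def)
  \<comment> \<open>Nothing is known of \<open>u\<close> at negative times, but \<open>g\<close> is
    zero before a > 0, so the measurable cut-off version of \<open>u\<close> may be
    inserted.\<close>
  have eq: "(\<lambda>p. u (fst p) (snd p) * g (fst p) (snd p))
      = (\<lambda>p. (indicator ({0..} \<times> UNIV) p *\<^sub>R u (fst p) (snd p)) * g (fst p) (snd p))"
  proof
    fix p :: "real \<times> real"
    show "u (fst p) (snd p) * g (fst p) (snd p)
      = (indicator ({0..} \<times> UNIV) p *\<^sub>R u (fst p) (snd p)) * g (fst p) (snd p)"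
      using z[of "fst p" "snd p"] a by (cases p) (auto simp: indicator_def)
  qed
  show ?thesis unfolding eq
  proof (rule integrable_bounded_support[where a="(a, -R)" and b="(b, R)" and M="M * max 0 K"])
    show "(\<lambda>p. (indicator ({0..} \<times> UNIV) p *\<^sub>R u (fst p) (snd p)) * g (fst p) (snd p)) \<in> borel_measurable borel"
      by measurable
    fix p
    have "\<bar>indicator ({0..} \<times> UNIV) p *\<^sub>R u (fst p) (snd p)\<bar> \<le> M"
      using M by (cases p) (auto simp: indicator_def)
    then show "\<bar>(indicator ({0..} \<times> UNIV) p *\<^sub>R u (fst p) (snd p)) * g (fst p) (snd p)\<bar> \<le> M * max 0 K"
      using K0[of p] M(1) unfolding abs_mult by (intro mult_mono) auto
  qed (use out in auto)
qed

lemma integral_deriv_compact_support: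
  fixes f :: "real \<Rightarrow> real"
  assumes "\<And>t. (f has_real_derivative f' t) (at t)" "continuous_on UNIV f'" "\<And>t. t \<notin> {a..b} \<Longrightarrow> f t = 0"
  shows "(LINT t|lborel. f' t) = 0"
proof -
  \<comment> \<open>The minimum and maximum put both ends outside {a..b} and keep A <= B even when b
    < a.\<close>
  define A B where "A = min a b - 1" and "B = max a b + 1"
  have "(LINT t|lborel. f' t) = (LINT t|lborel. indicator {A..B} t *\<^sub>R f' t)"
  proof (rule Bochner_Integration.integral_cong[OF refl])
    fix t show "f' t = indicator {A..B} t *\<^sub>R f' t"
      using deriv_zero_outside_Icc[where f=f and f'=f' and a=a and b=b and t=t, OF assms(1,3)]
      by (cases "t \<in> {a..b}") (auto simp: indicator_def A_def B_def)
  qed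
  also have "\<dots> = f B - f A"
    using assms(1) by (intro integral_FTC_Icc continuous_on_subset[OF assms(2)])
      (auto simp: A_def B_def simp flip: has_real_derivative_iff_has_vector_derivative
         intro: has_field_derivative_at_within)
  also have "\<dots> = 0"
  proof -
    have "A \<notin> {a..b}" "B \<notin> {a..b}" by (auto simp: A_def B_def)
    then show ?thesis using assms(3) by simp
  qed
  finally show ?thesis .
qed

text \<open>By Fubini, integrate first in the variable of the derivative. This removes the constants
  that the entropy inequalities carry.\<close>

lemma test_fun_integral_derivs:
  assumes "test_fun \<phi> \<phi>t \<phi>x"
  shows "(LINT p|lborel. \<phi>t (fst p) (snd p)) = 0" "(LINT p|lborel. \<phi>x (fst p) (snd p)) = 0"
proof -
  obtain a b R where a: "0 < a" and z: "\<And>t x. \<not> (a \<le> t \<and> t \<le> b \<and> \<bar>x\<bar> \<le> R) \<Longrightarrow> \<phi> t x = 0"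
    using assms unfolding test_fun_def by blast
  have dt: "\<And>t x. ((\<lambda>s. \<phi> s x) has_real_derivative \<phi>t t x) (at t)"
    and dx: "\<And>t x. ((\<lambda>y. \<phi> t y) has_real_derivative \<phi>x t x) (at x)"
    and ct: "continuous_on UNIV (\<lambda>p. \<phi>t (fst p) (snd p))"
    and cx: "continuous_on UNIV (\<lambda>p. \<phi>x (fst p) (snd p))"
    using assms unfolding test_fun_def by blast+
  have it: "integrable (lborel \<Otimes>\<^sub>M lborel) (\<lambda>p. \<phi>t (fst p) (snd p))"
    and ix: "integrable (lborel \<Otimes>\<^sub>M lborel) (\<lambda>p. \<phi>x (fst p) (snd p))"
    using admissible_test_integrable[OF admissible_const[of 1] test_fun_supported(2)[OF assms]]
      admissible_test_integrable[OF admissible_const[of 1] test_fun_supported(3)[OF assms]]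
    by (auto simp: lborel_prod)
  have "(LINT p|lborel. \<phi>t (fst p) (snd p)) = (LINT x|lborel. LINT t|lborel. \<phi>t t x)"
    using lborel_pair.integral_snd[of "\<lambda>t x. \<phi>t t x"] it by (simp add: lborel_prod case_prod_beta')
  moreover have "(LINT t|lborel. \<phi>t t x) = 0" for x
  proof (rule integral_deriv_compact_support[OF dt, where a=a and b=b])
    show "continuous_on UNIV (\<lambda>t. \<phi>t t x)"
      using continuous_on_compose2[OF ct, of UNIV "\<lambda>t. (t, x)"] by (simp add: continuous_on_Pair)
  qed (use z in auto)
  ultimately show "(LINT p|lborel. \<phi>t (fst p) (snd p)) = 0" by simp
  have "(LINT p|lborel. \<phi>x (fst p) (snd p)) = (LINT t|lborel. LINT x|lborel. \<phi>x t x)"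
    using lborel_pair.integral_fst[of "\<lambda>t x. \<phi>x t x"] ix by (simp add: lborel_prod case_prod_beta')
  moreover have "(LINT x|lborel. \<phi>x t x) = 0" for t
  proof (rule integral_deriv_compact_support[OF dx, where a="-R" and b=R])
    show "continuous_on UNIV (\<lambda>x. \<phi>x t x)"
      using continuous_on_compose2[OF cx, of UNIV "\<lambda>x. (t, x)"] by (simp add: continuous_on_Pair)
    show "\<phi> t x = 0" if "x \<notin> {-R..R}" for x using that by (intro z) auto
  qed
  ultimately show "(LINT p|lborel. \<phi>x (fst p) (snd p)) = 0" by simp
qed

text \<open>This is A_t + F_x = S in the sense of distributions on t > 0. Only nonnegative test
  functions occur, since the entropy inequalities provide no others; products of mollifiers are of
  this kind.\<close>

definition weak_balance ::
    "(real \<Rightarrow> real \<Rightarrow> real) \<Rightarrow> (real \<Rightarrow> real \<Rightarrow> real) \<Rightarrow> (real \<Rightarrow> real \<Rightarrow> real) \<Rightarrow> bool" where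
  "weak_balance A F S \<longleftrightarrow> (\<forall>\<phi> \<phi>t \<phi>x. test_fun \<phi> \<phi>t \<phi>x \<and> (\<forall>t x. 0 \<le> \<phi> t x) \<longrightarrow>
     (LINT p|lborel. A (fst p) (snd p) * \<phi>t (fst p) (snd p) + F (fst p) (snd p) * \<phi>x (fst p) (snd p)
        + S (fst p) (snd p) * \<phi> (fst p) (snd p)) = 0)"

text \<open>For a constant \<open>k\<close> outside the range of \<open>u\<close> the sign of u - k
  is fixed and the Kruzkov inequality becomes one about the weak form itself, up to integrals of
  derivatives of the test function. Constants below and above the range give opposite
  inequalities.\<close>

lemma entropy_solution_weak_balance:
  assumes "burgers_entropy_solution u0 u"
  shows "weak_balance u (\<lambda>t x. u t x * u t x / 2) (\<lambda>t x. 0)"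
  unfolding weak_balance_def
proof (intro allI impI, elim conjE)
  fix \<phi> \<phi>t \<phi>x assume test: "test_fun \<phi> \<phi>t \<phi>x" and pos: "\<forall>t x. 0 \<le> \<phi> t x"
  have u: "admissible u" using assms by (simp add: burgers_entropy_solution_def)
  obtain M where M: "0 \<le> M" "\<And>t x. 0 \<le> t \<Longrightarrow> \<bar>u t x\<bar> \<le> M" using admissibleE[OF u] by blast
  \<comment> \<open>The added 1 keeps u + K and u - K away from 0, where \<open>sgn\<close> would
    vanish.\<close>
  define K where "K = M + 1"
  let ?X = "\<lambda>p. u (fst p) (snd p) * \<phi>t (fst p) (snd p) + u (fst p) (snd p) * u (fst p) (snd p) / 2 * \<phi>x (fst p) (snd p)"
  let ?E = "\<lambda>k p. \<bar>u (fst p) (snd p) - k\<bar> * \<phi>t (fst p) (snd p)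
               + sgn (u (fst p) (snd p) - k) * ((u (fst p) (snd p))\<^sup>2 / 2 - k\<^sup>2 / 2) * \<phi>x (fst p) (snd p)"
  note sup = test_fun_supported[OF test]
  have i1: "integrable lborel (\<lambda>p. \<phi>t (fst p) (snd p))" "integrable lborel (\<lambda>p. \<phi>x (fst p) (snd p))"
    using admissible_test_integrable[OF admissible_const[of 1] sup(2)]
      admissible_test_integrable[OF admissible_const[of 1] sup(3)] by auto
  have "admissible (\<lambda>t x. 1/2 * (u t x * u t x))" using u by (intro admissible_cmult admissible_mult)
  then have i2: "integrable lborel ?X"
    using admissible_test_integrable[OF u sup(2)] admissible_test_integrable[OF _ sup(3), of "\<lambda>t x. 1/2 * (u t x * u t x)"]
    by (intro Bochner_Integration.integrable_add) auto
  have zero: "\<phi>t t x = 0" "\<phi>x t x = 0" if "t < 0" for t x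
    using sup that unfolding test_supported_def by (meson less_le_not_le less_trans not_le)+
  have E1: "?E (-K) p = ?X p + K * \<phi>t (fst p) (snd p) - K\<^sup>2 / 2 * \<phi>x (fst p) (snd p)" for p
  proof (cases "0 \<le> fst p")
    case True
    then have "u (fst p) (snd p) + K > 0" using M(2)[of "fst p" "snd p"] by (simp add: K_def abs_le_iff)
    then show ?thesis by (simp add: algebra_simps power2_eq_square)
  qed (use zero in auto)
  have E2: "?E K p = -1 * ?X p + K * \<phi>t (fst p) (snd p) + K\<^sup>2 / 2 * \<phi>x (fst p) (snd p)" for p
  proof (cases "0 \<le> fst p")
    case True
    then have "u (fst p) (snd p) - K < 0" using M(2)[of "fst p" "snd p"] by (simp add: K_def abs_le_iff)
    then show ?thesis by (simp add: algebra_simps power2_eq_square)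
  qed (use zero in auto)
  have "0 \<le> integral\<^sup>L lborel (?E (-K))" "0 \<le> integral\<^sup>L lborel (?E K)"
    using assms test pos unfolding burgers_entropy_solution_def by blast+
  moreover have "integral\<^sup>L lborel (?E (-K)) = integral\<^sup>L lborel ?X"
    unfolding E1 using i1 i2 test_fun_integral_derivs[OF test] by simp
  moreover have "integral\<^sup>L lborel (?E K) = - integral\<^sup>L lborel ?X"
  proof -
    have "integral\<^sup>L lborel (\<lambda>p. -1 * ?X p + K * \<phi>t (fst p) (snd p) + K\<^sup>2 / 2 * \<phi>x (fst p) (snd p))
        = integral\<^sup>L lborel (\<lambda>p. -1 * ?X p) + integral\<^sup>L lborel (\<lambda>p. K * \<phi>t (fst p) (snd p))
          + integral\<^sup>L lborel (\<lambda>p. K\<^sup>2 / 2 * \<phi>x (fst p) (snd p))"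
      using i1 i2 by (simp only: Bochner_Integration.integral_add Bochner_Integration.integrable_add integrable_mult_right)
    then show ?thesis unfolding E2 integral_mult_right_zero using test_fun_integral_derivs[OF test] by simp
  qed
  ultimately show "(LINT p|lborel. u (fst p) (snd p) * \<phi>t (fst p) (snd p)
      + u (fst p) (snd p) * u (fst p) (snd p) / 2 * \<phi>x (fst p) (snd p) + 0 * \<phi> (fst p) (snd p)) = 0"
    by simp
qed

text \<open>The test function is b(s - t) exp(\<kappa> t) k(x + \<gamma> t - y): it mollifies in
  time at \<open>s\<close> and in space along the line of speed \<gamma>, with an integrating
  factor. Its time derivative yields the term with \<open>b'\<close>, that is \<open>f\<close>, and
  also \<kappa> A and \<gamma> A; these join the source and the flux to form \<open>g\<close>. The
  condition e < s keeps the support in positive times.\<close>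

lemma (in mollifier) weak_balance_mollified_test:
  assumes A: "admissible A" and F: "admissible F" and S: "admissible S" and wb: "weak_balance A F S"
    and m: "mollifier e b b'" and s: "e < s"
    and f_def: "\<And>t. f t = exp (\<kappa> * t) * conv k (A t) (x + \<gamma> * t)"
    and g_def: "\<And>t. g t = exp (\<kappa> * t) * (conv k (\<lambda>y. S t y + \<kappa> * A t y) (x + \<gamma> * t)
          - conv k' (\<lambda>y. F t y - \<gamma> * A t y) (x + \<gamma> * t))"
    and T: "s \<le> T" and contf: "continuous_on {0..T} f" and contg: "continuous_on {0..T} g"
  shows "conv b' f s = conv b g s"
proof -
  interpret m: mollifier e b b' by (rule m)
  define \<phi> where "\<phi> t y = b (s - t) * exp (\<kappa> * t) * k (x + \<gamma> * t - y)" for t y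
  define \<phi>t where "\<phi>t t y = - (b' (s - t) * exp (\<kappa> * t) * k (x + \<gamma> * t - y))
      + b (s - t) * exp (\<kappa> * t) * (\<kappa> * k (x + \<gamma> * t - y) + \<gamma> * k' (x + \<gamma> * t - y))" for t y
  define \<phi>x where "\<phi>x t y = - (b (s - t) * exp (\<kappa> * t) * k' (x + \<gamma> * t - y))" for t y
  have ck: "continuous_on UNIV k" "continuous_on UNIV k'" "continuous_on UNIV b" "continuous_on UNIV b'"
    using kernel kernel' m.kernel m.kernel' by (auto simp: kernel_on_def)
  note ck' = continuous_on_compose2[OF ck(1)] continuous_on_compose2[OF ck(2)]
    continuous_on_compose2[OF ck(3)] continuous_on_compose2[OF ck(4)]
  have bz: "b (s - t) = 0" "b' (s - t) = 0" if "t < s - e \<or> s < t" for t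
    using m.kernel m.kernel' that by (auto simp: kernel_on_def)
  have test: "test_fun \<phi> \<phi>t \<phi>x"
    unfolding test_fun_def
  proof (intro conjI allI)
    fix t y
    note d1 = DERIV_chain2[OF m.deriv] and d2 = DERIV_chain2[OF deriv]
    show "((\<lambda>t. \<phi> t y) has_real_derivative \<phi>t t y) (at t)"
      unfolding \<phi>_def \<phi>t_def
      by (rule DERIV_cong, (rule derivative_intros d1 d2)+) (simp add: algebra_simps)
    show "(\<phi> t has_real_derivative \<phi>x t y) (at y)"
      unfolding \<phi>_def[abs_def] \<phi>x_def
      by (rule DERIV_cong, (rule derivative_intros d1 d2)+) (simp add: algebra_simps)
  next
    show "continuous_on UNIV (\<lambda>p. \<phi> (fst p) (snd p))"
      "continuous_on UNIV (\<lambda>p. \<phi>t (fst p) (snd p))"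
      "continuous_on UNIV (\<lambda>p. \<phi>x (fst p) (snd p))"
      unfolding \<phi>_def \<phi>t_def \<phi>x_def by (intro continuous_intros ck'; simp)+
  next
    define R where "R = \<bar>x\<bar> + \<bar>\<gamma>\<bar> * s + d"
    have "\<phi> t y = 0" if "\<not> (s - e \<le> t \<and> t \<le> s \<and> \<bar>y\<bar> \<le> R)" for t y
    proof (cases "s - e \<le> t \<and> t \<le> s")
      case True
      have "\<bar>\<gamma> * t\<bar> \<le> \<bar>\<gamma>\<bar> * s" using True s unfolding abs_mult by (intro mult_left_mono) auto
      then have "x + \<gamma> * t - y \<notin> {0..d}" using True that by (auto simp: R_def)
      then show ?thesis using support by (simp add: \<phi>_def)
    qed (use bz in \<open>auto simp: \<phi>_def\<close>)
    then show "\<exists>a b R. 0 < a \<and> (\<forall>t x. \<not> (a \<le> t \<and> t \<le> b \<and> \<bar>x\<bar> \<le> R) \<longrightarrow> \<phi> t x = 0)"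
      using s by (intro exI[of _ "s - e"] exI[of _ s] exI[of _ R]) auto
  qed
  let ?G = "\<lambda>p. A (fst p) (snd p) * \<phi>t (fst p) (snd p) + F (fst p) (snd p) * \<phi>x (fst p) (snd p)
        + S (fst p) (snd p) * \<phi> (fst p) (snd p)"
  have pos: "\<forall>t y. 0 \<le> \<phi> t y" using nonneg m.nonneg by (simp add: \<phi>_def)
  note sup = test_fun_supported[OF test]
  have "integrable lborel ?G"
    by (intro Bochner_Integration.integrable_add admissible_test_integrable A F S sup)
  then have "(LINT t|lborel. LINT y|lborel. ?G (t, y)) = integral\<^sup>L lborel ?G"
    using lborel_pair.integral_fst'[of ?G] by (simp add: lborel_prod)
  also have "\<dots> = 0" using wb test pos unfolding weak_balance_def by blast
  finally have zero: "(LINT t|lborel. LINT y|lborel. ?G (t, y)) = 0" .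
  have inner: "(LINT y|lborel. ?G (t, y)) = g t * b (s - t) - f t * b' (s - t)" for t
  proof (cases "s - e \<le> t \<and> t \<le> s")
    case True
    then have t: "0 \<le> t" using s by auto
    note bA = admissible_bdd_borel[OF A t] and bF = admissible_bdd_borel[OF F t] and bS = admissible_bdd_borel[OF S t]
    note i = conv_integrable[OF bA kernel, of "x + \<gamma> * t"]
      conv_integrable[OF bdd_borel_add[OF bS bdd_borel_cmult[OF bA, of \<kappa>]] kernel, of "x + \<gamma> * t"]
      conv_integrable[OF bdd_borel_diff[OF bF bdd_borel_cmult[OF bA, of \<gamma>]] kernel', of "x + \<gamma> * t"]
    have "(LINT y|lborel. ?G (t, y))
      = (LINT y|lborel. b (s - t) * exp (\<kappa> * t) * ((S t y + \<kappa> * A t y) * k (x + \<gamma> * t - y)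
         - (F t y - \<gamma> * A t y) * k' (x + \<gamma> * t - y))
         - b' (s - t) * exp (\<kappa> * t) * (A t y * k (x + \<gamma> * t - y)))"
      by (rule Bochner_Integration.integral_cong) (auto simp: \<phi>_def \<phi>t_def \<phi>x_def algebra_simps)
    also have "\<dots> = g t * b (s - t) - f t * b' (s - t)"
      using i by (simp add: conv_def f_def g_def)
    finally show ?thesis .
  next
    case False
    then have "b (s - t) = 0" "b' (s - t) = 0" using bz by auto
    then show ?thesis by (simp add: \<phi>_def \<phi>t_def \<phi>x_def)
  qed
  have int: "integrable lborel (\<lambda>t. w t * q (s - t))"
    if w: "continuous_on {0..T} w" and q: "kernel_on e q" for w q
  proof -
    have "set_integrable lborel {s - e..s} (\<lambda>t. w t * q (s - t))"
      unfolding set_integrable_def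
      by (rule borel_integrable_compact)
         (use q s T in \<open>auto intro!: continuous_intros continuous_on_subset[OF w] continuous_on_compose2[of UNIV q] simp: kernel_on_def\<close>)
    moreover have "(\<lambda>t. indicator {s - e..s} t *\<^sub>R (w t * q (s - t))) = (\<lambda>t. w t * q (s - t))"
    proof
      fix t show "indicator {s - e..s} t *\<^sub>R (w t * q (s - t)) = w t * q (s - t)"
        using q by (cases "s - t \<in> {0..e}") (auto simp: kernel_on_def)
    qed
    ultimately show ?thesis unfolding set_integrable_def by simp
  qed
  have "0 = (LINT t|lborel. g t * b (s - t) - f t * b' (s - t))"
    using zero unfolding inner by simp
  also have "\<dots> = conv b g s - conv b' f s"
    unfolding conv_def by (rule Bochner_Integration.integral_diff) (auto intro: int contf contg m.kernel m.kernel')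
  finally show ?thesis by simp
qed

text \<open>For the Riemann invariants, \<open>\<gamma>\<close> and \<open>\<kappa>\<close> will be chosen so that \<open>F = \<gamma> A\<close> and \<open>S + \<kappa> A\<close> depends
  on \<open>u\<close> only, which makes this an explicit formula for \<open>A\<close>.\<close>

lemma (in mollifier) weak_balance_mollified:
  assumes A: "admissible A" and F: "admissible F" and S: "admissible S" and wb: "weak_balance A F S"
    and t: "0 \<le> t"
  shows "exp (\<kappa> * t) * conv k (A t) (x + \<gamma> * t) = conv k (A 0) x
    + integral {0..t} (\<lambda>s. exp (\<kappa> * s) * (conv k (\<lambda>y. S s y + \<kappa> * A s y) (x + \<gamma> * s)
          - conv k' (\<lambda>y. F s y - \<gamma> * A s y) (x + \<gamma> * s)))"
proof (cases "t = 0")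
  case False
  define f where "f t = exp (\<kappa> * t) * conv k (A t) (x + \<gamma> * t)" for t
  define g where "g t = exp (\<kappa> * t) * (conv k (\<lambda>y. S t y + \<kappa> * A t y) (x + \<gamma> * t)
          - conv k' (\<lambda>y. F t y - \<gamma> * A t y) (x + \<gamma> * t))" for t
  have adm: "admissible (\<lambda>t y. S t y + \<kappa> * A t y)" "admissible (\<lambda>t y. F t y - \<gamma> * A t y)"
    using A F S by (auto intro!: admissible_add admissible_diff admissible_cmult)
  have f: "continuous_on {0..t} f" unfolding f_def
    by (intro continuous_intros conv_continuous_on[OF A kernel]) auto
  have g: "continuous_on {0..t} g" unfolding g_def
    by (intro continuous_intros conv_continuous_on[OF adm(1) kernel] conv_continuous_on[OF adm(2) kernel']) auto
  have "f t = f 0 + integral {0..t} g"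
    by (rule du_bois_reymond[OF _ f g])
       (use False t in \<open>auto intro!: weak_balance_mollified_test[OF A F S wb _ _ f_def g_def _ f g]\<close>)
  then show ?thesis by (simp add: f_def g_def[abs_def])
qed simp

section \<open>Transport by a compressive velocity field\<close>

text \<open>With r = E_t + a E_x, differentiating the integral of |E| \<omega> gives sgn(E) r
  \<omega> + a_x |E| \<omega> + |E| (\<omega>_t + a \<omega>_x) up to an exact x-derivative. The
  second term has a sign since \<open>a\<close> is nonincreasing, the third because \<omega>
  decreases along the flow. Only the L^1 norm of r remains, without any exponential factor.\<close>

lemma transport_L1_bound:
  fixes E Et Ex a ax :: "real \<Rightarrow> real \<Rightarrow> real"
  assumes T: "0 \<le> T" and L: "0 \<le> L" and E0: "\<And>x. E 0 x = 0"
    and dt: "\<And>t x. t \<in> {0..T} \<Longrightarrow> ((\<lambda>t. E t x) has_real_derivative Et t x) (at t within {0..T})"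
    and dx: "\<And>t x. t \<in> {0..T} \<Longrightarrow> (E t has_real_derivative Ex t x) (at x)"
    and da: "\<And>t x. t \<in> {0..T} \<Longrightarrow> (a t has_real_derivative ax t x) (at x)"
    and cE: "continuous_on ({0..T} \<times> UNIV) (\<lambda>p. E (fst p) (snd p))"
    and cEt: "continuous_on ({0..T} \<times> UNIV) (\<lambda>p. Et (fst p) (snd p))"
    and cEx: "continuous_on ({0..T} \<times> UNIV) (\<lambda>p. Ex (fst p) (snd p))"
    and ca: "continuous_on ({0..T} \<times> UNIV) (\<lambda>p. a (fst p) (snd p))"
    and a: "\<And>t x. t \<in> {0..T} \<Longrightarrow> \<bar>a t x\<bar> \<le> 1/2" "\<And>t x. t \<in> {0..T} \<Longrightarrow> ax t x \<le> 0"
    and K: "\<And>t N. t \<in> {0..T} \<Longrightarrow> 0 \<le> N \<Longrightarrow> integral {-N..N} (\<lambda>x. \<bar>Et t x + a t x * Ex t x\<bar>) \<le> K"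
  shows "integral {-L..L} (\<lambda>x. \<bar>E T x\<bar>) \<le> K * T"
proof -
  \<comment> \<open>The weight lives on a backward cone whose speed 1/2 is the bound for
    \<open>a\<close>: it equals 1 on [-L, L] at time T and vanishes at -N and N at all times t >= 0.
    The extra 1 in \<open>N\<close> is the width of the transition of \<theta>.\<close>
  define b where "b = L + T / 2"
  define N where "N = b + 1"
  have b0: "0 \<le> b" "0 \<le> N" "L \<le> N" using T L by (auto simp: b_def N_def)
  define \<theta> where "\<theta> r = (max 0 (1 - (max 0 r)^2))^2" for r :: real
  define \<theta>' where "\<theta>' r = 2 * max 0 (1 - (max 0 r)^2) * (0 - 2 * max 0 r * 1)" for r :: real
  have d\<theta>: "(\<theta> has_real_derivative \<theta>' r) (at r)" for r
    unfolding \<theta>_def[abs_def] \<theta>'_def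
    by (intro DERIV_pos_part_square DERIV_diff DERIV_const DERIV_ident)
  have \<theta>0: "0 \<le> \<theta> r" "\<theta> r \<le> 1" "\<theta>' r \<le> 0" for r
    by (auto simp: \<theta>_def \<theta>'_def intro!: power_le_one mult_nonneg_nonpos)
  have \<theta>1: "\<theta> r = 1" if "r \<le> 0" for r using that by (simp add: \<theta>_def)
  have \<theta>2: "\<theta> r = 0" if "1 \<le> r" for r
  proof -
    have "1 - (max 0 r)^2 \<le> 0" using that one_le_power[of "max 0 r" 2] by simp
    then show ?thesis by (simp add: \<theta>_def max_absorb1)
  qed
  have c\<theta>: "continuous_on S \<theta>" "continuous_on S \<theta>'" for S
    unfolding \<theta>_def[abs_def] \<theta>'_def[abs_def] by (intro continuous_intros)+
  note c\<theta>' = continuous_on_compose2[OF c\<theta>(1)[of UNIV]] continuous_on_compose2[OF c\<theta>(2)[of UNIV]]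
  note d\<theta>' = DERIV_chain2[OF d\<theta>] 
  define \<omega> where "\<omega> t x = \<theta> (x + t/2 - b) * \<theta> (t/2 - x - b)" for t x
  define \<omega>t where "\<omega>t t x = \<theta>' (x + t/2 - b) * (1/2) * \<theta> (t/2 - x - b) + \<theta>' (t/2 - x - b) * (1/2) * \<theta> (x + t/2 - b)" for t x
  define \<omega>x where "\<omega>x t x = \<theta>' (x + t/2 - b) * \<theta> (t/2 - x - b) - \<theta>' (t/2 - x - b) * \<theta> (x + t/2 - b)" for t x
  have d\<omega>t: "((\<lambda>t. \<omega> t x) has_real_derivative \<omega>t t x) (at t within S)" for t x S
    unfolding \<omega>_def \<omega>t_def
    by (rule has_field_derivative_at_within, rule DERIV_cong, rule DERIV_mult, (rule d\<theta>', (auto intro!: derivative_eq_intros)[1])+)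
       (simp add: algebra_simps)
  have d\<omega>x: "(\<omega> t has_real_derivative \<omega>x t x) (at x)" for t x
    unfolding \<omega>_def[abs_def] \<omega>x_def
    by (rule DERIV_cong, rule DERIV_mult, (rule d\<theta>', (auto intro!: derivative_eq_intros)[1])+)
       (simp add: algebra_simps)
  have \<omega>0: "0 \<le> \<omega> t x" "\<omega> t x \<le> 1" for t x using \<theta>0 by (auto simp: \<omega>_def intro!: mult_le_one)
  have \<omega>N: "\<omega> t N = 0" "\<omega> t (-N) = 0" if "0 \<le> t" for t
    using that by (auto simp: \<omega>_def N_def \<theta>2)
  have \<omega>T: "\<omega> T x = 1" if "x \<in> {-L..L}" for x
    using that by (auto simp: \<omega>_def b_def \<theta>1)
  \<comment> \<open>The two edges contribute with the coefficients 1/2 + a and 1/2 - a, both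
    nonnegative, times the nonpositive slopes of \<theta>.\<close>
  have \<omega>le: "\<omega>t t x + a t x * \<omega>x t x \<le> 0" if "t \<in> {0..T}" for t x
  proof -
    have "\<omega>t t x + a t x * \<omega>x t x = (1/2 + a t x) * \<theta> (t/2 - x - b) * \<theta>' (x + t/2 - b)
       + (1/2 - a t x) * \<theta> (x + t/2 - b) * \<theta>' (t/2 - x - b)"
      by (simp add: \<omega>t_def \<omega>x_def algebra_simps)
    also have "\<dots> \<le> 0"
      using \<theta>0 a(1)[OF that, of x] by (intro add_nonpos_nonpos mult_nonneg_nonpos mult_nonneg_nonneg) (auto simp: abs_le_iff)
    finally show ?thesis .
  qed
  have main: "integral {-L..L} (\<lambda>x. \<bar>E T x\<bar>) \<le> K * T + 2 * N * \<kappa>" if \<kappa>: "0 < \<kappa>" for \<kappa>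
  proof -
    \<comment> \<open>Smooth substitute for |E|. Since E(0) = 0 it starts at \<kappa>, which costs
      at most 2 N \<kappa>; \<open>N\<close> does not depend on \<kappa>, so this disappears in the
      limit.\<close>
    define B where "B t x = sqrt ((E t x)^2 + \<kappa>^2)" for t x
    have pos: "0 < (E t x)^2 + \<kappa>^2" for t x using \<kappa> by (simp add: add_nonneg_pos)
    have B0: "0 < B t x" for t x using pos by (simp add: B_def)
    have BE: "\<bar>E t x\<bar> \<le> B t x" for t x
      unfolding B_def by (rule real_le_rsqrt) (use \<kappa> in simp)
    have dBt: "((\<lambda>t. B t x) has_real_derivative E t x * Et t x / B t x) (at t within {0..T})"
      if "t \<in> {0..T}" for t x
      unfolding B_def using pos[of t x] dt[OF that, of x]
      by (auto intro!: derivative_eq_intros simp: field_simps)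
    have dBx: "(B t has_real_derivative E t x * Ex t x / B t x) (at x)"
      if "t \<in> {0..T}" for t x
      unfolding B_def[abs_def] using pos[of t x] dx[OF that, of x]
      by (auto intro!: derivative_eq_intros simp: field_simps)
    \<comment> \<open>\<open>D\<close> is the time derivative of B \<omega>, and \<open>G\<close>
      the space derivative of a B \<omega>. The integral of \<open>G\<close> over [-N, N] is zero
      because \<omega> vanishes at both ends.\<close>
    define D where "D t x = E t x * Et t x / B t x * \<omega> t x + \<omega>t t x * B t x" for t x
    define G where "G t x = (ax t x * (B t x * \<omega> t x)) + (E t x * Ex t x / B t x * \<omega> t x + \<omega>x t x * B t x) * a t x" for t x
    define I where "I t = integral {-N..N} (\<lambda>x. B t x * \<omega> t x)" for t
    have cB: "continuous_on ({0..T} \<times> UNIV) (\<lambda>p. B (fst p) (snd p))"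
      unfolding B_def by (intro continuous_intros cE)
    have c\<omega>: "continuous_on S (\<lambda>p. \<omega> (fst p) (snd p))" "continuous_on S (\<lambda>p. \<omega>t (fst p) (snd p))" for S
      unfolding \<omega>_def \<omega>t_def by (intro continuous_intros c\<theta>'; simp)+
    have cD: "continuous_on ({0..T} \<times> UNIV) (\<lambda>p. D (fst p) (snd p))"
      unfolding D_def using B0 by (intro continuous_intros cE cEt cB c\<omega>) (auto simp: less_imp_neq[symmetric])
    have sec: "continuous_on S (w t)" if "continuous_on ({0..T} \<times> UNIV) (\<lambda>p. w (fst p) (snd p))" "t \<in> {0..T}"
      for w :: "real \<Rightarrow> real \<Rightarrow> real" and t S
    proof -
      have "continuous_on S (\<lambda>x. (\<lambda>p. w (fst p) (snd p)) (t, x))"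
        by (rule continuous_on_compose2[OF that(1)]) (use that(2) in \<open>auto intro!: continuous_intros\<close>)
      then show ?thesis by simp
    qed
    have cB\<omega>: "continuous_on ({0..T} \<times> UNIV) (\<lambda>p. B (fst p) (snd p) * \<omega> (fst p) (snd p))"
      by (intro continuous_intros cB c\<omega>)
    have dI: "(I has_real_derivative integral {-N..N} (D t)) (at t within {0..T})" if "t \<in> {0..T}" for t
      unfolding I_def[abs_def] box_real[symmetric]
    proof (rule leibniz_rule_field_derivative)
      show "((\<lambda>t. B t x * \<omega> t x) has_real_derivative D t x) (at t within cbox 0 T)" if "t \<in> cbox 0 T" for t x
        unfolding D_def using DERIV_mult[OF dBt d\<omega>t, of t x x] that by (simp add: algebra_simps)
      show "(\<lambda>x. B t x * \<omega> t x) integrable_on cbox (-N) N" if "t \<in> cbox 0 T" for t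
        using sec[of "\<lambda>t x. B t x * \<omega> t x" t, OF cB\<omega>] that by (intro integrable_continuous) auto
      show "continuous_on (cbox 0 T \<times> cbox (-N) N) (\<lambda>(t, x). D t x)"
        using continuous_on_subset[OF cD, of "cbox 0 T \<times> cbox (-N) N"] by (simp add: case_prod_beta' Times_subset_cancel2 subset_iff)
    qed (use that in auto)
    have le: "D t x \<le> \<bar>Et t x + a t x * Ex t x\<bar> - G t x" if t: "t \<in> {0..T}" for t x
    proof -
      let ?e = "E t x / B t x"
      have e: "\<bar>?e\<bar> \<le> 1" using BE[of t x] B0[of t x] by (simp add: abs_divide)
      have "D t x + G t x = ?e * (Et t x + a t x * Ex t x) * \<omega> t x + ax t x * (B t x * \<omega> t x)
         + B t x * (\<omega>t t x + a t x * \<omega>x t x)"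
        by (simp add: D_def G_def algebra_simps)
      moreover have "?e * (Et t x + a t x * Ex t x) * \<omega> t x \<le> \<bar>Et t x + a t x * Ex t x\<bar>"
      proof -
        have "\<bar>?e * (Et t x + a t x * Ex t x) * \<omega> t x\<bar> = \<bar>?e\<bar> * \<bar>Et t x + a t x * Ex t x\<bar> * \<omega> t x"
          using \<omega>0[of t x] by (simp add: abs_mult)
        also have "\<dots> \<le> 1 * \<bar>Et t x + a t x * Ex t x\<bar> * 1"
          using e \<omega>0[of t x] by (intro mult_mono) auto
        also have "\<dots> = \<bar>Et t x + a t x * Ex t x\<bar>" by simp
        finally show ?thesis by (rule abs_le_D1)
      qed
      moreover have "ax t x * (B t x * \<omega> t x) \<le> 0"
        using a(2)[OF t, of x] B0[of t x] \<omega>0[of t x] by (intro mult_nonpos_nonneg mult_nonneg_nonneg) auto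
      moreover have "B t x * (\<omega>t t x + a t x * \<omega>x t x) \<le> 0"
        using \<omega>le[OF t, of x] B0[of t x] by (intro mult_nonneg_nonpos) auto
      ultimately show ?thesis by linarith
    qed
    have Ile: "integral {-N..N} (D t) \<le> K" if t: "t \<in> {0..T}" for t
    proof -
      have G: "(G t has_integral (a t N * (B t N * \<omega> t N) - a t (-N) * (B t (-N) * \<omega> t (-N)))) {-N..N}"
      proof (rule fundamental_theorem_of_calculus)
        fix x
        have "((\<lambda>x. a t x * (B t x * \<omega> t x)) has_real_derivative G t x) (at x)"
          unfolding G_def by (rule DERIV_mult[OF da[OF t] DERIV_mult[OF dBx[OF t] d\<omega>x]])
        then show "((\<lambda>x. a t x * (B t x * \<omega> t x)) has_vector_derivative G t x) (at x within {-N..N})"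
          by (simp add: has_real_derivative_iff_has_vector_derivative has_vector_derivative_at_within)
      qed (use b0 in auto)
      have cN: "continuous_on {-N..N} (\<lambda>x. \<bar>Et t x + a t x * Ex t x\<bar>)"
        by (intro continuous_intros sec[OF cEt t] sec[OF ca t] sec[OF cEx t])
      have "integral {-N..N} (D t) \<le> integral {-N..N} (\<lambda>x. \<bar>Et t x + a t x * Ex t x\<bar> - G t x)"
        using le[OF t]
        by (intro integral_le integrable_diff has_integral_integrable[OF G]
            integrable_continuous_real[OF cN] integrable_continuous_real[OF sec[OF cD t]]) auto
      also have "\<dots> = integral {-N..N} (\<lambda>x. \<bar>Et t x + a t x * Ex t x\<bar>) - integral {-N..N} (G t)"
        by (intro Henstock_Kurzweil_Integration.integral_diff integrable_continuous_real[OF cN] has_integral_integrable[OF G])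
      also have "integral {-N..N} (G t) = 0"
        using integral_unique[OF G] \<omega>N t by simp
      finally show ?thesis using K[OF t b0(2)] by simp
    qed
    have "I T - K * T \<le> I 0 - K * 0"
    proof (rule DERIV_nonpos_imp_decreasing_open[of 0 T "\<lambda>t. I t - K * t"])
      show "0 \<le> T" by (rule T)
      show "\<exists>y. ((\<lambda>t. I t - K * t) has_real_derivative y) (at t) \<and> y \<le> 0" if "0 < t" "t < T" for t
      proof (intro exI conjI)
        have "(I has_real_derivative integral {-N..N} (D t)) (at t)"
          using dI[of t] that at_within_Icc_at[of 0 t T] by simp
        then show "((\<lambda>t. I t - K * t) has_real_derivative integral {-N..N} (D t) - K) (at t)"
          by (auto intro!: derivative_eq_intros)
        show "integral {-N..N} (D t) - K \<le> 0" using Ile[of t] that by simp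
      qed
      show "continuous_on {0..T} (\<lambda>t. I t - K * t)"
        by (intro continuous_intros DERIV_continuous_on[of _ I]) (rule dI)
    qed
    moreover have "I 0 \<le> 2 * N * \<kappa>"
    proof -
      have "I 0 \<le> integral {-N..N} (\<lambda>x. \<kappa>)"
        unfolding I_def
      proof (rule integral_le)
        show "(\<lambda>x. B 0 x * \<omega> 0 x) integrable_on {-N..N}"
          using sec[of "\<lambda>t x. B t x * \<omega> t x" 0, OF cB\<omega>] T by (intro integrable_continuous_real) auto
        show "B 0 x * \<omega> 0 x \<le> \<kappa>" for x
          using \<kappa> \<omega>0[of 0 x] by (simp add: B_def E0 mult_left_le)
      qed auto
      then show ?thesis using b0 by (simp add: mult.commute)
    qed
    moreover have "integral {-L..L} (\<lambda>x. \<bar>E T x\<bar>) \<le> I T"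
    proof -
      have cT: "continuous_on S (\<lambda>x. B T x * \<omega> T x)" for S
        using sec[of "\<lambda>t x. B t x * \<omega> t x" T, OF cB\<omega>] T by auto
      have "integral {-L..L} (\<lambda>x. \<bar>E T x\<bar>) \<le> integral {-L..L} (\<lambda>x. B T x * \<omega> T x)"
        by (intro integral_le integrable_continuous_real continuous_intros cT sec[OF cE]) (use BE \<omega>T T in auto)
      also have "\<dots> \<le> I T"
        unfolding I_def
        by (intro integral_subset_le integrable_continuous_real cT) (use b0 B0 \<omega>0 in \<open>auto simp: less_imp_le\<close>)
      finally show ?thesis .
    qed
    ultimately show ?thesis by simp
  qed
  show ?thesis
  proof (rule field_le_epsilon)
    fix e :: real assume "0 < e"
    have "0 < N" using b0 by (simp add: N_def)
    then show "integral {-L..L} (\<lambda>x. \<bar>E T x\<bar>) \<le> K * T + e"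
      using main[of "e / (2 * N)"] \<open>0 < e\<close> by (simp add: field_simps)
  qed
qed

text \<open>Shifting the two integrals leaves only two end pieces, each of length p + q, on which
  |w| <= 1/2. The bound is thus independent of \<open>L\<close>: the shift times a total variation
  of at most 1.\<close>

lemma antimono_oscillation_integral:
  fixes w :: "real \<Rightarrow> real"
  assumes w: "continuous_on UNIV w" "antimono w" "\<And>x. \<bar>w x\<bar> \<le> 1/2" and "0 \<le> p" "0 \<le> q" "0 \<le> L"
  shows "integral {-L..L} (\<lambda>x. w (x - p) - w (x + q)) \<le> p + q"
proof -
  note i = integrable_continuous_real[OF continuous_on_subset[OF w(1) subset_UNIV]]
  \<comment> \<open>Leftmost point of all windows involved, hence a common base point for the
    primitive \<open>J\<close>.\<close>
  define A where "A = -L - p"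
  define J where "J x = integral {A..x} w" for x
  have J: "integral {x..y} w = J y - J x" if "A \<le> x" "x \<le> y" for x y
    using Henstock_Kurzweil_Integration.integral_combine[of A x y w] that i by (simp add: J_def)
  have bd: "\<bar>integral {x..y} w\<bar> \<le> 1/2 * (y - x)" if "x \<le> y" for x y
    using integral_bound[OF that continuous_on_subset[OF w(1) subset_UNIV], of "1/2"] w(3) by simp
  have cs: "continuous_on S (\<lambda>x. w (x + r))" for S r
    by (intro continuous_on_compose2[OF w(1)] continuous_intros) auto
  have "integral {-L..L} (\<lambda>x. w (x + (-p)) - w (x + q))
      = integral {-L..L} (\<lambda>x. w (x + (-p))) - integral {-L..L} (\<lambda>x. w (x + q))"
    by (intro Henstock_Kurzweil_Integration.integral_diff integrable_continuous_real cs)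
  also have "\<dots> = integral {-L - p..L - p} w - integral {-L + q..L + q} w"
    using integral_shift_Icc_real[of "-L" L w "-p"] integral_shift_Icc_real[of "-L" L w q]
    by (simp add: o_def add.commute)
  also have "\<dots> = (J (L - p) - J (-L - p)) - (J (L + q) - J (-L + q))"
    using assms(4-6) by (simp add: J A_def)
  \<comment> \<open>Regrouping values of the primitive avoids subtracting an overlap, which would be
    empty when p + q > 2 L.\<close>
  also have "\<dots> = (J (-L + q) - J (-L - p)) - (J (L + q) - J (L - p))" by simp
  also have "\<dots> = integral {-L - p..-L + q} w - integral {L - p..L + q} w"
    using assms(4-6) by (simp add: J A_def)
  also have "\<dots> \<le> p + q"
    using bd[of "-L - p" "-L + q"] bd[of "L - p" "L + q"] assms(4-6) by (simp add: abs_le_iff)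
  finally show ?thesis by simp
qed

section \<open>The relaxation system\<close>

lemma weak_balance_lincomb:
  assumes "admissible A1" "admissible F1" "admissible S1" "weak_balance A1 F1 S1"
    and "admissible A2" "admissible F2" "admissible S2" "weak_balance A2 F2 S2"
  shows "weak_balance (\<lambda>t x. A1 t x + a * A2 t x) (\<lambda>t x. F1 t x + a * F2 t x) (\<lambda>t x. S1 t x + a * S2 t x)"
  unfolding weak_balance_def
proof (intro allI impI)
  fix \<phi> \<phi>t \<phi>x assume *: "test_fun \<phi> \<phi>t \<phi>x \<and> (\<forall>t x. 0 \<le> \<phi> t x)"
  then have test: "test_fun \<phi> \<phi>t \<phi>x" by blast
  let ?G = "\<lambda>A F S p. A (fst p) (snd p) * \<phi>t (fst p) (snd p) + F (fst p) (snd p) * \<phi>x (fst p) (snd p)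
        + S (fst p) (snd p) * \<phi> (fst p) (snd p)"
  have i: "integrable lborel (?G A F S)" if "admissible A" "admissible F" "admissible S" for A F S
    by (intro Bochner_Integration.integrable_add admissible_test_integrable test_fun_supported[OF test] that)
  have z: "integral\<^sup>L lborel (?G A1 F1 S1) = 0" "integral\<^sup>L lborel (?G A2 F2 S2) = 0"
    using assms(4,8) * unfolding weak_balance_def by blast+
  have eq: "?G (\<lambda>t x. A1 t x + a * A2 t x) (\<lambda>t x. F1 t x + a * F2 t x) (\<lambda>t x. S1 t x + a * S2 t x) p
      = ?G A1 F1 S1 p + a * ?G A2 F2 S2 p" for p
    by (simp add: algebra_simps)
  have "integral\<^sup>L lborel (\<lambda>p. ?G A1 F1 S1 p + a * ?G A2 F2 S2 p)
      = integral\<^sup>L lborel (?G A1 F1 S1) + integral\<^sup>L lborel (\<lambda>p. a * ?G A2 F2 S2 p)"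
    by (rule Bochner_Integration.integral_add[OF i integrable_mult_right[OF i]]) (use assms in auto)
  then show "integral\<^sup>L lborel (?G (\<lambda>t x. A1 t x + a * A2 t x) (\<lambda>t x. F1 t x + a * F2 t x) (\<lambda>t x. S1 t x + a * S2 t x)) = 0"
    unfolding eq using z by (simp only: integral_mult_right_zero)
qed

context mollifier
begin

text \<open>All values in the window [x - d, x] lie between those at its ends. This is the device
  for passing between a monotone function and its mollification at the price of a shift by
  d.\<close>

lemma conv_antimono_between:
  assumes "bdd_borel f" "antimono f"
  shows "f x \<le> conv k f x" "conv k f x \<le> f (x - d)"
  by (rule conv_ge conv_le; use assms in \<open>auto intro: antimonoD\<close>)+

lemma conv_abs_le:
  assumes "bdd_borel f" "bdd_borel g" "\<And>y. \<bar>f y\<bar> \<le> g y"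
  shows "\<bar>conv k f x\<bar> \<le> conv k g x"
proof -
  have "conv k f x \<le> conv k g x" by (rule conv_mono) (use assms in \<open>auto simp: abs_le_iff\<close>)
  moreover have "conv k (\<lambda>y. -1 * f y) x \<le> conv k g x"
    by (rule conv_mono) (use assms bdd_borel_cmult[of f "-1"] in \<open>auto simp: abs_le_iff\<close>)
  ultimately show ?thesis unfolding conv_cmult by (simp add: abs_le_iff)
qed

lemma conv_bound:
  assumes "bdd_borel f" "\<And>x. \<bar>f x\<bar> \<le> 1/2"
  shows "\<bar>conv k f x\<bar> \<le> 1/2"
  using conv_abs_le[OF assms(1) bdd_borel_const[of "1/2"] assms(2)] by (simp add: conv_const)

lemma conv_continuous: "bdd_borel f \<Longrightarrow> continuous_on S (conv k f)"
  by (rule DERIV_continuous_on[OF has_field_derivative_at_within[OF conv_has_derivative]])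

lemma conv_oscillation_integral:
  assumes "bdd_borel f" "antimono f" "\<And>x. \<bar>f x\<bar> \<le> 1/2" "0 \<le> p" "0 \<le> q" "0 \<le> L"
  shows "integral {-L..L} (\<lambda>x. conv k f (x - p) - conv k f (x + q)) \<le> p + q"
  using assms by (intro antimono_oscillation_integral conv_continuous conv_antimono conv_bound)

end

text \<open>\<open>well_prepared\<close> is the initial condition \<sigma>0 = a[\<rho>0] \<rho>0 in
  cumulative form. \<open>anti\<close> and \<open>bound\<close> express that u(t) is 1/2 minus the
  distribution function of a probability measure.\<close>

locale relaxation = mollifier +
  fixes c \<epsilon> :: real and u v :: "real \<Rightarrow> real \<Rightarrow> real"
  assumes c: "1/2 < c" and eps: "0 < \<epsilon>"
    and adm_u: "admissible u" and adm_v: "admissible v"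
    and wb1: "weak_balance u v (\<lambda>t x. 0)"
    and wb2: "weak_balance v (\<lambda>t x. c\<^sup>2 * u t x) (\<lambda>t x. 1/\<epsilon> * (1/2 * (u t x * u t x) - v t x))"
    and anti: "\<And>t. 0 \<le> t \<Longrightarrow> antimono (u t)"
    and bound: "\<And>t x. 0 \<le> t \<Longrightarrow> \<bar>u t x\<bar> \<le> 1/2"
    and well_prepared: "\<And>x. v 0 x = 1/2 * (u 0 x * u 0 x)"
begin

text \<open>Equilibrium value of the Riemann invariant v + \<gamma> u, with \<open>v\<close>
  replaced by u^2/2; \<gamma> will be c or -c.\<close>

definition eq_flux :: "real \<Rightarrow> real \<Rightarrow> real \<Rightarrow> real" where
  "eq_flux \<gamma> t y = 1/2 * (u t y * u t y) + \<gamma> * u t y"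

lemma adm_flux: "admissible (eq_flux \<gamma>)"
  unfolding eq_flux_def[abs_def] by (intro admissible_add admissible_cmult admissible_mult adm_u)

lemma bdd_u: "0 \<le> t \<Longrightarrow> bdd_borel (u t)" and bdd_v: "0 \<le> t \<Longrightarrow> bdd_borel (v t)"
  and bdd_flux: "0 \<le> t \<Longrightarrow> bdd_borel (eq_flux \<gamma> t)"
  by (simp_all add: admissible_bdd_borel adm_u adm_v adm_flux)

text \<open>Duhamel formula. For \<gamma>^2 = c^2 the flux of A = v + \<gamma> u is \<gamma> A, so
  the term with \<open>k'\<close> drops out along the line of speed \<gamma>; the rate \<kappa> =
  1/\<epsilon> absorbs the damping and leaves the equilibrium value as the only source.\<close>

lemma wave_formula:
  assumes \<gamma>: "\<gamma>\<^sup>2 = c\<^sup>2" and t: "0 \<le> t"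
  shows "exp (t/\<epsilon>) * conv k (\<lambda>y. v t y + \<gamma> * u t y) (x + \<gamma> * t) = conv k (eq_flux \<gamma> 0) x
    + integral {0..t} (\<lambda>s. exp (s/\<epsilon>) / \<epsilon> * conv k (eq_flux \<gamma> s) (x + \<gamma> * s))"
proof -
  let ?A = "\<lambda>t y. v t y + \<gamma> * u t y"
  let ?F = "\<lambda>t y. c\<^sup>2 * u t y + \<gamma> * v t y"
  let ?S = "\<lambda>t x. 1/\<epsilon> * (1/2 * (u t x * u t x) - v t x) + \<gamma> * 0"
  have adm: "admissible ?A" "admissible ?F" "admissible ?S"
    by (intro admissible_add admissible_diff admissible_cmult admissible_mult admissible_const adm_u adm_v)+
  have wb: "weak_balance ?A ?F ?S"
    by (intro weak_balance_lincomb wb1 wb2 admissible_diff admissible_cmult admissible_mult admissible_const adm_u adm_v)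
  have "(\<lambda>y. ?F s y - \<gamma> * ?A s y) = (\<lambda>y. 0)" for s
    using \<gamma> by (simp add: algebra_simps power2_eq_square fun_eq_iff)
  moreover have "(\<lambda>y. ?S s y + 1/\<epsilon> * ?A s y) = (\<lambda>y. 1/\<epsilon> * eq_flux \<gamma> s y)" for s
    by (simp add: algebra_simps eq_flux_def fun_eq_iff)
  moreover have "?A 0 = eq_flux \<gamma> 0" using well_prepared by (simp add: eq_flux_def fun_eq_iff)
  ultimately show ?thesis
    using weak_balance_mollified[OF adm wb t, of "1/\<epsilon>" x \<gamma>]
    by (simp only: conv_cmult) (simp add: conv_def)
qed

text \<open>Both Riemann invariants \<open>v \<plusminus> c u\<close> inherit the monotonicity of \<open>u\<close> because of the
  subcharacteristic condition \<open>\<bar>u\<bar> \<le> 1/2 < c\<close>; the factor \<open>\<gamma>\<close> treats both signs at once.\<close>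

lemma flux_antimono:
  assumes \<gamma>: "\<gamma>\<^sup>2 = c\<^sup>2" and t: "0 \<le> t"
  shows "antimono (\<lambda>y. \<gamma> * eq_flux \<gamma> t y)"
proof (rule antimonoI)
  fix x y :: real assume "x \<le> y"
  then have le: "u t y \<le> u t x" using anti[OF t] by (auto dest: antimonoD)
  have ac: "\<bar>\<gamma>\<bar> = c" using \<gamma> c by (metis abs_of_pos less_trans half_gt_zero power2_abs power2_eq_iff_nonneg abs_ge_zero less_eq_real_def zero_less_one)
  \<comment> \<open>A difference of equilibrium values, multiplied by \<gamma>, factors into the
    difference of \<open>u\<close> and \<gamma> times the mean plus c^2. The latter is nonnegative
    since |\<gamma> mean| <= c/2 <= c^2, which is where the subcharacteristic condition
    enters.\<close>
  have "\<bar>\<gamma> * ((u t x + u t y) / 2)\<bar> \<le> c * (1/2)"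
    unfolding abs_mult ac using c bound[OF t, of x] bound[OF t, of y] by (intro mult_left_mono) (auto simp: abs_le_iff)
  also have "\<dots> \<le> c\<^sup>2" using c by (simp add: power2_eq_square)
  finally have "0 \<le> (u t x - u t y) * (\<gamma> * ((u t x + u t y) / 2) + c\<^sup>2)"
    using le by (intro mult_nonneg_nonneg) (auto simp: abs_le_iff)
  also have "\<dots> = \<gamma> * eq_flux \<gamma> t x - \<gamma> * eq_flux \<gamma> t y"
    unfolding \<gamma>[symmetric] by (simp add: eq_flux_def field_simps power2_eq_square)
  finally show "\<gamma> * eq_flux \<gamma> t y \<le> \<gamma> * eq_flux \<gamma> t x" by simp
qed

text \<open>The Duhamel formula represents the invariant as a combination, with positive weights, of
  translated equilibrium values, each of which is monotone.\<close>

lemma wave_antimono: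
  assumes \<gamma>: "\<gamma>\<^sup>2 = c\<^sup>2" and t: "0 \<le> t"
  shows "antimono (conv k (\<lambda>y. \<gamma> * (v t y + \<gamma> * u t y)))"
proof (rule antimonoI)
  fix x y :: real assume "x \<le> y"
  have fl: "\<gamma> * conv k (eq_flux \<gamma> s) y' \<le> \<gamma> * conv k (eq_flux \<gamma> s) x'" if "0 \<le> s" "x' \<le> y'" for s x' y'
    using antimonoD[OF conv_antimono[OF bdd_borel_cmult[OF bdd_flux[OF that(1)]] flux_antimono[OF \<gamma> that(1)]] that(2)]
    by (simp add: conv_cmult)
  define J where "J x = integral {0..t} (\<lambda>s. exp (s/\<epsilon>) / \<epsilon> * (\<gamma> * conv k (eq_flux \<gamma> s) (x - \<gamma> * t + \<gamma> * s)))" for x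
  have J: "exp (t/\<epsilon>) * (\<gamma> * conv k (\<lambda>y. v t y + \<gamma> * u t y) x) = \<gamma> * conv k (eq_flux \<gamma> 0) (x - \<gamma> * t) + J x" for x
  proof -
    have "J x = \<gamma> * integral {0..t} (\<lambda>s. exp (s/\<epsilon>) / \<epsilon> * conv k (eq_flux \<gamma> s) (x - \<gamma> * t + \<gamma> * s))"
      unfolding J_def by (simp add: mult.left_commute flip: Henstock_Kurzweil_Integration.integral_mult_right)
    then show ?thesis using wave_formula[OF \<gamma> t, of "x - \<gamma> * t"] by (simp add: mult.left_commute[of _ \<gamma>] distrib_left)
  qed
  have "J y \<le> J x"
    unfolding J_def
  proof (rule integral_le)
    have i: "(\<lambda>s. exp (s/\<epsilon>) / \<epsilon> * (\<gamma> * conv k (eq_flux \<gamma> s) (x - \<gamma> * t + \<gamma> * s))) integrable_on {0..t}" for x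
      using eps by (intro integrable_continuous_real continuous_intros conv_continuous_on[OF adm_flux kernel]) auto
    show "(\<lambda>s. exp (s/\<epsilon>) / \<epsilon> * (\<gamma> * conv k (eq_flux \<gamma> s) (y - \<gamma> * t + \<gamma> * s))) integrable_on {0..t}"
      "(\<lambda>s. exp (s/\<epsilon>) / \<epsilon> * (\<gamma> * conv k (eq_flux \<gamma> s) (x - \<gamma> * t + \<gamma> * s))) integrable_on {0..t}"
      by (rule i)+
    show "exp (s/\<epsilon>) / \<epsilon> * (\<gamma> * conv k (eq_flux \<gamma> s) (y - \<gamma> * t + \<gamma> * s))
        \<le> exp (s/\<epsilon>) / \<epsilon> * (\<gamma> * conv k (eq_flux \<gamma> s) (x - \<gamma> * t + \<gamma> * s))" if "s \<in> {0..t}" for s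
      using that \<open>x \<le> y\<close> eps by (intro mult_left_mono fl) auto
  qed
  then have "exp (t/\<epsilon>) * (\<gamma> * conv k (\<lambda>y. v t y + \<gamma> * u t y) y) \<le> exp (t/\<epsilon>) * (\<gamma> * conv k (\<lambda>y. v t y + \<gamma> * u t y) x)"
    unfolding J using fl[of 0 "x - \<gamma> * t" "y - \<gamma> * t"] \<open>x \<le> y\<close> by simp
  then show "conv k (\<lambda>y. \<gamma> * (v t y + \<gamma> * u t y)) y \<le> conv k (\<lambda>y. \<gamma> * (v t y + \<gamma> * u t y)) x"
    by (simp add: conv_cmult)
qed

text \<open>Along the line of speed -\<gamma> the derivative of \<open>u\<close> is -(v + \<gamma>
  u)_x, and after multiplication by \<gamma> its sign is known from \<open>wave_antimono\<close>.
  The choices c and -c give the upper and the lower bound.\<close>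

lemma finite_speed_conv:
  assumes \<gamma>: "\<gamma>\<^sup>2 = c\<^sup>2" and st: "0 \<le> s" "s \<le> t"
  shows "\<gamma> * conv k (u s) x \<le> \<gamma> * conv k (u t) (x - \<gamma> * (t - s))"
proof -
  define g where "g r = - conv k' (\<lambda>y. \<gamma> * (v r y + \<gamma> * u r y)) (x + \<gamma> * s - \<gamma> * r)" for r
  have adm: "admissible (\<lambda>t y. \<gamma> * (v t y + \<gamma> * u t y))"
    by (intro admissible_add admissible_cmult adm_u adm_v)
  define h where "h r = - conv k' (\<lambda>y. v r y + \<gamma> * u r y) (x + \<gamma> * s - \<gamma> * r)" for r
  have gh: "g = (\<lambda>r. \<gamma> * h r)" by (simp only: g_def h_def conv_cmult fun_eq_iff) simp
  have formula: "\<gamma> * conv k (u r) (x + \<gamma> * s - \<gamma> * r) = \<gamma> * conv k (u 0) (x + \<gamma> * s) + integral {0..r} g"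
    if "0 \<le> r" for r
  proof -
    have "conv k (u r) (x + \<gamma> * s - \<gamma> * r) = conv k (u 0) (x + \<gamma> * s) + integral {0..r} h"
      using weak_balance_mollified[OF adm_u adm_v admissible_const wb1 that, of 0 "x + \<gamma> * s" "-\<gamma>"]
      by (simp add: h_def[abs_def] conv_def[of k "\<lambda>y. 0"])
    then show ?thesis by (simp add: gh distrib_left)
  qed
  have g0: "0 \<le> g r" if "0 \<le> r" for r
    using conv_deriv_nonpos[OF admissible_bdd_borel[OF adm that] wave_antimono[OF \<gamma> that]] by (simp add: g_def)
  have "continuous_on {0..t} g" unfolding g_def
    by (intro continuous_intros conv_continuous_on[OF adm kernel']) auto
  then have "integral {0..s} g \<le> integral {0..t} g"
    using st g0 by (intro integral_subset_le integrable_continuous_real) (auto intro: continuous_on_subset)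
  then show ?thesis using formula[of s] formula[of t] st by (simp add: algebra_simps)
qed

text \<open>Undoing the mollification at both times costs one kernel width, hence the additional
  \<open>d\<close> in the cone.\<close>

lemma finite_speed:
  assumes st: "0 \<le> s" "s \<le> t"
  shows "u t y \<le> u s (y - c * (t - s) - d)" "u s (y + c * (t - s) + d) \<le> u t y"
proof -
  have t: "0 \<le> t" using st by simp
  have c0: "0 < c" using c by simp
  note bt = conv_antimono_between[OF bdd_u[OF t] anti[OF t]]
    and bs = conv_antimono_between[OF bdd_u[OF st(1)] anti[OF st(1)]]
  have "conv k (u t) y \<le> conv k (u s) (y - c * (t - s))"
    using finite_speed_conv[of "-c", OF _ st, of "y - c * (t - s)"] c0 by simp
  then show "u t y \<le> u s (y - c * (t - s) - d)" using bt(1)[of y] bs(2)[of "y - c * (t - s)"] by simp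
  have "conv k (u s) (y + c * (t - s) + d) \<le> conv k (u t) (y + d)"
    using finite_speed_conv[of c, OF _ st, of "y + c * (t - s) + d"] c0 by (simp add: algebra_simps)
  then show "u s (y + c * (t - s) + d) \<le> u t y" using bt(2)[of "y + d"] bs(1)[of "y + c * (t - s) + d"] by simp
qed

text \<open>The square is taken before mollifying, so that adding and subtracting c u turns this
  into mollified invariant minus mollified equilibrium value.\<close>

definition defect :: "real \<Rightarrow> real \<Rightarrow> real" where
  "defect t x = conv k (v t) x - conv k (\<lambda>y. 1/2 * (u t y * u t y)) x"

text \<open>Oscillation of u(s) across the base of the backward cone of (t, x), widened by the
  kernel width.\<close>

definition osc :: "real \<Rightarrow> real \<Rightarrow> real \<Rightarrow> real" where
  "osc t s x = conv k (u s) (x - (c * (t - s) + d)) - conv k (u s) (x + (c * (t - s) + d))"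

text \<open>On |u| <= 1/2 the map u^2/2 + c u has Lipschitz constant c + 1/2, and by finite speed
  both arguments lie between the values of u(s) at the two ends of the widened cone.\<close>

lemma flux_difference_bound:
  assumes st: "0 \<le> s" "s \<le> t"
  shows "\<bar>conv k (eq_flux c s) (x - c * (t - s)) - conv k (eq_flux c t) x\<bar> \<le> (c + 1/2) * osc t s x"
proof -
  have t: "0 \<le> t" using st by simp
  define r where "r = c * (t - s)"
  have r: "0 \<le> r" using st c by (simp add: r_def)
  have aux: "\<bar>(a + b) / 2 + c\<bar> \<le> c + 1/2" if "\<bar>a\<bar> \<le> 1/2" "\<bar>b\<bar> \<le> 1/2" for a b :: real
    using that c by (auto simp: abs_le_iff field_simps)
  have pw: "\<bar>eq_flux c s (y + (-r)) - eq_flux c t y\<bar> \<le> (c + 1/2) * (u s (y + (-(r + d))) - u s (y + (r + d)))" for y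
  proof -
    have 1: "u s (y + (r + d)) \<le> u t y" "u t y \<le> u s (y + (-(r + d)))"
      using finite_speed[OF st, of y] by (simp_all add: r_def algebra_simps)
    have 2: "u s (y + (r + d)) \<le> u s (y + (-r))" "u s (y + (-r)) \<le> u s (y + (-(r + d)))"
      using antimonoD[OF anti[OF st(1)]] r d_pos by auto
    have eq: "eq_flux c s (y + (-r)) - eq_flux c t y
       = (u s (y + (-r)) - u t y) * ((u s (y + (-r)) + u t y) / 2 + c)"
      by (simp add: eq_flux_def field_simps)
    have "\<bar>eq_flux c s (y + (-r)) - eq_flux c t y\<bar>
       = \<bar>u s (y + (-r)) - u t y\<bar> * \<bar>(u s (y + (-r)) + u t y) / 2 + c\<bar>"
      unfolding eq abs_mult ..
    also have "\<dots> \<le> (u s (y + (-(r + d))) - u s (y + (r + d))) * (c + 1/2)"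
    proof (rule mult_mono)
      show "\<bar>u s (y + (-r)) - u t y\<bar> \<le> u s (y + (-(r + d))) - u s (y + (r + d))"
        using 1 2 by (intro abs_leI) linarith+
      show "\<bar>(u s (y + (-r)) + u t y) / 2 + c\<bar> \<le> c + 1/2"
        by (rule aux[OF bound[OF st(1)] bound[OF t]])
    qed (use 1 2 in auto)
    finally show ?thesis by (simp add: mult.commute)
  qed
  have b: "bdd_borel (\<lambda>y. eq_flux c s (y + (-r)))" "bdd_borel (\<lambda>y. u s (y + (-(r + d))))" "bdd_borel (\<lambda>y. u s (y + (r + d)))"
    by (intro bdd_borel_shift bdd_flux bdd_u st(1))+
  have "\<bar>conv k (\<lambda>y. eq_flux c s (y + (-r)) - eq_flux c t y) x\<bar>
     \<le> conv k (\<lambda>y. (c + 1/2) * (u s (y + (-(r + d))) - u s (y + (r + d)))) x"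
    by (intro conv_abs_le pw bdd_borel_diff bdd_borel_cmult b bdd_flux t)
  then have "\<bar>conv k (eq_flux c s) (x + (-r)) - conv k (eq_flux c t) x\<bar>
     \<le> (c + 1/2) * (conv k (u s) (x + (-(r + d))) - conv k (u s) (x + (r + d)))"
    by (simp only: conv_cmult conv_diff[OF b(1) bdd_flux[OF t] kernel] conv_diff[OF b(2,3) kernel]
        conv_shift[of k "eq_flux c s" "-r"] conv_shift[of k "u s" "-(r+d)"] conv_shift[of k "u s" "r+d"])
  then show ?thesis unfolding osc_def r_def by (simp only: diff_conv_add_uminus)
qed

text \<open>The weights of the Duhamel formula, 1 at time 0 and exp(s/\<epsilon>)/\<epsilon> on
  [0, t], add up to exp(t/\<epsilon>). The current equilibrium value can therefore be subtracted
  inside, and the defect becomes a weighted average of flux differences along the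
  characteristic.\<close>

lemma defect_pointwise:
  assumes t: "0 \<le> t"
  shows "exp (t/\<epsilon>) * \<bar>defect t x\<bar> \<le> (c + 1/2) * osc t 0 x
    + integral {0..t} (\<lambda>s. exp (s/\<epsilon>) / \<epsilon> * ((c + 1/2) * osc t s x))"
proof -
  define D where "D s = conv k (eq_flux c s) (x - c * (t - s)) - conv k (eq_flux c t) x" for s
  have cD: "continuous_on {0..t} (\<lambda>s. exp (s/\<epsilon>) / \<epsilon> * D s)" unfolding D_def
    using eps t by (intro continuous_intros conv_continuous_on[OF adm_flux kernel]) auto
  have cs: "continuous_on {0..t} (\<lambda>s. exp (s/\<epsilon>) / \<epsilon> * conv k (eq_flux c s) (x - c * (t - s)))"
    using eps by (intro continuous_intros conv_continuous_on[OF adm_flux kernel]) auto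
  have ce: "continuous_on {0..t} (\<lambda>s. exp (s/\<epsilon>) / \<epsilon> * conv k (eq_flux c t) x)"
    using eps by (intro continuous_intros) auto
  have co: "continuous_on {0..t} (\<lambda>s. exp (s/\<epsilon>) / \<epsilon> * ((c + 1/2) * osc t s x))" unfolding osc_def
    using eps by (intro continuous_intros conv_continuous_on[OF adm_u kernel]) auto
  have ftc: "((\<lambda>s. exp (s/\<epsilon>) / \<epsilon>) has_integral (exp (t/\<epsilon>) - exp (0/\<epsilon>))) {0..t}"
    using t eps
    by (intro fundamental_theorem_of_calculus)
       (auto simp flip: has_real_derivative_iff_has_vector_derivative intro!: derivative_eq_intros)
  have e: "integral {0..t} (\<lambda>s. exp (s/\<epsilon>) / \<epsilon> * conv k (eq_flux c t) x) = (exp (t/\<epsilon>) - 1) * conv k (eq_flux c t) x"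
    using integral_unique[OF has_integral_mult_left[OF ftc]] by simp
  have "defect t x = conv k (\<lambda>y. v t y + c * u t y) x - conv k (eq_flux c t) x"
    unfolding defect_def eq_flux_def[abs_def]
    using bdd_u[OF t] bdd_v[OF t] by (simp only: conv_add[OF _ _ kernel] bdd_borel_cmult bdd_borel_mult)
  then have "exp (t/\<epsilon>) * defect t x = exp (t/\<epsilon>) * conv k (\<lambda>y. v t y + c * u t y) x - exp (t/\<epsilon>) * conv k (eq_flux c t) x"
    by (simp add: right_diff_distrib)
  also have "exp (t/\<epsilon>) * conv k (\<lambda>y. v t y + c * u t y) x = conv k (eq_flux c 0) (x - c * t)
       + integral {0..t} (\<lambda>s. exp (s/\<epsilon>) / \<epsilon> * conv k (eq_flux c s) (x - c * (t - s)))"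
    using wave_formula[OF refl t, of "x - c * t"] by (simp add: algebra_simps)
  also have "\<dots> - exp (t/\<epsilon>) * conv k (eq_flux c t) x = D 0 +
      (integral {0..t} (\<lambda>s. exp (s/\<epsilon>) / \<epsilon> * conv k (eq_flux c s) (x - c * (t - s)))
        - integral {0..t} (\<lambda>s. exp (s/\<epsilon>) / \<epsilon> * conv k (eq_flux c t) x))"
    unfolding e by (simp add: D_def algebra_simps)
  also have "integral {0..t} (\<lambda>s. exp (s/\<epsilon>) / \<epsilon> * conv k (eq_flux c s) (x - c * (t - s)))
        - integral {0..t} (\<lambda>s. exp (s/\<epsilon>) / \<epsilon> * conv k (eq_flux c t) x)
      = integral {0..t} (\<lambda>s. exp (s/\<epsilon>) / \<epsilon> * D s)"
    using Henstock_Kurzweil_Integration.integral_diff[OF integrable_continuous_real[OF cs] integrable_continuous_real[OF ce]]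
    by (simp add: D_def right_diff_distrib)
  finally have eq: "exp (t/\<epsilon>) * defect t x = D 0 + integral {0..t} (\<lambda>s. exp (s/\<epsilon>) / \<epsilon> * D s)" .
  have Dle: "\<bar>D s\<bar> \<le> (c + 1/2) * osc t s x" if "s \<in> {0..t}" for s
    unfolding D_def using flux_difference_bound[of s t x] that by simp
  have int: "\<bar>integral {0..t} (\<lambda>s. exp (s/\<epsilon>) / \<epsilon> * D s)\<bar> \<le> integral {0..t} (\<lambda>s. exp (s/\<epsilon>) / \<epsilon> * ((c + 1/2) * osc t s x))"
    unfolding real_norm_def[symmetric]
  proof (rule integral_norm_bound_integral)
    fix s assume s: "s \<in> {0..t}"
    show "norm (exp (s/\<epsilon>) / \<epsilon> * D s) \<le> exp (s/\<epsilon>) / \<epsilon> * ((c + 1/2) * osc t s x)"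
      unfolding real_norm_def abs_mult using eps Dle[OF s] by (intro mult_mono) auto
  qed (intro integrable_continuous_real cD co)+
  have "exp (t/\<epsilon>) * \<bar>defect t x\<bar> = \<bar>exp (t/\<epsilon>) * defect t x\<bar>" by (simp add: abs_mult)
  then show ?thesis unfolding eq
    using order_trans[OF abs_triangle_ineq add_mono[OF Dle[of 0] int]] t by simp
qed

lemma osc_integral:
  assumes "0 \<le> s" "s \<le> t" "0 \<le> L"
  shows "integral {-L..L} (osc t s) \<le> 2 * (c * (t - s) + d)"
proof -
  have "0 \<le> c * (t - s) + d" using assms c d_pos by simp
  then show ?thesis
    using conv_oscillation_integral[OF bdd_u anti bound, OF assms(1) assms(1) assms(1), of "c * (t - s) + d" "c * (t - s) + d" L] assms
    by (simp add: osc_def[abs_def])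
qed

text \<open>After exchanging the integrals, the oscillation at time s contributes at most twice c (t
  - s) + d. Averaging t - s against the exponential weight gives at most \<epsilon>, so the bound is
  uniform in t.\<close>

lemma defect_integral:
  assumes t: "0 \<le> t" and L: "0 \<le> L"
  shows "integral {-L..L} (\<lambda>x. \<bar>defect t x\<bar>) \<le> 2 * (c + 1/2) * (c * \<epsilon> + d)"
proof -
  let ?l = "c + 1/2"
  let ?W = "\<lambda>s x. exp (s/\<epsilon>) / \<epsilon> * (?l * osc t s x)"
  have cW: "continuous_on ({0..t} \<times> UNIV) (\<lambda>p. ?W (fst p) (snd p))"
    unfolding osc_def using eps by (intro continuous_intros conv_continuous_on[OF adm_u kernel]) auto
  have cosc: "continuous_on S (osc t s)" if "0 \<le> s" for S s
    unfolding osc_def[abs_def]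
    by (intro continuous_intros continuous_on_compose2[OF conv_continuous[OF bdd_u[OF that], of UNIV]]) auto
  have cW1: "continuous_on {0..t} (\<lambda>s. integral {-L..L} (?W s))"
    unfolding box_real[symmetric]
    by (rule integral_continuous_on_param)
       (use continuous_on_subset[OF cW, of "cbox 0 t \<times> cbox (-L) L"] in \<open>simp add: case_prod_beta' subset_iff\<close>)
  have cW2: "continuous_on {-L..L} (\<lambda>x. integral {0..t} (\<lambda>s. ?W s x))"
    unfolding box_real[symmetric]
  proof (rule integral_continuous_on_param)
    have "continuous_on (cbox (-L) L \<times> cbox 0 t) (\<lambda>p. (\<lambda>p. ?W (fst p) (snd p)) (snd p, fst p))"
      by (rule continuous_on_compose2[OF cW]) (auto intro!: continuous_intros)
    then show "continuous_on (cbox (-L) L \<times> cbox 0 t) (\<lambda>(x, s). ?W s x)" by (simp add: case_prod_beta')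
  qed
  have cdef: "continuous_on S (defect t)" for S
    unfolding defect_def[abs_def]
    by (intro continuous_intros conv_continuous bdd_v bdd_borel_cmult bdd_borel_mult bdd_u t)
  have "exp (t/\<epsilon>) * integral {-L..L} (\<lambda>x. \<bar>defect t x\<bar>) = integral {-L..L} (\<lambda>x. exp (t/\<epsilon>) * \<bar>defect t x\<bar>)"
    by simp
  also have "\<dots> \<le> integral {-L..L} (\<lambda>x. ?l * osc t 0 x + integral {0..t} (\<lambda>s. ?W s x))"
    using defect_pointwise[OF t]
    by (intro integral_le integrable_continuous_real continuous_intros cosc cW2 cdef) auto
  also have "\<dots> = integral {-L..L} (\<lambda>x. ?l * osc t 0 x) + integral {-L..L} (\<lambda>x. integral {0..t} (\<lambda>s. ?W s x))"
    by (intro Henstock_Kurzweil_Integration.integral_add integrable_continuous_real continuous_intros cosc cW2) auto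
  also have "integral {-L..L} (\<lambda>x. integral {0..t} (\<lambda>s. ?W s x)) = integral {0..t} (\<lambda>s. integral {-L..L} (?W s))"
  proof -
    have "continuous_on (cbox (0, -L) (t, L)) (\<lambda>(s, x). ?W s x)"
      unfolding case_prod_beta' by (rule continuous_on_subset[OF cW]) (auto simp: cbox_Pair_eq)
    from integral_swap_continuous[OF this] show ?thesis unfolding box_real by (rule sym)
  qed
  also have "integral {-L..L} (\<lambda>x. ?l * osc t 0 x) + integral {0..t} (\<lambda>s. integral {-L..L} (?W s))
     \<le> ?l * (2 * (c * t + d)) + integral {0..t} (\<lambda>s. ?l * 2 * (exp (s/\<epsilon>) / \<epsilon> * (c * (t - s) + d)))"
  proof (rule add_mono)
    show "integral {-L..L} (\<lambda>x. ?l * osc t 0 x) \<le> ?l * (2 * (c * t + d))"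
      using osc_integral[of 0 t L] t L c by simp
    show "integral {0..t} (\<lambda>s. integral {-L..L} (?W s)) \<le> integral {0..t} (\<lambda>s. ?l * 2 * (exp (s/\<epsilon>) / \<epsilon> * (c * (t - s) + d)))"
    proof (rule integral_le)
      fix s assume s: "s \<in> {0..t}"
      have "integral {-L..L} (?W s) = (exp (s/\<epsilon>) / \<epsilon> * ?l) * integral {-L..L} (osc t s)" by (simp add: mult.assoc)
      also have "\<dots> \<le> (exp (s/\<epsilon>) / \<epsilon> * ?l) * (2 * (c * (t - s) + d))"
        using osc_integral[of s t L] s L c eps by (intro mult_left_mono) auto
      also have "\<dots> = ?l * 2 * (exp (s/\<epsilon>) / \<epsilon> * (c * (t - s) + d))" by (simp only: mult_ac)
      finally show "integral {-L..L} (?W s) \<le> ?l * 2 * (exp (s/\<epsilon>) / \<epsilon> * (c * (t - s) + d))" .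
    qed (use eps in \<open>intro integrable_continuous_real continuous_intros cW1; simp\<close>)+
  qed
  also have "integral {0..t} (\<lambda>s. ?l * 2 * (exp (s/\<epsilon>) / \<epsilon> * (c * (t - s) + d)))
      = ?l * 2 * (exp (t/\<epsilon>) * (c * \<epsilon> + d) - (c * (t + \<epsilon>) + d))"
  proof -
    \<comment> \<open>The primitive is exp(s/\<epsilon>) (c (t - s + \<epsilon>) + d); the
      additional \<epsilon> compensates for the derivative of the linear factor.\<close>
    have "((\<lambda>s. exp (s/\<epsilon>) / \<epsilon> * (c * (t - s) + d)) has_integral
        (exp (t/\<epsilon>) * (c * (t - t + \<epsilon>) + d) - exp (0/\<epsilon>) * (c * (t - 0 + \<epsilon>) + d))) {0..t}"
      using t eps
      by (intro fundamental_theorem_of_calculus)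
         (auto simp flip: has_real_derivative_iff_has_vector_derivative intro!: derivative_eq_intros simp: field_simps)
    from integral_unique[OF this] show ?thesis
      unfolding Henstock_Kurzweil_Integration.integral_mult_right by simp
  qed
  \<comment> \<open>The contribution of time 0 cancels against the lower limit of the primitive, up
    to a negative term.\<close>
  also have "?l * (2 * (c * t + d)) + ?l * 2 * (exp (t/\<epsilon>) * (c * \<epsilon> + d) - (c * (t + \<epsilon>) + d))
      = exp (t/\<epsilon>) * (2 * ?l * (c * \<epsilon> + d)) - 2 * ?l * (c * \<epsilon>)"
    by (simp add: algebra_simps)
  also have "\<dots> \<le> exp (t/\<epsilon>) * (2 * ?l * (c * \<epsilon> + d))"
    using c eps by simp
  finally show ?thesis by simp
qed

end

section \<open>Comparison with the entropy solution\<close>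

context relaxation
begin

context
  fixes w :: "real \<Rightarrow> real \<Rightarrow> real" and T :: real
  assumes adm_w: "admissible w"
    and wbw: "weak_balance w (\<lambda>t x. 1/2 * (w t x * w t x)) (\<lambda>t x. 0)"
    and anti_w: "\<And>t. 0 \<le> t \<Longrightarrow> antimono (w t)"
    and bound_w: "\<And>t x. 0 \<le> t \<Longrightarrow> \<bar>w t x\<bar> \<le> 1/2"
    and init_w: "\<And>x. w 0 x = u 0 x"
    and T: "0 \<le> T"
begin

text \<open>Written with \<open>+ -1 *\<close> to match the shape produced by
  \<open>weak_balance_lincomb\<close>.\<close>

definition err :: "real \<Rightarrow> real \<Rightarrow> real" where
  "err t y = u t y + -1 * w t y"

definition flux_err :: "real \<Rightarrow> real \<Rightarrow> real" where
  "flux_err t y = v t y + -1 * (1/2 * (w t y * w t y))"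

text \<open>Velocity of the transport equation for the primitive, from (u^2 - w^2)/2 = avg *
  err.\<close>

definition avg :: "real \<Rightarrow> real \<Rightarrow> real" where
  "avg t y = 1/2 * (u t y + w t y)"

text \<open>The space primitive of the mollified error, obtained by integrating the flux in time.
  This avoids an integral from minus infinity and makes the initial value zero and the time
  derivative explicit.\<close>

definition prim_err :: "real \<Rightarrow> real \<Rightarrow> real" where
  "prim_err t x = - integral {0..t} (\<lambda>s. conv k (flux_err s) x)"

lemma adm_err: "admissible err" and adm_flux_err: "admissible flux_err" and adm_avg: "admissible avg"
  unfolding err_def[abs_def] flux_err_def[abs_def] avg_def[abs_def]
  by (intro admissible_add admissible_cmult admissible_mult adm_u adm_v adm_w)+

lemma bdd_w: "0 \<le> t \<Longrightarrow> bdd_borel (w t)" and bdd_err: "0 \<le> t \<Longrightarrow> bdd_borel (err t)"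
  and bdd_flux_err: "0 \<le> t \<Longrightarrow> bdd_borel (flux_err t)" and bdd_avg: "0 \<le> t \<Longrightarrow> bdd_borel (avg t)"
  by (simp_all add: admissible_bdd_borel adm_w adm_err adm_flux_err adm_avg)

lemma anti_avg: "0 \<le> t \<Longrightarrow> antimono (avg t)"
  using anti[of t] anti_w[of t] by (auto simp: antimono_def avg_def intro!: add_mono)

lemma bound_avg: "0 \<le> t \<Longrightarrow> \<bar>avg t y\<bar> \<le> 1/2" and bound_err: "0 \<le> t \<Longrightarrow> \<bar>err t y\<bar> \<le> 1"
  using bound[of t y] bound_w[of t y] by (auto simp: avg_def err_def abs_le_iff)

lemma conv_err: "0 \<le> t \<Longrightarrow> conv k (err t) x = conv k (u t) x - conv k (w t) x"
  unfolding err_def[abs_def] using conv_diff[OF bdd_u bdd_w kernel, of t t x] by simp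

text \<open>The mollified balance law along a vertical line; the initial term is absent because both
  solutions start from the same datum.\<close>

lemma conv_err_formula:
  assumes t: "0 \<le> t"
  shows "conv k (err t) x = - integral {0..t} (\<lambda>s. conv k' (flux_err s) x)"
proof -
  have "weak_balance err flux_err (\<lambda>t x. 0 + -1 * 0)"
    unfolding err_def[abs_def] flux_err_def[abs_def]
    by (intro weak_balance_lincomb wb1 wbw adm_u adm_v adm_w admissible_const admissible_cmult admissible_mult)
  moreover have "err 0 = (\<lambda>x. 0)" using init_w by (simp add: err_def fun_eq_iff)
  ultimately show ?thesis
    using weak_balance_mollified[OF adm_err adm_flux_err admissible_const _ t, of "0 + -1 * 0" 0 x 0]
    by (simp add: conv_def[of k "\<lambda>y. 0"])
qed

lemma prim_err_deriv_t:
  assumes "t \<in> {0..T}"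
  shows "((\<lambda>t. prim_err t x) has_real_derivative - conv k (flux_err t) x) (at t within {0..T})"
proof -
  have "continuous_on {0..T} (\<lambda>s. conv k (flux_err s) x)"
    by (intro conv_continuous_on[OF adm_flux_err kernel] continuous_intros) auto
  from integral_has_real_derivative[OF this assms] show ?thesis
    unfolding prim_err_def by (rule DERIV_minus)
qed

text \<open>Differentiating under the time integral turns \<open>k\<close> into \<open>k'\<close>,
  which produces the right-hand side of \<open>conv_err_formula\<close>.\<close>

lemma prim_err_deriv_x:
  assumes t: "0 \<le> t"
  shows "(prim_err t has_real_derivative conv k (err t) x) (at x)"
proof -
  have "((\<lambda>x. integral (cbox 0 t) (\<lambda>s. conv k (flux_err s) x)) has_real_derivative
      integral (cbox 0 t) (\<lambda>s. conv k' (flux_err s) x)) (at x within UNIV)"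
  proof (rule leibniz_rule_field_derivative)
    show "((\<lambda>x. conv k (flux_err s) x) has_real_derivative conv k' (flux_err s) x) (at x within UNIV)"
      if "s \<in> cbox 0 t" for s x
      using conv_has_derivative[OF bdd_flux_err, of s x] that by simp
    show "(\<lambda>s. conv k (flux_err s) x) integrable_on cbox 0 t" for x
      by (intro integrable_continuous conv_continuous_on[OF adm_flux_err kernel] continuous_intros) auto
    have "continuous_on (UNIV \<times> cbox 0 t) (\<lambda>p. conv k' (flux_err (snd p)) (fst p))"
      by (intro conv_continuous_on[OF adm_flux_err kernel'] continuous_intros) auto
    then show "continuous_on (UNIV \<times> cbox 0 t) (\<lambda>(x, s). conv k' (flux_err s) x)"
      by (simp add: case_prod_beta')
  qed auto
  from DERIV_minus[OF this] show ?thesis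
    unfolding prim_err_def[abs_def] conv_err_formula[OF t] by simp
qed

lemma prim_err_continuous: "continuous_on ({0..T} \<times> UNIV) (\<lambda>p. prim_err (fst p) (snd p))"
proof -
  obtain M where M: "0 \<le> M" "\<And>t x. 0 \<le> t \<Longrightarrow> \<bar>flux_err t x\<bar> \<le> M" using admissibleE[OF adm_flux_err] by blast
  have lt: "\<bar>prim_err t x - prim_err s x\<bar> \<le> M * \<bar>t - s\<bar>" if "t \<in> {0..T}" "s \<in> {0..T}" for t s x
  proof -
    have "norm (- conv k (flux_err r) x) \<le> M" if "r \<in> {0..T}" for r
      using conv_abs_le[of "flux_err r" "\<lambda>_. M" x] bdd_flux_err M(2) that by (simp add: conv_const)
    then show ?thesis
      using field_differentiable_bound[of "{0..T}" "\<lambda>t. prim_err t x" "\<lambda>t. - conv k (flux_err t) x" M s t]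
        prim_err_deriv_t that by (simp add: abs_minus_commute)
  qed
  have lx: "\<bar>prim_err t x - prim_err t y\<bar> \<le> 1 * \<bar>x - y\<bar>" if t: "0 \<le> t" for t x y
  proof -
    have "norm (conv k (err t) r) \<le> 1" for r
      using conv_abs_le[of "err t" "\<lambda>_. 1" r] bdd_err bound_err t by (simp add: conv_const)
    then show ?thesis
      using field_differentiable_bound[of UNIV "prim_err t" "\<lambda>x. conv k (err t) x" 1 y x]
        prim_err_deriv_x[OF t] by (simp add: abs_minus_commute)
  qed
  have "(M + 1)-lipschitz_on ({0..T} \<times> UNIV) (\<lambda>p. prim_err (fst p) (snd p))"
  proof (rule lipschitz_onI)
    fix p q assume p: "p \<in> {0..T} \<times> (UNIV :: real set)" and q: "q \<in> {0..T} \<times> (UNIV :: real set)"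
    have "\<bar>prim_err (fst p) (snd p) - prim_err (fst q) (snd q)\<bar>
       \<le> M * \<bar>fst p - fst q\<bar> + 1 * \<bar>snd p - snd q\<bar>"
      using lt[of "fst p" "fst q" "snd p"] lx[of "fst q" "snd p" "snd q"] p q by auto
    also have "\<dots> \<le> M * dist p q + 1 * dist p q"
      using M dist_fst_le[of p q] dist_snd_le[of p q] by (intro add_mono mult_left_mono) (auto simp: dist_real_def)
    finally show "dist (prim_err (fst p) (snd p)) (prim_err (fst q) (snd q)) \<le> (M + 1) * dist p q"
      by (simp add: dist_real_def distrib_right)
  qed (use M in simp)
  then show ?thesis by (rule lipschitz_on_continuous_on)
qed

text \<open>On the window [x - d, x] both \<open>avg\<close> and its mollified value at x lie
  between the mollified values at x + d and x - d, and |err| <= 1. Monotonicity takes the place of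
  regularity here.\<close>

lemma commutator_bound:
  assumes t: "0 \<le> t"
  shows "\<bar>conv k (\<lambda>y. avg t y * err t y) x - conv k (avg t) x * conv k (err t) x\<bar>
    \<le> conv k (avg t) (x - d) - conv k (avg t) (x + d)"
proof -
  let ?a = "conv k (avg t) x" and ?b = "conv k (avg t) (x - d) - conv k (avg t) (x + d)"
  note btw = conv_antimono_between[OF bdd_avg[OF t] anti_avg[OF t]]
  have bnd: "\<bar>(avg t y + -1 * ?a) * err t y\<bar> \<le> ?b" if "x - d \<le> y" "y \<le> x" for y
  proof -
    have "avg t y \<le> avg t (x - d)" "avg t x \<le> avg t y" using antimonoD[OF anti_avg[OF t]] that by auto
    then have "\<bar>avg t y + -1 * ?a\<bar> \<le> ?b"
      using btw(1)[of "x - d"] btw(2)[of "x + d"] btw(1)[of x] btw(2)[of x] by (simp add: abs_le_iff)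
    then have "\<bar>avg t y + -1 * ?a\<bar> * \<bar>err t y\<bar> \<le> ?b * 1"
      using bound_err[OF t, of y] by (intro mult_mono) auto
    then show ?thesis by (simp add: abs_mult)
  qed
  have bb: "bdd_borel (\<lambda>y. (avg t y + -1 * ?a) * err t y)"
    by (intro bdd_borel_mult bdd_borel_add bdd_avg bdd_err bdd_borel_const t)
  have "(\<lambda>y. (avg t y + -1 * ?a) * err t y) = (\<lambda>y. avg t y * err t y - ?a * err t y)"
    by (simp add: fun_eq_iff algebra_simps)
  then have eq: "conv k (\<lambda>y. (avg t y + -1 * ?a) * err t y) x
      = conv k (\<lambda>y. avg t y * err t y) x - ?a * conv k (err t) x"
    using conv_diff[OF bdd_borel_mult[OF bdd_avg[OF t] bdd_err[OF t]] bdd_borel_cmult[OF bdd_err[OF t]] kernel]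
    by (simp add: conv_cmult)
  have "conv k (\<lambda>y. (avg t y + -1 * ?a) * err t y) x \<le> ?b"
    by (rule conv_le[OF bb]) (use bnd in \<open>blast dest: abs_le_D1\<close>)
  moreover have "- ?b \<le> conv k (\<lambda>y. (avg t y + -1 * ?a) * err t y) x"
    by (rule conv_ge[OF bb]) (use bnd in \<open>force dest: abs_le_D2\<close>)
  ultimately show ?thesis unfolding eq by (intro abs_leI) linarith+
qed

text \<open>Since \<open>flux_err\<close> is v - u^2/2 plus avg * err, the residual of the mollified
  transport equation consists of the defect and the commutator; the latter accounts for the summand
  2 d.\<close>

lemma residual_integral:
  assumes t: "0 \<le> t" and N: "0 \<le> N"
  shows "integral {-N..N} (\<lambda>x. \<bar>- conv k (flux_err t) x + conv k (avg t) x * conv k (err t) x\<bar>)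
    \<le> 2 * (c + 1/2) * (c * \<epsilon> + d) + 2 * d"
proof -
  have eq: "conv k (flux_err t) x = defect t x + conv k (\<lambda>y. avg t y * err t y) x" for x
  proof -
    have "flux_err t = (\<lambda>y. (v t y - 1/2 * (u t y * u t y)) + avg t y * err t y)"
      by (simp add: fun_eq_iff flux_err_def avg_def err_def field_simps)
    then show ?thesis unfolding defect_def
      using t by (simp only: conv_add[OF _ _ kernel] conv_diff[OF _ _ kernel] bdd_borel_diff bdd_borel_cmult
          bdd_borel_mult bdd_u bdd_v bdd_avg bdd_err)
  qed
  have pw: "\<bar>- conv k (flux_err t) x + conv k (avg t) x * conv k (err t) x\<bar>
      \<le> \<bar>defect t x\<bar> + (conv k (avg t) (x - d) - conv k (avg t) (x + d))" for x
    unfolding eq using commutator_bound[OF t, of x] by linarith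
  have c1: "continuous_on S (\<lambda>x. \<bar>defect t x\<bar>)" for S
    unfolding defect_def[abs_def]
    by (intro continuous_intros conv_continuous bdd_v bdd_borel_cmult bdd_borel_mult bdd_u t)
  have c2: "continuous_on S (\<lambda>x. conv k (avg t) (x - d) - conv k (avg t) (x + d))" for S
    by (intro continuous_intros continuous_on_compose2[OF conv_continuous[OF bdd_avg[OF t], of UNIV]]) auto
  have "integral {-N..N} (\<lambda>x. \<bar>- conv k (flux_err t) x + conv k (avg t) x * conv k (err t) x\<bar>)
    \<le> integral {-N..N} (\<lambda>x. \<bar>defect t x\<bar> + (conv k (avg t) (x - d) - conv k (avg t) (x + d)))"
    by (rule integral_le)
       (use pw in \<open>auto intro!: integrable_continuous_real continuous_on_add[OF c1 c2] continuous_intros conv_continuous bdd_flux_err bdd_avg bdd_err t\<close>)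
  also have "\<dots> = integral {-N..N} (\<lambda>x. \<bar>defect t x\<bar>) + integral {-N..N} (\<lambda>x. conv k (avg t) (x - d) - conv k (avg t) (x + d))"
    by (intro Henstock_Kurzweil_Integration.integral_add integrable_continuous_real c1 c2)
  also have "\<dots> \<le> 2 * (c + 1/2) * (c * \<epsilon> + d) + (d + d)"
    using d_pos by (intro add_mono defect_integral conv_oscillation_integral bdd_avg anti_avg bound_avg t N) auto
  finally show ?thesis by simp
qed

lemma prim_err_L1:
  assumes "0 \<le> L"
  shows "integral {-L..L} (\<lambda>x. \<bar>prim_err T x\<bar>) \<le> (2 * (c + 1/2) * (c * \<epsilon> + d) + 2 * d) * T"
proof (rule transport_L1_bound[where Et="\<lambda>t x. - conv k (flux_err t) x" and Ex="\<lambda>t. conv k (err t)"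
      and a="\<lambda>t. conv k (avg t)" and ax="\<lambda>t. conv k' (avg t)"])
  show "continuous_on ({0..T} \<times> UNIV) (\<lambda>p. - conv k (flux_err (fst p)) (snd p))"
    "continuous_on ({0..T} \<times> UNIV) (\<lambda>p. conv k (err (fst p)) (snd p))"
    "continuous_on ({0..T} \<times> UNIV) (\<lambda>p. conv k (avg (fst p)) (snd p))"
    by (intro continuous_intros conv_continuous_on[OF adm_flux_err kernel] conv_continuous_on[OF adm_err kernel]
        conv_continuous_on[OF adm_avg kernel]; auto)+
  show "prim_err 0 x = 0" for x by (simp add: prim_err_def)
  show "conv k' (avg t) x \<le> 0" if "t \<in> {0..T}" for t x
    using that by (intro conv_deriv_nonpos conv_antimono bdd_avg anti_avg) auto
  show "\<bar>conv k (avg t) x\<bar> \<le> 1/2" if "t \<in> {0..T}" for t x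
    using that by (intro conv_bound bdd_avg bound_avg) auto
  show "integral {-N..N} (\<lambda>x. \<bar>- conv k (flux_err t) x + conv k (avg t) x * conv k (err t) x\<bar>)
      \<le> 2 * (c + 1/2) * (c * \<epsilon> + d) + 2 * d" if "t \<in> {0..T}" "0 \<le> N" for t N
    using that by (intro residual_integral) auto
qed (use T assms in \<open>auto intro: prim_err_deriv_t prim_err_deriv_x conv_has_derivative prim_err_continuous bdd_avg\<close>)

text \<open>By the mean value theorem a difference quotient of the primitive with step
  \<open>h\<close> is the error at some z in (x, x + h). Moving from z back to x costs the
  oscillation of two monotone functions over [x, x + h], each of integral at most
  \<open>h\<close>.\<close>

lemma mollified_L1:
  assumes h: "0 < h" and L: "0 \<le> L"
  shows "integral {-L..L} (\<lambda>x. \<bar>conv k (u T) x - conv k (w T) x\<bar>)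
    \<le> 2 * ((2 * (c + 1/2) * (c * \<epsilon> + d) + 2 * d) * T) / h + 2 * h"
proof -
  define f g where "f = conv k (u T)" and "g = conv k (w T)"
  define KT where "KT = (2 * (c + 1/2) * (c * \<epsilon> + d) + 2 * d) * T"
  let ?E = "\<lambda>x. \<bar>prim_err T x\<bar>"
  have af: "antimono f" and ag: "antimono g"
    using T by (auto simp: f_def g_def intro!: conv_antimono bdd_u bdd_w anti anti_w)
  have cf: "continuous_on S f" and cg: "continuous_on S g" for S
    using T by (auto simp: f_def g_def intro!: conv_continuous bdd_u bdd_w)
  have cE: "continuous_on S (prim_err T)" for S
    by (rule DERIV_continuous_on[OF has_field_derivative_at_within[OF prim_err_deriv_x[OF T]]])
  \<comment> \<open>The form \<open>x - 0\<close> fits \<open>conv_oscillation_integral\<close> with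
    left shift 0.\<close>
  have pw: "h * \<bar>f x - g x\<bar> \<le> ?E (x + h) + ?E x + h * ((f (x - 0) - f (x + h)) + (g (x - 0) - g (x + h)))" for x
  proof -
    obtain z where z: "x < z" "z < x + h" "prim_err T (x + h) - prim_err T x = (x + h - x) * conv k (err T) z"
      using MVT2[of x "x + h" "prim_err T" "\<lambda>z. conv k (err T) z"] prim_err_deriv_x[OF T] h by auto
    then have 1: "prim_err T (x + h) - prim_err T x = h * (f z - g z)"
      using conv_err[OF T, of z] by (simp add: f_def g_def)
    have "f (x + h) \<le> f z" "f z \<le> f x" "g (x + h) \<le> g z" "g z \<le> g x"
      using z antimonoD[OF af] antimonoD[OF ag] by auto
    then have "\<bar>f x - g x\<bar> \<le> \<bar>f z - g z\<bar> + ((f x - f (x + h)) + (g x - g (x + h)))" by linarith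
    then have "h * \<bar>f x - g x\<bar> \<le> h * (\<bar>f z - g z\<bar> + ((f x - f (x + h)) + (g x - g (x + h))))"
      using h by (intro mult_left_mono) auto
    also have "\<dots> = \<bar>prim_err T (x + h) - prim_err T x\<bar> + h * ((f x - f (x + h)) + (g x - g (x + h)))"
      unfolding 1 using h by (simp add: abs_mult distrib_left)
    finally show ?thesis by simp
  qed
  have cs: "continuous_on S (\<lambda>x. q (x + r))" if "\<And>S. continuous_on S q" for q :: "real \<Rightarrow> real" and r S
    by (rule continuous_on_compose2[OF that[of UNIV]]) (auto intro!: continuous_intros)
  have c1: "continuous_on S (\<lambda>x. ?E (x + h))" "continuous_on S ?E"
    "continuous_on S (\<lambda>x. f (x - 0) - f (x + h))" "continuous_on S (\<lambda>x. g (x - 0) - g (x + h))" for S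
    using cs[of "prim_err T" S h, OF cE] cs[of f S h, OF cf] cs[of g S h, OF cg] cE cf cg
    by (auto intro!: continuous_intros)
  have i: "?E integrable_on {a..b}" for a b by (intro integrable_continuous_real c1)
  have 1: "integral {-L..L} ?E \<le> KT" unfolding KT_def by (rule prim_err_L1[OF L])
  have "integral {-L..L} (\<lambda>x. ?E (x + h)) = integral {-L + h..L + h} ?E"
    using integral_shift_Icc_real[of "-L" L ?E h] by (simp add: o_def add.commute)
  also have "\<dots> \<le> integral {-(L + h)..L + h} ?E"
    using h by (intro integral_subset_le i) auto
  also have "\<dots> \<le> KT" unfolding KT_def using h L by (intro prim_err_L1) auto
  finally have 2: "integral {-L..L} (\<lambda>x. ?E (x + h)) \<le> KT" .
  have 3: "integral {-L..L} (\<lambda>x. f (x - 0) - f (x + h)) \<le> 0 + h" "integral {-L..L} (\<lambda>x. g (x - 0) - g (x + h)) \<le> 0 + h"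
    unfolding f_def g_def using h L T
    by (intro conv_oscillation_integral bdd_u bdd_w anti anti_w bound bound_w; simp)+
  have "h * integral {-L..L} (\<lambda>x. \<bar>f x - g x\<bar>) = integral {-L..L} (\<lambda>x. h * \<bar>f x - g x\<bar>)" by simp
  also have "\<dots> \<le> integral {-L..L} (\<lambda>x. ?E (x + h) + ?E x + h * ((f (x - 0) - f (x + h)) + (g (x - 0) - g (x + h))))"
    by (intro integral_le integrable_continuous_real pw
        continuous_on_add continuous_on_mult continuous_on_const c1 continuous_on_rabs continuous_on_diff cf cg)
  also have "\<dots> = integral {-L..L} (\<lambda>x. ?E (x + h)) + integral {-L..L} ?E
      + h * (integral {-L..L} (\<lambda>x. f (x - 0) - f (x + h)) + integral {-L..L} (\<lambda>x. g (x - 0) - g (x + h)))"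
    by (simp only: Henstock_Kurzweil_Integration.integral_add Henstock_Kurzweil_Integration.integral_mult_right
        integrable_continuous_real c1 integrable_add integrable_on_mult_right)
  also have "\<dots> \<le> KT + KT + h * ((0 + h) + (0 + h))"
    using h by (intro add_mono mult_left_mono 1 2 3) auto
  finally have "h * integral {-L..L} (\<lambda>x. \<bar>f x - g x\<bar>) \<le> 2 * KT + h * (2 * h)" by simp
  then have "integral {-L..L} (\<lambda>x. \<bar>f x - g x\<bar>) \<le> (2 * KT + h * (2 * h)) / h"
    using h by (simp add: pos_le_divide_eq mult.commute)
  also have "\<dots> = 2 * KT / h + 2 * h" using h by (simp add: add_divide_distrib)
  finally show ?thesis by (simp add: f_def g_def KT_def)
qed

text \<open>Each of u(T, x) and w(T, x) lies between its mollified values at x + d and x, so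
  removing the mollification costs d for each function. The nonnegative integral prepares for the
  limit of large \<open>L\<close>, for which the bound is uniform.\<close>

lemma nn_integral_L1:
  assumes h: "0 < h" and L: "0 \<le> L"
  shows "(\<integral>\<^sup>+x. ennreal \<bar>u T x - w T x\<bar> * indicator {-L..L} x \<partial>lborel)
    \<le> ennreal (2 * ((2 * (c + 1/2) * (c * \<epsilon> + d) + 2 * d) * T) / h + 2 * h + 2 * d)"
proof -
  define f g where "f = conv k (u T)" and "g = conv k (w T)"
  define m where "m x = \<bar>f x - g x\<bar> + ((f (x - 0) - f (x + d)) + (g (x - 0) - g (x + d)))" for x
  note bf = conv_antimono_between[OF bdd_u[OF T] anti[OF T]] and bg = conv_antimono_between[OF bdd_w[OF T] anti_w[OF T]]
  have pw: "\<bar>u T x - w T x\<bar> \<le> m x" for x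
    using bf(1)[of x] bf(2)[of "x + d"] bg(1)[of x] bg(2)[of "x + d"] by (simp add: m_def f_def g_def)
  have cf: "continuous_on S f" and cg: "continuous_on S g" for S
    using T by (auto simp: f_def g_def intro!: conv_continuous bdd_u bdd_w)
  have c1: "continuous_on S (\<lambda>x. f (x - 0) - f (x + d))" "continuous_on S (\<lambda>x. g (x - 0) - g (x + d))"
    "continuous_on S (\<lambda>x. \<bar>f x - g x\<bar>)" for S
    by (intro continuous_intros cf cg continuous_on_compose2[OF cf[of UNIV]] continuous_on_compose2[OF cg[of UNIV]]; simp)+
  have cm: "continuous_on S m" for S unfolding m_def[abs_def] by (intro continuous_on_add c1)
  have m0: "0 \<le> m x" for x using pw[of x] by linarith
  have im: "set_integrable lborel {-L..L} m"
    unfolding set_integrable_def by (rule borel_integrable_compact) (auto intro: cm)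
  have "(\<integral>\<^sup>+x. ennreal \<bar>u T x - w T x\<bar> * indicator {-L..L} x \<partial>lborel)
     \<le> (\<integral>\<^sup>+x. ennreal (indicator {-L..L} x *\<^sub>R m x) \<partial>lborel)"
    by (rule nn_integral_mono) (auto simp: indicator_def intro!: ennreal_leI pw)
  also have "\<dots> = ennreal (LINT x:{-L..L}|lborel. m x)"
    unfolding set_lebesgue_integral_def
    by (rule nn_integral_eq_integral) (use im m0 in \<open>auto simp: set_integrable_def\<close>)
  also have "(LINT x:{-L..L}|lborel. m x) = integral {-L..L} m"
    using set_borel_integral_eq_integral(2)[OF im] .
  also have "integral {-L..L} m = integral {-L..L} (\<lambda>x. \<bar>f x - g x\<bar>)
      + (integral {-L..L} (\<lambda>x. f (x - 0) - f (x + d)) + integral {-L..L} (\<lambda>x. g (x - 0) - g (x + d)))"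
    unfolding m_def[abs_def]
    by (simp only: Henstock_Kurzweil_Integration.integral_add integrable_continuous_real c1 integrable_add)
  also have "ennreal \<dots> \<le> ennreal (2 * ((2 * (c + 1/2) * (c * \<epsilon> + d) + 2 * d) * T) / h + 2 * h + ((0 + d) + (0 + d)))"
    unfolding f_def g_def using d_pos L T
    by (intro ennreal_leI add_mono mollified_L1[OF h L] conv_oscillation_integral bdd_u bdd_w anti anti_w bound bound_w) auto
  finally show ?thesis by simp
qed

end

end

section \<open>Wasserstein distance\<close>

lemma cdf_left_mono:
  assumes "prob_space \<mu>" "sets \<mu> = sets borel"
  shows "mono (cdf_left \<mu>)"
proof (rule monoI)
  fix x y :: real assume "x \<le> y"
  interpret prob_space \<mu> by (rule assms)
  show "cdf_left \<mu> x \<le> cdf_left \<mu> y"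
    unfolding cdf_left_def by (rule finite_measure_mono) (use assms \<open>x \<le> y\<close> in auto)
qed

text \<open>For 0 < z < 1 the limits of the distribution function at both infinities make the set in
  \<open>qf\<close> nonempty and bounded below, so its infimum is meaningful. The point x =
  \<open>qf \<mu> z\<close> itself is left aside, being a null set for the integrals to
  come.\<close>

lemma cdf_left_crossing:
  assumes "prob_space \<mu>" "sets \<mu> = sets borel" "0 < z" "z < 1"
  shows "qf \<mu> z < x \<Longrightarrow> z < cdf_left \<mu> x" "x < qf \<mu> z \<Longrightarrow> cdf_left \<mu> x \<le> z"
proof -
  interpret prob_space \<mu> by (rule assms)
  interpret real_distribution \<mu> using assms(2) by unfold_locales (auto dest: sets_eq_imp_space_eq)
  have le: "cdf_left \<mu> x \<le> cdf \<mu> x" and ge: "cdf \<mu> x \<le> cdf_left \<mu> (x + 1)" for x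
    unfolding cdf_left_def cdf_def by (auto intro!: finite_measure_mono)
  have mono: "cdf_left \<mu> x \<le> cdf_left \<mu> y" if "x \<le> y" for x y
    using cdf_left_mono[OF assms(1,2)] that by (rule monoD)
  have "\<forall>\<^sub>F x in at_top. z < cdf \<mu> x"
    using cdf_lim_at_top_prob assms by (intro order_tendstoD) auto
  then obtain X where X: "z < cdf \<mu> X" by (auto simp: eventually_at_top_linorder)
  have "\<forall>\<^sub>F x in at_bot. cdf \<mu> x < z"
    using cdf_lim_at_bot assms by (intro order_tendstoD) auto
  then obtain Y where Y: "cdf \<mu> Y < z" by (auto simp: eventually_at_bot_linorder)
  let ?S = "{x. cdf_left \<mu> x > z}"
  \<comment> \<open>The limits are available for the right-continuous \<open>cdf\<close>; a shift by
    1 transfers them to \<open>cdf_left\<close>.\<close>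
  have ne: "?S \<noteq> {}" using X ge[of X] by (auto intro!: exI[of _ "X + 1"])
  have bdd: "bdd_below ?S"
  proof (rule bdd_belowI)
    fix x assume "x \<in> ?S"
    then show "Y \<le> x" using mono[of x Y] le[of Y] Y by (cases "x \<le> Y") auto
  qed
  show "z < cdf_left \<mu> x" if lt: "qf \<mu> z < x"
  proof -
    obtain s where "s \<in> ?S" "s < x" using cInf_lessD[OF ne lt[unfolded qf_def]] by blast
    then show ?thesis using mono[of s x] by simp
  qed
  show "cdf_left \<mu> x \<le> z" if "x < qf \<mu> z"
    using cInf_lower[OF _ bdd, of x] that unfolding qf_def by force
qed

text \<open>For every x between the two quantiles at level z, the level z lies between the two
  distribution functions at x. The quantile gap is thus at most the length of the x-section of the
  region between the graphs; Fubini then integrates over z first and gives the L^1 distance.\<close>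

lemma W1_le_cdf_L1:
  assumes \<mu>: "prob_space \<mu>" "sets \<mu> = sets borel" and \<nu>: "prob_space \<nu>" "sets \<nu> = sets borel"
    and le: "(\<integral>\<^sup>+x. ennreal \<bar>cdf_left \<mu> x - cdf_left \<nu> x\<bar> \<partial>lborel) \<le> ennreal B" and B: "0 \<le> B"
  shows "W1 \<mu> \<nu> \<le> B"
proof -
  let ?F = "cdf_left \<mu>" and ?G = "cdf_left \<nu>"
  have [measurable]: "?F \<in> borel_measurable borel" "?G \<in> borel_measurable borel"
    by (intro borel_measurable_mono cdf_left_mono \<mu> \<nu>)+
  let ?I = "\<lambda>z x. indicator {?G x..<?F x} z + indicator {?F x..<?G x} z :: ennreal"
  have q: "ennreal (indicator {0<..<1} z *\<^sub>R \<bar>qf \<mu> z - qf \<nu> z\<bar>) \<le> (\<integral>\<^sup>+x. ?I z x \<partial>lborel)" for z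
  proof (cases "0 < z \<and> z < 1")
    case True
    note m = cdf_left_crossing[OF \<mu>, of z] and n = cdf_left_crossing[OF \<nu>, of z]
    have gap: "ennreal (b - a) \<le> (\<integral>\<^sup>+x. ?I z x \<partial>lborel)"
      if "a \<le> b" "\<And>x. a < x \<Longrightarrow> x < b \<Longrightarrow> 1 \<le> ?I z x" for a b
    proof -
      have "ennreal (b - a) = (\<integral>\<^sup>+x. indicator {a<..<b} x \<partial>lborel)" using that(1) by simp
      also have "\<dots> \<le> (\<integral>\<^sup>+x. ?I z x \<partial>lborel)"
        by (rule nn_integral_mono) (use that(2) in \<open>auto simp: indicator_def\<close>)
      finally show ?thesis .
    qed
    show ?thesis
    proof (cases "qf \<mu> z \<le> qf \<nu> z")
      case le: True
      have "ennreal (qf \<nu> z - qf \<mu> z) \<le> (\<integral>\<^sup>+x. ?I z x \<partial>lborel)"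
        by (rule gap[OF le]) (use m n True in \<open>auto simp: indicator_def\<close>)
      then show ?thesis using True le by simp
    next
      case False
      have "ennreal (qf \<mu> z - qf \<nu> z) \<le> (\<integral>\<^sup>+x. ?I z x \<partial>lborel)"
        by (rule gap) (use m n True False in \<open>auto simp: indicator_def\<close>)
      then show ?thesis using True False by simp
    qed
  qed auto
  have "(\<integral>\<^sup>+z. ennreal (indicator {0<..<1} z *\<^sub>R \<bar>qf \<mu> z - qf \<nu> z\<bar>) \<partial>lborel)
      \<le> (\<integral>\<^sup>+z. \<integral>\<^sup>+x. ?I z x \<partial>lborel \<partial>lborel)"
    by (intro nn_integral_mono q)
  also have "\<dots> = (\<integral>\<^sup>+x. \<integral>\<^sup>+z. ?I z x \<partial>lborel \<partial>lborel)"
  proof (rule lborel_pair.Fubini'[symmetric])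
    have "(\<lambda>(z, x). ?I z x) = (\<lambda>p. indicator {p. ?G (snd p) \<le> fst p \<and> fst p < ?F (snd p)} p
        + indicator {p. ?F (snd p) \<le> fst p \<and> fst p < ?G (snd p)} p)"
      by (auto simp: indicator_def fun_eq_iff)
    also have "\<dots> \<in> borel_measurable (lborel \<Otimes>\<^sub>M lborel)" by measurable
    finally show "(\<lambda>(z, x). ?I z x) \<in> borel_measurable (lborel \<Otimes>\<^sub>M lborel)" .
  qed
  also have "(\<lambda>x. \<integral>\<^sup>+z. ?I z x \<partial>lborel) = (\<lambda>x. ennreal \<bar>?F x - ?G x\<bar>)"
  proof
    fix x
    have "(\<integral>\<^sup>+z. ?I z x \<partial>lborel) = emeasure lborel {?G x..<?F x} + emeasure lborel {?F x..<?G x}"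
      by (simp add: nn_integral_add)
    also have "\<dots> = ennreal \<bar>?F x - ?G x\<bar>"
      by (cases "?F x \<le> ?G x") (auto simp: abs_if)
    finally show "(\<integral>\<^sup>+z. ?I z x \<partial>lborel) = ennreal \<bar>?F x - ?G x\<bar>" .
  qed
  also note le
  finally have nn: "(\<integral>\<^sup>+z. ennreal (indicator {0<..<1} z *\<^sub>R \<bar>qf \<mu> z - qf \<nu> z\<bar>) \<partial>lborel) \<le> ennreal B" .
  show ?thesis
  \<comment> \<open>The case distinction avoids showing that \<open>qf\<close> is measurable:
    without integrability the Bochner integral is 0 by convention, and B is nonnegative.\<close>
  proof (cases "integrable lborel (\<lambda>z. indicator {0<..<1} z *\<^sub>R \<bar>qf \<mu> z - qf \<nu> z\<bar>)")
    case True
    have "ennreal (W1 \<mu> \<nu>) \<le> ennreal B"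
      using nn nn_integral_eq_integral[OF True] by (simp add: W1_def set_lebesgue_integral_def)
    then show ?thesis using B by (simp add: ennreal_le_iff)
  next
    case False
    then show ?thesis using B by (simp add: W1_def set_lebesgue_integral_def not_integrable_integral_eq)
  qed
qed

text \<open>Split the double integral of sgn(y - z) over y < x. Pairs with z < x cancel by
  antisymmetry, atoms included since sgn 0 = 0; pairs with z >= x contribute -F (1 - F). Then 1/8 -
  F (1 - F)/2 = (1/2 - F)^2 / 2, where 1/8 is the value of u^2/2 at minus infinity.\<close>

lemma v_init_eq:
  assumes "prob_space \<rho>" "sets \<rho> = sets borel"
  shows "v_init \<rho> x = 1/2 * (u_init \<rho> x * u_init \<rho> x)"
proof -
  interpret prob_space \<rho> by (rule assms)
  interpret PP: pair_prob_space \<rho> \<rho> ..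
  note [measurable_cong] = assms(2)
  have sp: "space \<rho> = UNIV" using sets_eq_imp_space_eq[OF assms(2)] by simp
  define F where "F = measure \<rho> {..<x}"
  have F2: "measure \<rho> {x..} = 1 - F"
    using prob_compl[of "{..<x}"] assms(2) by (simp add: F_def sp Compl_eq_Diff_UNIV[symmetric])
  let ?i = "indicator {..<x} :: real \<Rightarrow> real" and ?j = "indicator {x..} :: real \<Rightarrow> real"
  have bnd: "integrable \<rho> (\<lambda>z. g z * sgn (y - z))" if [measurable]: "g \<in> borel_measurable borel" and "\<And>z. \<bar>g z\<bar> \<le> 1" for g y
    by (rule integrable_const_bound[where B=1]) (use that(2) in \<open>auto simp: abs_mult sgn_if\<close>)
  have inner: "(LINT z|\<rho>. sgn (y - z)) = (LINT z|\<rho>. ?i z * sgn (y - z)) + (LINT z|\<rho>. ?j z * sgn (y - z))" for y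
  proof -
    have "(LINT z|\<rho>. sgn (y - z)) = (LINT z|\<rho>. ?i z * sgn (y - z) + ?j z * sgn (y - z))"
      by (rule Bochner_Integration.integral_cong) (auto simp: indicator_def)
    also have "\<dots> = (LINT z|\<rho>. ?i z * sgn (y - z)) + (LINT z|\<rho>. ?j z * sgn (y - z))"
      by (rule Bochner_Integration.integral_add) (auto intro!: bnd simp: indicator_def)
    finally show ?thesis .
  qed
  \<comment> \<open>The part with both points left of x; Fubini and renaming turn it into its own
    negative.\<close>
  define J where "J = (LINT y|\<rho>. LINT z|\<rho>. ?i y * (?i z * sgn (y - z)))"
  have intp: "integrable (\<rho> \<Otimes>\<^sub>M \<rho>) (\<lambda>(y, z). ?i y * (?i z * sgn (y - z)))"
    by (rule PP.P.integrable_const_bound[where B=1]) (auto simp: abs_mult sgn_if indicator_def)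
  have "J = (LINT z|\<rho>. LINT y|\<rho>. ?i y * (?i z * sgn (y - z)))"
    unfolding J_def using PP.Fubini_integral[OF intp] by simp
  also have "\<dots> = (LINT z|\<rho>. LINT y|\<rho>. - (?i z * (?i y * sgn (z - y))))"
    by (intro Bochner_Integration.integral_cong refl) (auto simp: sgn_if indicator_def)
  also have "\<dots> = - J" unfolding J_def by simp
  finally have J: "J = 0" by simp
  \<comment> \<open>Here y < x <= z, so the sign is constantly -1.\<close>
  have j: "?i y * (LINT z|\<rho>. ?j z * sgn (y - z)) = - (?i y * (1 - F))" for y
  proof (cases "y < x")
    case True
    have "(LINT z|\<rho>. ?j z * sgn (y - z)) = (LINT z|\<rho>. - ?j z)"
      by (rule Bochner_Integration.integral_cong) (use True in \<open>auto simp: indicator_def\<close>)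
    also have "\<dots> = - (1 - F)" using F2 assms(2) by simp
    finally show ?thesis using True by simp
  qed simp
  have ai: "integrable \<rho> (\<lambda>y. ?i y * (LINT z|\<rho>. ?i z * sgn (y - z)))"
    using PP.integrable_fst'[OF intp] by simp
  have "(LINT y:{..<x}|\<rho>. aggr_field \<rho> y) = (LINT y|\<rho>. - 1/2 * (?i y * (LINT z|\<rho>. sgn (y - z))))"
    unfolding set_lebesgue_integral_def aggr_field_def Wprime_def
    by (intro Bochner_Integration.integral_cong) auto
  also have "\<dots> = - 1/2 * (LINT y|\<rho>. ?i y * (LINT z|\<rho>. ?i z * sgn (y - z)) + - (?i y * (1 - F)))"
    unfolding inner distrib_left[of "indicator {..<x} _"] j by (rule integral_mult_right_zero)
  also have "(LINT y|\<rho>. ?i y * (LINT z|\<rho>. ?i z * sgn (y - z)) + - (?i y * (1 - F)))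
      = (LINT y|\<rho>. ?i y * (LINT z|\<rho>. ?i z * sgn (y - z))) + (LINT y|\<rho>. - (?i y * (1 - F)))"
    by (rule Bochner_Integration.integral_add[OF ai]) (use assms(2) in \<open>auto intro!: integrable_real_indicator simp: less_top[symmetric]\<close>)
  also have "(LINT y|\<rho>. ?i y * (LINT z|\<rho>. ?i z * sgn (y - z))) = J"
    by (simp add: J_def)
  also have "(LINT y|\<rho>. - (?i y * (1 - F))) = - (F * (1 - F))" using assms(2) by (simp add: F_def)
  finally have "(LINT y:{..<x}|\<rho>. aggr_field \<rho> y) = F * (1 - F) / 2" using J by simp
  then show ?thesis by (simp add: v_init_def u_init_def F_def[symmetric] field_simps)
qed

section \<open>Assembly: from cumulative variables to the distance of the measures\<close>

lemma density_of_cumulative_profile: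
  assumes "density_of_cumulative \<rho> u" "0 \<le> t"
  shows "antimono (u t)" "\<bar>u t x\<bar> \<le> 1/2" "cdf_left (\<rho> t) x = 1/2 - u t x"
proof -
  interpret prob_space "\<rho> t" using assms unfolding density_of_cumulative_def by blast
  have s: "sets (\<rho> t) = sets borel" and eq: "\<And>x. measure (\<rho> t) {..<x} = 1/2 - u t x"
    using assms unfolding density_of_cumulative_def by blast+
  show *: "cdf_left (\<rho> t) x = 1/2 - u t x" for x using eq by (simp add: cdf_left_def)
  show "antimono (u t)"
    using cdf_left_mono[OF prob_space_axioms s] unfolding mono_def antimono_def * by simp
  have "0 \<le> measure (\<rho> t) {..<x}" "measure (\<rho> t) {..<x} \<le> 1" by simp_all
  then show "\<bar>u t x\<bar> \<le> 1/2" unfolding eq by (simp add: abs_le_iff)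
qed

lemma nn_integral_le_of_bounded_intervals:
  assumes [measurable]: "f \<in> borel_measurable lborel"
    and "\<And>L. 0 \<le> L \<Longrightarrow> (\<integral>\<^sup>+x. f x * indicator {-L..L} x \<partial>lborel) \<le> B"
  shows "(\<integral>\<^sup>+(x::real). f x \<partial>lborel) \<le> B"
proof -
  have "f x = (SUP n. f x * indicator {-real n..real n} x)" for x
  proof (rule antisym)
    obtain n where "\<bar>x\<bar> \<le> real n" using real_arch_simple by blast
    then have "f x \<le> f x * indicator {-real n..real n} x" by (auto simp: abs_le_iff)
    then show "f x \<le> (SUP n. f x * indicator {-real n..real n} x)" by (rule SUP_upper2[OF UNIV_I])
    show "(SUP n. f x * indicator {-real n..real n} x) \<le> f x"
      by (intro SUP_least) (auto simp: indicator_def)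
  qed
  then have "(\<integral>\<^sup>+x. f x \<partial>lborel) = (\<integral>\<^sup>+x. (SUP n. f x * indicator {-real n..real n} x) \<partial>lborel)" by simp
  also have "\<dots> = (SUP n. \<integral>\<^sup>+x. f x * indicator {-real n..real n} x \<partial>lborel)"
    by (rule nn_integral_monotone_convergence_SUP) (auto simp: incseq_def le_fun_def indicator_def)
  also have "\<dots> \<le> B" by (intro SUP_least assms(2)) simp
  finally show ?thesis .
qed

theorem theorem2:
  fixes \<rho>0 :: "real measure" and c :: real
  assumes "P2 \<rho>0" and "c > 1/2"
  shows "\<exists>C>0. \<forall>\<epsilon>>0. \<forall>(\<rho> :: real \<Rightarrow> real measure) u (\<rho>\<epsilon> :: real \<Rightarrow> real measure) u\<epsilon> v\<epsilon>.
           burgers_entropy_solution (u_init \<rho>0) u \<and> density_of_cumulative \<rho> u \<and>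
           relax_solution c \<epsilon> (u_init \<rho>0) (v_init \<rho>0) u\<epsilon> v\<epsilon> \<and> density_of_cumulative \<rho>\<epsilon> u\<epsilon>
           \<longrightarrow> (\<forall>T>0. W1 (\<rho> T) (\<rho>\<epsilon> T) \<le> C * (sqrt (\<epsilon> * T) + \<epsilon>))"
proof -
  \<comment> \<open>The factor 2 of the interpolation times the defect constant 2 (c + 1/2) c, plus
    2 for the oscillation term 2 h.\<close>
  define C where "C = 4 * (c + 1/2) * c + 2"
  have C: "0 < C" using assms(2) unfolding C_def by (intro add_nonneg_pos mult_nonneg_nonneg) auto
  have "W1 (\<rho> T) (\<rho>\<epsilon> T) \<le> C * (sqrt (\<epsilon> * T) + \<epsilon>)"
    if eps: "0 < \<epsilon>" and b: "burgers_entropy_solution (u_init \<rho>0) w" and dw: "density_of_cumulative \<rho> w"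
      and r: "relax_solution c \<epsilon> (u_init \<rho>0) (v_init \<rho>0) u v" and du: "density_of_cumulative \<rho>\<epsilon> u" and T: "0 < T"
    for \<epsilon> T \<rho> w \<rho>\<epsilon> u v
  proof -
    have adm: "admissible u" "admissible v" "admissible w"
      and init: "\<And>x. u 0 x = u_init \<rho>0 x" "\<And>x. v 0 x = v_init \<rho>0 x" "\<And>x. w 0 x = u_init \<rho>0 x"
      using r b unfolding relax_solution_def burgers_entropy_solution_def by blast+
    have wb1: "weak_balance u v (\<lambda>t x. 0)"
      unfolding weak_balance_def
    proof (intro allI impI)
      fix \<phi> \<phi>t \<phi>x assume "test_fun \<phi> \<phi>t \<phi>x \<and> (\<forall>t x. 0 \<le> \<phi> t x)"
      then have "(LINT p|lborel. u (fst p) (snd p) * \<phi>t (fst p) (snd p) + v (fst p) (snd p) * \<phi>x (fst p) (snd p)) = 0"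
        using r unfolding relax_solution_def by blast
      then show "(LINT p|lborel. u (fst p) (snd p) * \<phi>t (fst p) (snd p) + v (fst p) (snd p) * \<phi>x (fst p) (snd p)
          + 0 * \<phi> (fst p) (snd p)) = 0" by simp
    qed
    have wb2: "weak_balance v (\<lambda>t x. c\<^sup>2 * u t x) (\<lambda>t x. 1/\<epsilon> * (1/2 * (u t x * u t x) - v t x))"
      using r unfolding relax_solution_def weak_balance_def by (simp add: power2_eq_square)
    have wbw: "weak_balance w (\<lambda>t x. 1/2 * (w t x * w t x)) (\<lambda>t x. 0)"
      using entropy_solution_weak_balance[OF b] by simp
    \<comment> \<open>Optimal interpolation step: it makes \<epsilon> T / h equal to h.\<close>
    define h where "h = sqrt (\<epsilon> * T)"
    have h: "0 < h" "h * h = \<epsilon> * T" using eps T by (auto simp: h_def)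
    have loc: "(\<integral>\<^sup>+x. ennreal \<bar>u T x - w T x\<bar> * indicator {-L..L} x \<partial>lborel) \<le> ennreal (C * h)"
      if L: "0 \<le> L" for L
    proof (rule ennreal_le_epsilon)
      fix e :: real assume e: "0 < e"
      \<comment> \<open>The coefficient of \<open>d\<close> in the bound of
        \<open>nn_integral_L1\<close>. With d = e/q all mollification errors together amount to
        exactly the allowed e.\<close>
      define q where "q = (4 * (c + 1/2) + 4) * T / h + 2"
      have q: "0 < q" using assms(2) T h by (simp add: q_def add_nonneg_pos)
      define d where "d = e / q"
      have d: "0 < d" using e q by (simp add: d_def)
      obtain k k' where "mollifier d k k'" using mollifier_exists[OF d] by blast
      then interpret mollifier d k k' .
      interpret relaxation d k k' c \<epsilon> u v
        by unfold_locales
           (use assms eps adm wb1 wb2 density_of_cumulative_profile[OF du] init in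
             \<open>auto simp: P2_def v_init_eq\<close>)
      have "(\<integral>\<^sup>+x. ennreal \<bar>u T x - w T x\<bar> * indicator {-L..L} x \<partial>lborel)
        \<le> ennreal (2 * ((2 * (c + 1/2) * (c * \<epsilon> + d) + 2 * d) * T) / h + 2 * h + 2 * d)"
        by (rule nn_integral_L1)
           (use adm wbw density_of_cumulative_profile[OF dw] init T h L in auto)
      also have "2 * ((2 * (c + 1/2) * (c * \<epsilon> + d) + 2 * d) * T) / h + 2 * h + 2 * d
        = 4 * (c + 1/2) * c * (\<epsilon> * T / h) + 2 * h + q * d"
        using h(1) by (simp add: q_def field_simps)
      also have "\<epsilon> * T / h = h" using h by (simp flip: h(2))
      also have "q * d = e" using q by (simp add: d_def)
      also have "4 * (c + 1/2) * c * h + 2 * h + e = C * h + e" by (simp add: C_def algebra_simps)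
      also have "ennreal (C * h + e) = ennreal (C * h) + ennreal e" using C h e by (intro ennreal_plus) auto
      finally show "(\<integral>\<^sup>+x. ennreal \<bar>u T x - w T x\<bar> * indicator {-L..L} x \<partial>lborel) \<le> ennreal (C * h) + ennreal e" .
    qed
    have [measurable]: "u T \<in> borel_measurable borel" "w T \<in> borel_measurable borel"
      using admissible_bdd_borel[OF adm(1), of T] admissible_bdd_borel[OF adm(3), of T] T
      by (simp_all add: bdd_borel_def)
    have "(\<integral>\<^sup>+x. ennreal \<bar>u T x - w T x\<bar> \<partial>lborel) \<le> ennreal (C * h)"
      by (rule nn_integral_le_of_bounded_intervals[OF _ loc]) measurable
    then have "(\<integral>\<^sup>+x. ennreal \<bar>cdf_left (\<rho> T) x - cdf_left (\<rho>\<epsilon> T) x\<bar> \<partial>lborel) \<le> ennreal (C * h)"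
      using T by (simp add: density_of_cumulative_profile(3)[OF dw] density_of_cumulative_profile(3)[OF du])
    then have "W1 (\<rho> T) (\<rho>\<epsilon> T) \<le> C * h"
      using dw du T C h by (intro W1_le_cdf_L1) (auto simp: density_of_cumulative_def)
    \<comment> \<open>Data at equilibrium create no initial layer, so the square root term alone
      already bounds the distance.\<close>
    also have "\<dots> \<le> C * (sqrt (\<epsilon> * T) + \<epsilon>)"
      using C eps by (simp add: h_def)
    finally show ?thesis .
  qed
  then show ?thesis using C by blast
qed

end
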